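(* Let $b\ge2$ be an integer. There are constants $\mu_\ell$ and $\sigma_\ell^2$ (depending only on $b$) such that the exponent of the largest denominator in a random composition of $1$ into $m=(b-1)n+1$ powers of $b$ is asymptotically normally distributed (as $n\to\infty$) with mean $\mu_\ell n+O(1)$ and variance $\sigma_\ell^2 n+O(1)$.
   Context: For an integer $n\ge0$ and $m=(b-1)n+1$, a composition of $1$ into $m$ powers of $b$ is an $m$-tuple $\mathbf{k}=(k_1,\ldots,k_m)$ of nonnegative integers with $b^{-k_1}+b^{-k_2}+\cdots+b^{-k_m}=1$. There are finitely many such compositions for each $n$, and a random composition is one chosen uniformly at random among them. The exponent of the largest denominator of $\mathbf{k}$ is $\max_i k_i$. A sequence of random variables $X_n$ is asymptotically normally distributed if $(X_n-\mathbb{E}X_n)/\sqrt{\mathrm{Var}\,X_n}$ converges in distribution to the standard normal distribution. *)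

theory Defs
  imports "HOL-Probability.Probability" "HOL-Library.Landau_Symbols"
begin

definition compositions :: "nat \<Rightarrow> nat \<Rightarrow> nat list set" where
  "compositions b n =
     {ks. length ks = (b - 1) * n + 1 \<and> (\<Sum>k\<leftarrow>ks. 1 / real b ^ k) = 1}"

text \<open>
  \<^const>\<open>pmf_of_set\<close> is the uniform distribution only for finite nonempty sets; both
  properties are shown below for \<open>b \<ge> 2\<close>.
\<close>
definition random_composition :: "nat \<Rightarrow> nat \<Rightarrow> nat list pmf" where
  "random_composition b n = pmf_of_set (compositions b n)"

definition largest_exponent :: "nat list \<Rightarrow> nat" where
  "largest_exponent ks = Max (set ks)"

definition asymptotically_normal :: "(nat \<Rightarrow> 'a pmf) \<Rightarrow> (nat \<Rightarrow> 'a \<Rightarrow> real) \<Rightarrow> bool" where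
  "asymptotically_normal p X \<longleftrightarrow>
     weak_conv_m
       (\<lambda>n. distr (measure_pmf (p n)) borel
          (\<lambda>\<omega>. (X n \<omega> - measure_pmf.expectation (p n) (X n))
                 / sqrt (measure_pmf.variance (p n) (X n))))
       std_normal_distribution"

lemma finite_lists_sum_inverse_powers:
  fixes t :: real
  assumes b: "b \<ge> 2"
  shows "finite {ks :: nat list. length ks = m \<and> (\<Sum>k\<leftarrow>ks. 1 / real b ^ k) = t}"
proof (induction m arbitrary: t)
  case 0
  show ?case by (rule finite_subset[of _ "{[]}"]) auto
next
  case (Suc m)
  let ?S = "\<lambda>m t. {ks :: nat list. length ks = m \<and> (\<Sum>k\<leftarrow>ks. 1 / real b ^ k) = t}"
  define K where "K = nat \<lceil>(real m + 1) / t\<rceil>"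
  let ?T = "SIGMA i:{..m}. SIGMA k:{..K}. ?S m (t - 1 / real b ^ k)"
  let ?f = "\<lambda>(i, k, l). take i l @ k # drop i l"
  have "?S (Suc m) t \<subseteq> ?f ` ?T"
  proof
    fix ks assume ks: "ks \<in> ?S (Suc m) t"
    then have len: "length ks = Suc m" and sum: "(\<Sum>k\<leftarrow>ks. 1 / real b ^ k) = t" by auto
    define k where "k = Min (set ks)"
    have ne: "ks \<noteq> []" using len by auto
    then have kin: "k \<in> set ks" unfolding k_def by (intro Min_in) auto
    then obtain i where i: "i < length ks" "ks ! i = k" by (auto simp: in_set_conv_nth)
    define l where "l = take i ks @ drop (Suc i) ks"
    have split: "ks = take i ks @ k # drop (Suc i) ks"
      using i by (metis id_take_nth_drop)
    have "(\<Sum>k\<leftarrow>ks. 1 / real b ^ k) = (\<Sum>k\<leftarrow>take i ks @ k # drop (Suc i) ks. 1 / real b ^ k)"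
      using split by metis
    then have suml: "(\<Sum>k\<leftarrow>l. 1 / real b ^ k) = t - 1 / real b ^ k"
      using sum by (simp add: l_def)
    have lenl: "length l = m" using i len by (simp add: l_def)
    have "(\<Sum>j\<leftarrow>ks. 1 / real b ^ j) \<le> (\<Sum>j\<leftarrow>ks. 1 / real b ^ k)"
    proof (rule sum_list_mono)
      fix j assume "j \<in> set ks"
      then have "k \<le> j" by (simp add: k_def)
      then show "1 / real b ^ j \<le> 1 / real b ^ k"
        using b by (intro divide_left_mono power_increasing) auto
    qed
    then have t_le: "t \<le> (real m + 1) / real b ^ k"
      using sum len by (simp add: sum_list_triv add.commute)
    have "1 / real b ^ k \<le> (\<Sum>j\<leftarrow>ks. 1 / real b ^ j)"
      using kin by (intro member_le_sum_list) auto
    moreover have "0 < 1 / real b ^ k" using b by simp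
    ultimately have tpos: "t > 0" using sum by linarith
    have "real b ^ k \<le> (real m + 1) / t"
      using t_le tpos b by (simp add: field_simps)
    moreover have "real k < real b ^ k"
    proof -
      have "k < 2 ^ k" by simp
      also have "(2::nat) ^ k \<le> b ^ k" using b by (rule power_mono) simp
      finally show ?thesis by (metis of_nat_less_iff of_nat_power)
    qed
    ultimately have "real k \<le> (real m + 1) / t" by linarith
    then have "k \<le> K" unfolding K_def by linarith
    moreover have "?f (i, k, l) = ks"
      using i split by (simp add: l_def)
    ultimately show "ks \<in> ?f ` ?T"
      using i len lenl suml by (intro image_eqI[of _ _ "(i, k, l)"]) auto
  qed
  moreover have "finite ?T" using Suc.IH by (intro finite_SigmaI) auto
  ultimately show ?case by (meson finite_imageI finite_subset)
qed

lemma finite_compositions: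
  assumes "b \<ge> 2"
  shows "finite (compositions b n)"
  using finite_lists_sum_inverse_powers[OF assms] unfolding compositions_def .

lemma compositions_nonempty:
  assumes b: "b \<ge> 2"
  shows "compositions b n \<noteq> {}"
proof (induction n)
  case 0
  have "[0] \<in> compositions b 0" by (simp add: compositions_def)
  then show ?case by blast
next
  case (Suc n)
  then obtain ks where ks: "ks \<in> compositions b n" by blast
  then obtain k l where kl: "ks = k # l" by (cases ks) (auto simp: compositions_def)
  have "replicate b (Suc k) @ l \<in> compositions b (Suc n)"
    using ks b by (auto simp: kl compositions_def sum_list_replicate)
  then show ?case by blast
qed

end

theory Submission
  imports Defs "HOL-Complex_Analysis.Complex_Analysis"
begin

text \<open>
  Read the parts of a composition with largest exponent L as the depths of the leaves of a b-ary
  tree of height L. Let i_j be the number of internal nodes at level j. Then i_0 = 1, the i_j sum to n, level j + 1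
  carries b i_j - i_{j+1} leaves, and there are m! \<Prod> 1/(b i_j - i_{j+1})! compositions with
  the given sequence. So L is the length of a random path weighted by a transfer operator. Cutting
  the path at its visits to state 1 gives a renewal equation p = \<gamma> + \<phi> * p for the generating
  polynomials p_n(s) = \<Sum> weight e^{sL}. The weights of large states are superexponentially
  small, so the excursion series \<Sum> \<phi>_n(s) q^n converges beyond the point q_0 at which it
  equals 1 for s = 0. Its root Q(s) near q_0 is then a simple dominant pole of
  \<Sum> p_n(s) q^n, depends holomorphically on s, and p_n(s) = c(s) Q(s)^{-n} (1 + O(\<rho>^n)) uniformly
  for s near 0. The logarithm of the moment generating function is therefore n \<alpha>(s) + O(1), and
  Cauchy estimates give the mean, the variance and, through the characteristic functions, the
  limit law. The variance is of linear order because the excursions (1) and (1, 2) have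
  different ratios of length to sum of states.
\<close>

section \<open>Power series depending holomorphically on a parameter\<close>

text \<open>The state space is infinite, so no finite transfer matrix supplies a dominant
  eigenvalue; taking state 1 as a renewal point leaves one scalar equation instead. The crux is that
  the excursion series reaches 1 strictly inside its disc of convergence. No radius is computed:
  convergence at any q >= 0 is shown to extend to some larger q'. Were the series at most 1 wherever
  it converges, it would converge at the supremum of these points too, and hence beyond it. The
  extension compares partial sums with a supersolution of the recursion, which needs no operator
  theory. Uniformity in s turns the pole into a quasi-power: the constants of the pole estimate are
  fixed once for a whole ball of s, and logarithms are only taken of functions within 1/2 of 1. The
  root of the tree, state 1, is not counted in the sum along a path, so paths with sum n belong to
  compositions of index n + 1.\<close>

locale power_series_family =
  fixes \<phi> :: "nat \<Rightarrow> complex \<Rightarrow> complex" and R C \<epsilon> :: real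
  assumes R_pos: "R > 0"
    and holo: "\<And>n. \<phi> n holomorphic_on ball 0 \<epsilon>"
    and bound: "\<And>n s. s \<in> ball 0 \<epsilon> \<Longrightarrow> norm (\<phi> n s) \<le> C / R ^ n"
begin

definition series :: "complex \<Rightarrow> complex \<Rightarrow> complex" where
  "series q s = (\<Sum>n. \<phi> n s * q ^ n)"

lemma term_bound:
  assumes "s \<in> ball 0 \<epsilon>" "norm q \<le> r"
  shows "norm (\<phi> n s * q ^ n) \<le> C * (r / R) ^ n"
proof -
  have "norm (\<phi> n s) * norm q ^ n \<le> C / R ^ n * r ^ n"
    using bound[OF assms(1), of n] assms(2) norm_ge_zero[of "\<phi> n s"]
    by (intro mult_mono power_mono) (auto intro: order_trans[OF norm_ge_zero])
  then show ?thesis by (simp add: norm_mult norm_power power_divide)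
qed

lemma summable_bound:
  assumes "0 \<le> r" "r < R"
  shows "summable (\<lambda>n. C * (r / R) ^ n)"
  using assms by (intro summable_mult summable_geometric) auto

lemma summable_terms:
  assumes "s \<in> ball 0 \<epsilon>" "norm q < R"
  shows "summable (\<lambda>n. \<phi> n s * q ^ n)"
  using assms
  by (intro summable_comparison_test'[OF summable_bound[of "norm q"], of 0] term_bound) auto

lemma sums_series:
  assumes "s \<in> ball 0 \<epsilon>" "norm q < R"
  shows "(\<lambda>n. \<phi> n s * q ^ n) sums series q s"
  using summable_terms[OF assms] by (simp add: series_def summable_sums)

lemma norm_series_le:
  assumes "s \<in> ball 0 \<epsilon>" "norm q \<le> r" "r < R"
  shows "norm (series q s) \<le> (\<Sum>n. C * (r / R) ^ n)"
  unfolding series_def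
  using assms norm_ge_zero[of q]
  by (intro norm_suminf_le summable_bound term_bound) linarith+

lemma uniform_limit_series:
  assumes r: "0 \<le> r" "r < R" and A: "\<And>x. x \<in> A \<Longrightarrow> norm (f x) \<le> r \<and> g x \<in> ball 0 \<epsilon>"
  shows "uniform_limit A (\<lambda>N x. \<Sum>n<N. \<phi> n (g x) * f x ^ n) (\<lambda>x. series (f x) (g x)) sequentially"
  unfolding series_def
  by (rule Weierstrass_m_test[OF _ summable_bound[OF r]]) (use A term_bound in blast)

text \<open>Both arguments may move with s, because Newton iterates and finally the root Q(s) are
  substituted for q. The fixed radius r < R makes the Weierstrass test uniform.\<close>

lemma holomorphic_series_compose:
  assumes "open U" and r: "0 \<le> r" "r < R"
    and h: "h holomorphic_on U" and g: "g holomorphic_on U"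
    and U: "\<And>s. s \<in> U \<Longrightarrow> norm (h s) \<le> r \<and> g s \<in> ball 0 \<epsilon>"
  shows "(\<lambda>s. series (h s) (g s)) holomorphic_on U"
proof (rule holomorphic_uniform_sequence[OF \<open>open U\<close>])
  fix N
  have "(\<lambda>s. \<phi> n (g s)) holomorphic_on U" for n
    using holomorphic_on_compose_gen[OF g holo[of n]] U unfolding o_def by blast
  then show "(\<lambda>s. \<Sum>n<N. \<phi> n (g s) * h s ^ n) holomorphic_on U"
    by (intro holomorphic_intros h)
next
  fix x assume "x \<in> U"
  then obtain d where d: "d > 0" "cball x d \<subseteq> U" using \<open>open U\<close> open_contains_cball by blast
  have "uniform_limit (cball x d) (\<lambda>N s. \<Sum>n<N. \<phi> n (g s) * h s ^ n) (\<lambda>s. series (h s) (g s)) sequentially"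
    by (rule uniform_limit_series[OF r]) (use U d in auto)
  then show "\<exists>d>0. cball x d \<subseteq> U \<and>
      uniform_limit (cball x d) (\<lambda>N s. \<Sum>n<N. \<phi> n (g s) * h s ^ n) (\<lambda>s. series (h s) (g s)) sequentially"
    using d by blast
qed

lemma holomorphic_series_left:
  assumes s: "s \<in> ball 0 \<epsilon>"
  shows "(\<lambda>q. series q s) holomorphic_on ball 0 R"
proof -
  have "(\<lambda>q. series q s) holomorphic_on ball 0 r" if "0 \<le> r" "r < R" for r
    by (rule holomorphic_series_compose[OF _ that, where g = "\<lambda>_. s" and h = "\<lambda>q. q"])
       (use s in \<open>auto\<close>)
  then have "(\<lambda>q. series q s) field_differentiable at q" if "norm q < R" for q
  proof -
    obtain r where r: "norm q < r" "r < R" using dense \<open>norm q < R\<close> by blast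
    then have "(\<lambda>q. series q s) holomorphic_on ball 0 r"
      using \<open>\<And>r. \<lbrakk>0 \<le> r; r < R\<rbrakk> \<Longrightarrow> _\<close> norm_ge_zero[of q] by (meson le_less_trans less_imp_le)
    then show ?thesis using r holomorphic_on_imp_differentiable_at by auto
  qed
  then show ?thesis by (simp add: holomorphic_on_def field_differentiable_at_within)
qed

lemma continuous_on_series:
  assumes r: "0 \<le> r" "r < R"
  shows "continuous_on (cball 0 r \<times> ball 0 \<epsilon>) (\<lambda>x. series (fst x) (snd x))"
proof (rule uniform_limit_theorem[OF _ uniform_limit_series[OF r]])
  have "continuous_on (cball 0 r \<times> ball 0 \<epsilon>) (\<lambda>x. \<phi> n (snd x))" for n
    by (rule continuous_on_compose2[OF holomorphic_on_imp_continuous_on[OF holo[of n]]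
      continuous_on_snd[OF continuous_on_id]]) auto
  then show "\<forall>\<^sub>F N in sequentially. continuous_on (cball 0 r \<times> ball 0 \<epsilon>) (\<lambda>x. \<Sum>n<N. \<phi> n (snd x) * fst x ^ n)"
    by (intro always_eventually allI continuous_intros)
qed auto

lemma fps_expansion_series:
  assumes s: "s \<in> ball 0 \<epsilon>"
  shows "(\<lambda>q. series q s) has_fps_expansion Abs_fps (\<lambda>n. \<phi> n s)"
proof (rule has_fps_expansionI)
  have "eventually (\<lambda>q. q \<in> ball 0 R) (nhds (0::complex))"
    using R_pos by (intro eventually_nhds_in_open) auto
  then show "\<forall>\<^sub>F q in nhds 0. (\<lambda>n. fps_nth (Abs_fps (\<lambda>n. \<phi> n s)) n * q ^ n) sums series q s"
    by eventually_elim (use sums_series[OF s] in auto)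
qed

lemma deriv_series:
  assumes s: "s \<in> ball 0 \<epsilon>" and q: "norm q < R"
  shows "((\<lambda>q. series q s) has_field_derivative (\<Sum>n. of_nat (Suc n) * \<phi> (Suc n) s * q ^ n)) (at q)"
proof -
  obtain K where K: "norm q < K" "K < R" using dense q by blast
  have "0 < K" using K norm_ge_zero[of q] by linarith
  have "((\<lambda>q. \<Sum>n. \<phi> n s * q ^ n) has_field_derivative (\<Sum>n. diffs (\<lambda>n. \<phi> n s) n * q ^ n)) (at q)"
  proof (rule termdiffs_strong)
    show "summable (\<lambda>n. \<phi> n s * complex_of_real K ^ n)"
      using K \<open>0 < K\<close> by (intro summable_terms[OF s]) simp
    show "norm q < norm (complex_of_real K)" using K norm_ge_zero[of q] by simp
  qed
  then show ?thesis by (simp add: series_def diffs_def)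
qed

end

text \<open>The factor n from differentiation is paid for by shrinking the radius:
  \<open>n * (R' / R) ^ n\<close> is bounded.\<close>

lemma power_series_family_deriv:
  assumes "power_series_family \<phi> R C \<epsilon>" "0 < R'" "R' < R"
  obtains C' where "power_series_family (\<lambda>n s. of_nat (Suc n) * \<phi> (Suc n) s) R' C' \<epsilon>"
proof -
  interpret power_series_family \<phi> R C \<epsilon> by fact
  have "(\<lambda>n. real n * (R' / R) ^ n) \<longlonglongrightarrow> 0"
    using assms by (intro powser_times_n_limit_0) simp
  then have "Bseq (\<lambda>n. real n * (R' / R) ^ n)"
    by (intro convergent_imp_Bseq) (auto simp: convergent_def)
  then obtain B where B: "B > 0" "\<And>n. \<bar>real n * (R' / R) ^ n\<bar> \<le> B" by (auto simp: Bseq_def)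
  have "power_series_family (\<lambda>n s. of_nat (Suc n) * \<phi> (Suc n) s) R' (\<bar>C\<bar> * B / R') \<epsilon>"
  proof
    show "(\<lambda>s. of_nat (Suc n) * \<phi> (Suc n) s) holomorphic_on ball 0 \<epsilon>" for n
      by (intro holomorphic_intros holo)
    fix n and s :: complex assume s: "s \<in> ball 0 \<epsilon>"
    have "norm (of_nat (Suc n) * \<phi> (Suc n) s) \<le> real (Suc n) * (\<bar>C\<bar> / R ^ Suc n)"
      unfolding norm_mult norm_of_nat using bound[OF s, of "Suc n"] R_pos
      by (intro mult_left_mono) (auto intro!: order_trans[OF bound[OF s]] divide_right_mono)
    also have "\<dots> = \<bar>C\<bar> * (real (Suc n) * (R' / R) ^ Suc n) / R' / R' ^ n"
      using assms by (simp add: power_divide field_simps)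
    also have "\<dots> \<le> \<bar>C\<bar> * B / R' / R' ^ n"
      using B(2)[of "Suc n"] assms by (intro divide_right_mono mult_left_mono) auto
    finally show "norm (of_nat (Suc n) * \<phi> (Suc n) s) \<le> \<bar>C\<bar> * B / R' / R' ^ n" .
  qed (use assms in auto)
  then show ?thesis by (rule that)
qed

section \<open>The dominant root\<close>

lemma continuous_on_product_nhd:
  fixes f :: "complex \<times> complex \<Rightarrow> complex"
  assumes "continuous_on (cball 0 r \<times> ball 0 \<epsilon>) f" "norm q < r" "0 < \<epsilon>" "0 < e"
  obtains d where "d > 0" "d \<le> \<epsilon>" "norm q + d \<le> r"
    "\<And>z s. norm (z - q) \<le> d \<Longrightarrow> norm s < d \<Longrightarrow> norm (f (z, s) - f (q, 0)) < e"
proof -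
  have "continuous_on (ball 0 r \<times> ball 0 \<epsilon>) f"
    by (rule continuous_on_subset[OF assms(1)]) auto
  then have "isCont f (q, 0)"
    using assms by (subst (asm) continuous_on_eq_continuous_at) (auto intro: open_Times)
  then obtain d where d: "d > 0" "\<And>x. dist x (q, 0) < d \<Longrightarrow> dist (f x) (f (q, 0)) < e"
    using \<open>0 < e\<close> unfolding continuous_at_eps_delta by blast
  \<comment> \<open>A third for each coordinate keeps the pair strictly within d although the bound
    on z is not strict; the other terms keep the box inside the domain.\<close>
  let ?d = "min (d / 3) (min \<epsilon> (r - norm q))"
  show ?thesis
  proof (rule that[of ?d])
    fix z s :: complex assume z: "norm (z - q) \<le> ?d" and s: "norm s < ?d"
    have "dist (z, s) (q, 0) = norm (z - q, s)" by (simp add: dist_norm)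
    also have "\<dots> \<le> norm (z - q) + norm s" by (rule norm_Pair_le)
    also have "\<dots> < d" using z s d(1) by auto
    finally show "norm (f (z, s) - f (q, 0)) < e" using d(2) by (simp add: dist_norm)
  qed (use d assms in auto)
qed

text \<open>An implicit function theorem with explicit constants. The q-derivative A at (q0, 0) is
  positive since the coefficients are nonnegative and \<open>a 1 > 0\<close>. Where it varies by
  less than A / 2, the map \<open>series - A * q\<close> is Lipschitz with constant A / 2. This
  gives both the contraction that produces Q and the last conclusion, which makes the root unique in
  the disc and simple.\<close>

lemma holomorphic_root:
  assumes F: "power_series_family \<phi> R C \<epsilon>" and \<epsilon>: "0 < \<epsilon>" and q0: "0 < q0" "q0 < R"
    and real: "\<And>n. \<phi> n 0 = of_real (a n)" and nonneg: "\<And>n. a n \<ge> 0" and a1: "a 1 > 0"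
    and sum1: "(\<lambda>n. a n * q0 ^ n) sums 1"
  obtains \<delta> \<epsilon>' A Q where "0 < \<delta>" "q0 + \<delta> < R" "0 < \<epsilon>'" "\<epsilon>' \<le> \<epsilon>" "0 < A" "Q holomorphic_on ball 0 \<epsilon>'"
    "Q 0 = of_real q0"
    "\<And>s. s \<in> ball 0 \<epsilon>' \<Longrightarrow> Q s \<in> cball (of_real q0) \<delta> \<and> power_series_family.series \<phi> (Q s) s = 1"
    "\<And>s z w. s \<in> ball 0 \<epsilon>' \<Longrightarrow> z \<in> cball (of_real q0) \<delta> \<Longrightarrow> w \<in> cball (of_real q0) \<delta> \<Longrightarrow>
      A * norm (z - w) \<le> norm (power_series_family.series \<phi> z s - power_series_family.series \<phi> w s)"
proof -
  interpret F: power_series_family \<phi> R C \<epsilon> by fact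
  let ?q0 = "complex_of_real q0"
  obtain R' where R': "q0 < R'" "R' < R" using q0 dense by blast
  obtain C' where "power_series_family (\<lambda>n s. of_nat (Suc n) * \<phi> (Suc n) s) R' C' \<epsilon>"
    using power_series_family_deriv[OF F, of R'] R' q0 by auto
  then interpret D: power_series_family "\<lambda>n s. of_nat (Suc n) * \<phi> (Suc n) s" R' C' \<epsilon> .
  have dF: "((\<lambda>q. F.series q s) has_field_derivative D.series q s) (at q)"
    if "s \<in> ball 0 \<epsilon>" "norm q < R'" for s q
    unfolding D.series_def using F.deriv_series[of s q] that R' by simp
  have F0: "F.series ?q0 0 = 1"
  proof -
    have "(\<lambda>n. complex_of_real (a n * q0 ^ n)) sums of_real 1"
      using sum1 by (subst sums_of_real_iff)
    then show ?thesis using F.sums_series[of 0 ?q0] \<epsilon> q0 by (simp add: real sums_iff)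
  qed
  obtain A where A: "D.series ?q0 0 = of_real A" "A > 0"
  proof -
    have "(\<lambda>n. complex_of_real (real (Suc n) * a (Suc n) * q0 ^ n)) sums D.series ?q0 0"
      using D.sums_series[of 0 ?q0] \<epsilon> q0 R' by (simp add: real)
    moreover from this have sm: "summable (\<lambda>n. real (Suc n) * a (Suc n) * q0 ^ n)"
      using summable_of_real_iff sums_summable by blast
    ultimately have "D.series ?q0 0 = of_real (\<Sum>n. real (Suc n) * a (Suc n) * q0 ^ n)"
      by (simp add: sums_iff suminf_of_real)
    moreover have "(\<Sum>n. real (Suc n) * a (Suc n) * q0 ^ n) > 0"
      by (rule suminf_pos2[OF sm, of 0]) (use nonneg a1 q0 in auto)
    ultimately show ?thesis using that by blast
  qed
  obtain r where r: "q0 < r" "r < R'" using R' dense by blast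
  obtain d1 where d1: "d1 > 0" "d1 \<le> \<epsilon>" "q0 + d1 \<le> r"
    "\<And>z s. norm (z - ?q0) \<le> d1 \<Longrightarrow> norm s < d1 \<Longrightarrow> norm (D.series z s - of_real A) < A / 2"
    using continuous_on_product_nhd[OF D.continuous_on_series[of r], of ?q0 "A / 2"] r q0 \<epsilon> A
    by auto
  \<comment> \<open>The bound \<open>A * d1 / 4\<close> makes the first Newton step from q0 at most
    \<open>d1 / 4\<close> long; together with contraction by 1/2 the iterates stay in the disc of
    radius \<open>d1\<close>.\<close>
  obtain d2 where d2: "d2 > 0" "d2 \<le> \<epsilon>" "q0 + d2 \<le> r"
    "\<And>z s. norm (z - ?q0) \<le> d2 \<Longrightarrow> norm s < d2 \<Longrightarrow> norm (F.series z s - 1) < A * d1 / 4"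
    using continuous_on_product_nhd[OF F.continuous_on_series[of r], of ?q0 "A * d1 / 4"] r R' q0 \<epsilon> A d1 F0
    by auto
  define \<epsilon>' where "\<epsilon>' = min d1 d2"
  have \<epsilon>': "0 < \<epsilon>'" "\<epsilon>' \<le> \<epsilon>" using d1 d2 by (auto simp: \<epsilon>'_def)
  have lip: "norm ((F.series z s - A * z) - (F.series w s - A * w)) \<le> A / 2 * norm (z - w)"
    if s: "s \<in> ball 0 \<epsilon>'" and z: "z \<in> cball ?q0 d1" and w: "w \<in> cball ?q0 d1" for s z w :: complex
  proof (rule field_differentiable_bound[where f = "\<lambda>z. F.series z s - A * z" and f' = "\<lambda>z. D.series z s - A",
        OF convex_cball _ _ z w])
    fix x assume x: "x \<in> cball ?q0 d1"
    have "norm x \<le> norm ?q0 + norm (x - ?q0)" by (rule norm_triangle_sub)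
    also have "\<dots> \<le> q0 + d1" using x q0 by (simp add: dist_norm norm_minus_commute)
    finally have xR: "norm x < R'" using d1(3) r by linarith
    show "((\<lambda>z. F.series z s - A * z) has_field_derivative (D.series x s - A)) (at x within cball ?q0 d1)"
      by (rule has_field_derivative_at_within, intro DERIV_diff dF DERIV_cmult_Id) (use s \<epsilon>' xR in auto)
    show "norm (D.series x s - A) \<le> A / 2"
      by (rule less_imp_le[OF d1(4)]) (use x s in \<open>auto simp: dist_norm norm_minus_commute \<epsilon>'_def\<close>)
  qed
  have expand: "A / 2 * norm (z - w) \<le> norm (F.series z s - F.series w s)"
    if "s \<in> ball 0 \<epsilon>'" "z \<in> cball ?q0 d1" "w \<in> cball ?q0 d1" for s z w :: complex
  proof -
    have "norm (A * (z - w)) \<le> norm (F.series z s - F.series w s) + norm (F.series z s - F.series w s - A * (z - w))"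
      using norm_triangle_sub[of "A * (z - w)" "F.series z s - F.series w s"] by (simp add: norm_minus_commute[of "A * (z - w)"])
    also have "norm (F.series z s - F.series w s - A * (z - w)) \<le> A / 2 * norm (z - w)"
      using lip[OF that] by (simp add: algebra_simps)
    finally show ?thesis using A(2) by (simp add: norm_mult)
  qed
  text \<open>Newton iteration with the derivative frozen at (q0, 0): a contraction whose iterates are holomorphic in s.\<close>
  define T where "T s z = z - (F.series z s - 1) / A" for s z :: complex
  have T_lip: "norm (T s z - T s w) \<le> norm (z - w) / 2"
    if "s \<in> ball 0 \<epsilon>'" "z \<in> cball ?q0 d1" "w \<in> cball ?q0 d1" for s z w :: complex
  proof -
    have "T s z - T s w = - (((F.series z s - A * z) - (F.series w s - A * w)) / A)"
      using A(2) by (simp add: T_def diff_divide_distrib)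
    then have "norm (T s z - T s w) = norm ((F.series z s - A * z) - (F.series w s - A * w)) / A"
      using A(2) by (simp only: norm_minus_cancel norm_divide) simp
    also have "\<dots> \<le> A / 2 * norm (z - w) / A"
      using A(2) by (intro divide_right_mono lip that) auto
    finally show ?thesis using A(2) by simp
  qed
  have T_q0: "norm (T s ?q0 - ?q0) \<le> d1 / 2" if "s \<in> ball 0 \<epsilon>'" for s
  proof -
    have "norm (F.series ?q0 s - 1) / A \<le> A * d1 / 4 / A"
      using d2(4)[of ?q0 s] d2(1) that A(2) by (intro divide_right_mono) (auto simp: \<epsilon>'_def)
    then have "norm (F.series ?q0 s - 1) / A \<le> d1 / 4" using A(2) by simp
    then have "norm (F.series ?q0 s - 1) / A \<le> d1 / 2" using d1(1) by linarith
    then show ?thesis using A(2) by (simp add: T_def norm_divide)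
  qed
  have T_maps: "T s z \<in> cball ?q0 d1" if "s \<in> ball 0 \<epsilon>'" "z \<in> cball ?q0 d1" for s z :: complex
  proof -
    have "norm (T s z - ?q0) \<le> norm (T s z - T s ?q0) + norm (T s ?q0 - ?q0)"
      using norm_triangle_ineq[of "T s z - T s ?q0" "T s ?q0 - ?q0"] by simp
    also have "\<dots> \<le> norm (z - ?q0) / 2 + d1 / 2"
      using T_lip[OF that, of ?q0] T_q0[OF that(1)] d1 by (intro add_mono) auto
    also have "\<dots> \<le> d1" using that(2) by (simp add: dist_norm norm_minus_commute)
    finally show ?thesis by (simp add: dist_norm norm_minus_commute)
  qed
  define P where "P k s = (T s ^^ k) ?q0" for k s
  have P_0: "P 0 s = ?q0" and P_Suc: "P (Suc k) s = T s (P k s)" for k s by (simp_all add: P_def)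
  have P_in: "P k s \<in> cball ?q0 d1" if "s \<in> ball 0 \<epsilon>'" for k s
    using that d1 by (induction k) (auto simp: P_0 P_Suc simp del: mem_cball intro: T_maps)
  have P_holo: "P k holomorphic_on ball 0 \<epsilon>'" for k
  proof (induction k)
    case 0
    then show ?case by (simp add: P_def[abs_def])
  next
    case (Suc k)
    have "(\<lambda>s. F.series (P k s) s) holomorphic_on ball 0 \<epsilon>'"
    proof (rule F.holomorphic_series_compose[OF _ _ _ Suc])
      fix s :: complex assume s: "s \<in> ball 0 \<epsilon>'"
      have "norm (P k s) \<le> norm ?q0 + norm (P k s - ?q0)" by (rule norm_triangle_sub)
      also have "\<dots> \<le> q0 + d1" using P_in[OF s, of k] q0 by (simp add: dist_norm norm_minus_commute)
      finally show "norm (P k s) \<le> r \<and> s \<in> ball 0 \<epsilon>" using d1 s \<epsilon>' by auto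
    qed (use r R' q0 in auto)
    then show ?case using A(2) Suc
      by (simp add: P_Suc[abs_def] T_def) (intro holomorphic_intros; simp)
  qed
  have P_diff: "norm (P (Suc k) s - P k s) \<le> d1 * (1 / 2) ^ k" if s: "s \<in> ball 0 \<epsilon>'" for k s
  proof (induction k)
    case 0
    then show ?case using T_q0[OF s] d1(1) by (simp add: P_0 P_Suc)
  next
    case (Suc k)
    have "norm (P (Suc (Suc k)) s - P (Suc k) s) \<le> norm (P (Suc k) s - P k s) / 2"
      using T_lip[OF s P_in[OF s, of "Suc k"] P_in[OF s, of k]] by (simp add: P_Suc)
    then show ?case using Suc by simp
  qed
  \<comment> \<open>The limit of the iterates is written as a telescoping series so that the
    geometric bound \<open>P_diff\<close> gives uniform convergence in s.\<close>
  define Q where "Q s = ?q0 + (\<Sum>k. P (Suc k) s - P k s)" for s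
  have tele: "?q0 + (\<Sum>k<N. P (Suc k) s - P k s) = P N s" for N s
    using sum_lessThan_telescope[of "\<lambda>k. P k s" N] by (simp add: P_0)
  have ul: "uniform_limit (ball 0 \<epsilon>') P Q sequentially"
  proof -
    have "uniform_limit (ball 0 \<epsilon>') (\<lambda>N s. \<Sum>k<N. P (Suc k) s - P k s) (\<lambda>s. \<Sum>k. P (Suc k) s - P k s) sequentially"
      by (rule Weierstrass_m_test[OF P_diff]) (auto intro!: summable_mult)
    then have "uniform_limit (ball 0 \<epsilon>') (\<lambda>N s. ?q0 + (\<Sum>k<N. P (Suc k) s - P k s)) Q sequentially"
      unfolding Q_def[abs_def] by (intro uniform_limit_intros)
    then show ?thesis by (simp only: tele)
  qed
  have Q_lim: "(\<lambda>k. P k s) \<longlonglongrightarrow> Q s" if "s \<in> ball 0 \<epsilon>'" for s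
    using tendsto_uniform_limitI[OF ul that] .
  have Q_in: "Q s \<in> cball ?q0 d1" if "s \<in> ball 0 \<epsilon>'" for s
    by (rule Lim_in_closed_set[OF closed_cball _ _ Q_lim[OF that]]) (use P_in[OF that] in auto)
  have Q_holo: "Q holomorphic_on ball 0 \<epsilon>'"
  proof (rule holomorphic_uniform_sequence[OF open_ball P_holo])
    fix x :: complex assume "x \<in> ball 0 \<epsilon>'"
    then obtain d where "d > 0" "cball x d \<subseteq> ball 0 \<epsilon>'" using open_contains_cball open_ball by blast
    then show "\<exists>d>0. cball x d \<subseteq> ball 0 \<epsilon>' \<and> uniform_limit (cball x d) P Q sequentially"
      using uniform_limit_on_subset[OF ul] by blast
  qed
  have Q_root: "F.series (Q s) s = 1" if s: "s \<in> ball 0 \<epsilon>'" for s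
  proof -
    have "norm (Q s) \<le> norm ?q0 + norm (Q s - ?q0)" by (rule norm_triangle_sub)
    also have "\<dots> \<le> q0 + d1" using Q_in[OF s] q0 by (simp add: dist_norm norm_minus_commute)
    finally have "norm (Q s) < R'" using d1 r by linarith
    then have "isCont (\<lambda>q. F.series q s) (Q s)" using dF[of s "Q s"] s \<epsilon>' DERIV_isCont by auto
    then have "(\<lambda>k. F.series (P k s) s) \<longlonglongrightarrow> F.series (Q s) s"
      by (rule isCont_tendsto_compose[OF _ Q_lim[OF s]])
    then have "(\<lambda>k. T s (P k s)) \<longlonglongrightarrow> T s (Q s)"
      unfolding T_def using A(2) by (intro tendsto_diff tendsto_divide tendsto_const Q_lim s) auto
    moreover have "(\<lambda>k. T s (P k s)) \<longlonglongrightarrow> Q s"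
      using LIMSEQ_Suc[OF Q_lim[OF s]] by (simp add: P_Suc)
    ultimately have "T s (Q s) = Q s" by (rule LIMSEQ_unique)
    then show ?thesis using A(2) by (simp add: T_def)
  qed
  have "Q 0 = ?q0"
    using expand[of 0 "Q 0" ?q0] Q_in[of 0] Q_root[of 0] F0 A(2) \<epsilon>' d1(1)
    by (simp add: mult_le_0_iff)
  show ?thesis
  proof (rule that[of d1 \<epsilon>' "A / 2" Q])
    show "q0 + d1 < R" using d1(3) r R' by linarith
    show "0 < A / 2" using A(2) by simp
    show "Q s \<in> cball ?q0 d1 \<and> F.series (Q s) s = 1" if "s \<in> ball 0 \<epsilon>'" for s
      using Q_in[OF that] Q_root[OF that] by (rule conjI)
    show "A / 2 * norm (z - w) \<le> norm (F.series z s - F.series w s)"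
      if "s \<in> ball 0 \<epsilon>'" "z \<in> cball ?q0 d1" "w \<in> cball ?q0 d1" for s z w
      using that by (rule expand)
  qed (fact d1(1) \<epsilon>' Q_holo \<open>Q 0 = ?q0\<close>)+
qed

text \<open>Comparing real parts, the nonnegative terms \<open>a n * (q0 ^ n - Re (q ^ n))\<close>
  sum to 0, so each vanishes. The term n = 1 alone decides because \<open>a 1 > 0\<close>; this is
  the aperiodicity of the renewal sequence.\<close>

lemma root_in_closed_disc_unique:
  fixes q :: complex
  assumes a: "\<And>n. a n \<ge> (0 :: real)" "a 1 > 0" and q0: "0 < q0"
    and sums: "(\<lambda>n. a n * q0 ^ n) sums 1"
    and q: "norm q \<le> q0" and eq: "(\<lambda>n. of_real (a n) * q ^ n) sums 1"
  shows "q = of_real q0"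
proof -
  have "(\<lambda>n. Re (of_real (a n) * q ^ n)) sums 1" using sums_Re[OF eq] by simp
  then have "(\<lambda>n. a n * Re (q ^ n)) sums 1" by simp
  from sums_diff[OF sums this] have d: "(\<lambda>n. a n * (q0 ^ n - Re (q ^ n))) sums 0"
    by (simp add: right_diff_distrib)
  have le: "Re (q ^ n) \<le> q0 ^ n" for n
  proof -
    have "Re (q ^ n) \<le> norm q ^ n" using complex_Re_le_cmod[of "q ^ n"] by (simp add: norm_power)
    also have "\<dots> \<le> q0 ^ n" using q by (intro power_mono) auto
    finally show ?thesis .
  qed
  have "\<forall>n. a n * (q0 ^ n - Re (q ^ n)) = 0"
    using suminf_eq_zero_iff[OF sums_summable[OF d]] sums_unique[OF d] le a(1) by simp
  from spec[OF this, of 1] have re: "Re q = q0" using a(2) by simp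
  have "(Re q)\<^sup>2 + (Im q)\<^sup>2 \<le> q0\<^sup>2"
    using q q0 by (metis cmod_power2 norm_ge_zero power_mono)
  then show ?thesis using re by (simp add: complex_eq_iff)
qed

text \<open>The zeros off the small disc form a compact set whose least modulus exceeds q0 by
  \<open>inner\<close>, so a radius r' fits in between. On the compact set that remains, the modulus
  of f has a positive minimum.\<close>

lemma compact_annulus_avoiding:
  fixes f :: "complex \<Rightarrow> complex"
  assumes cont: "continuous_on (cball 0 R1) f" and q0: "0 < q0" "q0 < R1" "0 < \<delta>"
    and inner: "\<And>q. norm q \<le> q0 \<Longrightarrow> f q = 0 \<Longrightarrow> q = of_real q0"
  obtains r' c where "q0 < r'" "r' \<le> R1" "0 < c"
    "\<And>q. norm q \<le> r' \<Longrightarrow> q \<notin> ball (of_real q0) \<delta> \<Longrightarrow> c \<le> norm (f q)"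
proof -
  let ?Z = "{q \<in> cball 0 R1. f q = 0} - ball (of_real q0) \<delta>"
  have "closed {q \<in> cball 0 R1. f q = 0}"
    by (rule continuous_closed_preimage_constant[OF cont closed_cball])
  then have "compact ({q \<in> cball 0 R1. f q = 0} \<inter> - ball (of_real q0) \<delta> \<inter> cball 0 R1)"
    by (intro closed_Int_compact closed_Int) auto
  also have "{q \<in> cball 0 R1. f q = 0} \<inter> - ball (of_real q0) \<delta> \<inter> cball 0 R1 = ?Z" by auto
  finally have Z: "compact ?Z" .
  obtain r' where r': "q0 < r'" "r' \<le> R1" "\<And>q. norm q \<le> r' \<Longrightarrow> q \<notin> ball (of_real q0) \<delta> \<Longrightarrow> f q \<noteq> 0"
  proof (cases "?Z = {}")
    case True
    have "f q \<noteq> 0" if "norm q \<le> R1" "q \<notin> ball (of_real q0) \<delta>" for q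
    proof
      assume "f q = 0"
      then have "q \<in> ?Z" using that by simp
      then show False using True by blast
    qed
    then show ?thesis using that[of R1] q0 by blast
  next
    case False
    obtain z where z: "z \<in> ?Z" "\<And>y. y \<in> ?Z \<Longrightarrow> norm z \<le> norm y"
      using continuous_attains_inf[OF Z False continuous_on_norm_id] by blast
    have "\<not> norm z \<le> q0"
    proof
      assume "norm z \<le> q0"
      then have "z = of_real q0" using z(1) inner by simp
      then show False using z(1) q0 by simp
    qed
    then obtain r' where r': "q0 < r'" "r' < norm z" using dense[of q0 "norm z"] by (auto simp: not_le)
    have "norm z \<le> R1" using z(1) by simp
    have "f q \<noteq> 0" if "norm q \<le> r'" "q \<notin> ball (of_real q0) \<delta>" for q
    proof
      assume "f q = 0"
      then have "q \<in> ?Z" using that r' \<open>norm z \<le> R1\<close> by simp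
      then show False using z(2)[of q] that r' by simp
    qed
    then show ?thesis using r' \<open>norm z \<le> R1\<close> by (intro that[of r']) auto
  qed
  let ?K = "cball 0 r' - ball (of_real q0 :: complex) \<delta>"
  have K: "compact ?K" by (intro compact_diff) auto
  obtain c where "0 < c" "\<And>q. q \<in> ?K \<Longrightarrow> c \<le> norm (f q)"
  proof (cases "?K = {}")
    case True
    then show ?thesis by (intro that[of 1]) (simp, blast)
  next
    case False
    have "continuous_on ?K (\<lambda>q. norm (f q))"
      using r'(2) by (intro continuous_intros continuous_on_subset[OF cont]) auto
    then obtain z where z: "z \<in> ?K" "\<And>y. y \<in> ?K \<Longrightarrow> norm (f z) \<le> norm (f y)"
      using continuous_attains_inf[OF K False] by blast
    then show ?thesis using r'(3)[of z] by (intro that[of "norm (f z)"]) auto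
  qed
  then show ?thesis using r'(1,2) by (intro that[of r' c]) auto
qed

lemma (in power_series_family) uniform_in_parameter:
  assumes r: "0 \<le> r" "r < R" and "0 < \<epsilon>" "0 < e"
  obtains d where "0 < d" "d \<le> \<epsilon>" "\<And>q s. norm q \<le> r \<Longrightarrow> norm s < d \<Longrightarrow> norm (series q s - series q 0) < e"
proof -
  let ?K = "cball 0 r \<times> cball 0 (\<epsilon> / 2) :: (complex \<times> complex) set"
  have "continuous_on ?K (\<lambda>x. series (fst x) (snd x))"
    by (rule continuous_on_subset[OF continuous_on_series[OF r]]) (use \<open>0 < \<epsilon>\<close> in auto)
  then have "uniformly_continuous_on ?K (\<lambda>x. series (fst x) (snd x))"
    by (intro compact_uniformly_continuous compact_Times compact_cball)
  then obtain d where d: "d > 0"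
    "\<forall>x\<in>?K. \<forall>y\<in>?K. dist y x < d \<longrightarrow> dist (series (fst y) (snd y)) (series (fst x) (snd x)) < e"
    unfolding uniformly_continuous_on_def using \<open>0 < e\<close> by (elim allE[of _ e] impE exE conjE)
  show ?thesis
  proof (rule that[of "min d (\<epsilon> / 2)"])
    fix q s :: complex assume q: "norm q \<le> r" and s: "norm s < min d (\<epsilon> / 2)"
    have "dist (q, s) (q, 0) < d" using s by (simp add: dist_Pair_Pair)
    then show "norm (series q s - series q 0) < e"
      using bspec[OF bspec[OF d(2), of "(q, 0)"], of "(q, s)"] q s \<open>0 < \<epsilon>\<close> by (simp add: dist_norm)
  qed (use d(1) assms in auto)
qed

text \<open>The last estimate says, uniformly in s, that \<open>Q s\<close> is the only root in a
  disc of radius r' > r and that it is simple. Close to q0 it comes from the expansion bound of the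
  implicit function theorem; elsewhere compactness gives it at s = 0, and a small change of s costs
  half of the bound.\<close>

lemma holomorphic_simple_root:
  assumes F: "power_series_family \<phi> R C \<epsilon>" and \<epsilon>: "0 < \<epsilon>" and q0: "0 < q0" "q0 < R"
    and real: "\<And>n. \<phi> n 0 = of_real (a n)" and nonneg: "\<And>n. a n \<ge> 0" and a1: "a 1 > 0"
    and sum1: "(\<lambda>n. a n * q0 ^ n) sums 1"
  obtains r r' c \<epsilon>' Q where "0 < r" "r < r'" "r' < R" "0 < c" "0 < \<epsilon>'" "\<epsilon>' \<le> \<epsilon>"
    "Q holomorphic_on ball 0 \<epsilon>'" "Q 0 = of_real q0"
    "\<And>s. s \<in> ball 0 \<epsilon>' \<Longrightarrow> Q s \<noteq> 0 \<and> norm (Q s) \<le> r \<and> power_series_family.series \<phi> (Q s) s = 1"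
    "\<And>s q. s \<in> ball 0 \<epsilon>' \<Longrightarrow> norm q \<le> r' \<Longrightarrow> c * norm (q - Q s) \<le> norm (1 - power_series_family.series \<phi> q s)"
proof -
  interpret F: power_series_family \<phi> R C \<epsilon> by fact
  let ?q0 = "complex_of_real q0"
  obtain \<delta> \<epsilon>1 A Q where Q: "0 < \<delta>" "q0 + \<delta> < R" "0 < \<epsilon>1" "\<epsilon>1 \<le> \<epsilon>" "0 < A" "Q holomorphic_on ball 0 \<epsilon>1" "Q 0 = ?q0"
    and root: "\<And>s. s \<in> ball 0 \<epsilon>1 \<Longrightarrow> Q s \<in> cball ?q0 \<delta> \<and> F.series (Q s) s = 1"
    and expand: "\<And>s z w. s \<in> ball 0 \<epsilon>1 \<Longrightarrow> z \<in> cball ?q0 \<delta> \<Longrightarrow> w \<in> cball ?q0 \<delta> \<Longrightarrow>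
      A * norm (z - w) \<le> norm (F.series z s - F.series w s)"
    by (rule holomorphic_root[OF assms]) blast
  have inner: "q = ?q0" if "norm q \<le> q0" "1 - F.series q 0 = 0" for q
  proof (rule root_in_closed_disc_unique[OF nonneg a1 q0(1) sum1 that(1)])
    have "(\<lambda>n. \<phi> n 0 * q ^ n) sums F.series q 0"
      using that q0 \<epsilon> by (intro F.sums_series) auto
    then show "(\<lambda>n. of_real (a n) * q ^ n) sums 1" using that(2) by (simp add: real)
  qed
  have "continuous_on (cball 0 (q0 + \<delta>)) (\<lambda>q. F.series q 0)"
    by (rule continuous_on_subset[OF holomorphic_on_imp_continuous_on[OF F.holomorphic_series_left]])
       (use \<epsilon> Q(2) in auto)
  then have cont: "continuous_on (cball 0 (q0 + \<delta>)) (\<lambda>q. 1 - F.series q 0)"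
    by (intro continuous_intros)
  have "q0 < q0 + \<delta>" using Q(1) by simp
  then obtain r' c where r': "q0 < r'" "r' \<le> q0 + \<delta>" "0 < c"
    "\<And>q. norm q \<le> r' \<Longrightarrow> q \<notin> ball ?q0 \<delta> \<Longrightarrow> c \<le> norm (1 - F.series q 0)"
    using compact_annulus_avoiding[OF cont q0(1) _ Q(1) inner] by blast
  obtain d where d: "0 < d" "d \<le> \<epsilon>" "\<And>q s. norm q \<le> r' \<Longrightarrow> norm s < d \<Longrightarrow> norm (F.series q s - F.series q 0) < c / 2"
  proof (rule F.uniform_in_parameter[of r' "c / 2"])
    show "0 \<le> r'" "r' < R" "0 < \<epsilon>" "0 < c / 2" using r'(1-3) q0 \<epsilon> Q(2) by auto
  qed blast
  have "isCont Q 0"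
    using holomorphic_on_imp_continuous_on[OF Q(6)] Q(3)
    by (simp add: continuous_on_eq_continuous_at[OF open_ball])
  \<comment> \<open>The first bound keeps \<open>Q s\<close> away from 0, the second keeps its
    modulus below the midpoint of q0 and r'.\<close>
  moreover have "min (q0 / 2) ((r' - q0) / 2) > 0" using q0 r' by simp
  ultimately obtain d' where d': "d' > 0" "\<And>s. dist s 0 < d' \<Longrightarrow> dist (Q s) (Q 0) < min (q0 / 2) ((r' - q0) / 2)"
    unfolding continuous_at_eps_delta by blast
  define \<epsilon>' where "\<epsilon>' = min \<epsilon>1 (min d d')"
  have Qn: "Q s \<noteq> 0 \<and> norm (Q s) \<le> (q0 + r') / 2" if "s \<in> ball 0 \<epsilon>'" for s
  proof -
    have *: "norm (Q s - ?q0) < q0 / 2" "norm (Q s - ?q0) < (r' - q0) / 2"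
      using d'(2)[of s] that Q(7) by (simp_all add: \<epsilon>'_def dist_norm)
    have "Q s \<noteq> 0" using *(1) q0 by auto
    moreover have "norm (Q s) \<le> norm ?q0 + norm (Q s - ?q0)" by (rule norm_triangle_sub)
    ultimately show ?thesis using * q0 by (simp add: field_simps)
  qed
  show ?thesis
  \<comment> \<open>The distance from q to \<open>Q s\<close> is at most \<open>2 * r'\<close>, so
    the factor \<open>c / (4 * r')\<close> turns it into at most \<open>c / 2\<close>, which is what
    remains of c after moving from 0 to s.\<close>
  proof (rule that[of "(q0 + r') / 2" r' "min A (c / (4 * r'))" \<epsilon>' Q])
    show "0 < (q0 + r') / 2" "(q0 + r') / 2 < r'" "r' < R" "0 < min A (c / (4 * r'))" "0 < \<epsilon>'" "\<epsilon>' \<le> \<epsilon>"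
      using q0 r' Q d d' by (auto simp: \<epsilon>'_def)
    show "Q holomorphic_on ball 0 \<epsilon>'" by (rule holomorphic_on_subset[OF Q(6)]) (auto simp: \<epsilon>'_def)
    show "Q s \<noteq> 0 \<and> norm (Q s) \<le> (q0 + r') / 2 \<and> F.series (Q s) s = 1" if "s \<in> ball 0 \<epsilon>'" for s
      using Qn[OF that] root[of s] that by (simp add: \<epsilon>'_def)
    fix s q :: complex assume s: "s \<in> ball 0 \<epsilon>'" and q: "norm q \<le> r'"
    have s1: "s \<in> ball 0 \<epsilon>1" "norm s < d" using s by (auto simp: \<epsilon>'_def)
    show "min A (c / (4 * r')) * norm (q - Q s) \<le> norm (1 - F.series q s)"
    proof (cases "q \<in> ball ?q0 \<delta>")
      case True
      then have "A * norm (q - Q s) \<le> norm (F.series q s - F.series (Q s) s)"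
        using root[OF s1(1)] by (intro expand[OF s1(1)]) auto
      then have "A * norm (q - Q s) \<le> norm (1 - F.series q s)"
        using root[OF s1(1)] by (simp add: norm_minus_commute)
      moreover have "min A (c / (4 * r')) * norm (q - Q s) \<le> A * norm (q - Q s)"
        by (intro mult_right_mono) auto
      ultimately show ?thesis by linarith
    next
      case False
      have "norm (q - Q s) \<le> norm q + norm (Q s)" by (rule norm_triangle_ineq4)
      also have "\<dots> \<le> 2 * r'" using q Qn[OF s] r' by (auto simp: field_simps)
      finally have "min A (c / (4 * r')) * norm (q - Q s) \<le> c / (4 * r') * (2 * r')"
        using r' q0 by (intro mult_mono) auto
      also have "\<dots> = c / 2" using r' q0 by simp
      also have "\<dots> \<le> norm (1 - F.series q s)"
        using norm_triangle_ineq2[of "1 - F.series q 0" "F.series q s - F.series q 0"]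
          r'(4)[OF q False] d(3)[OF q s1(2)] by (simp add: algebra_simps)
      finally show ?thesis .
    qed
  qed (fact Q(7))
qed

section \<open>Asymptotics of renewal sequences\<close>

text \<open>The generating function of p is \<open>series \<gamma> / (1 - series \<phi>)\<close>.
  Dividing the factor q - Q out of the denominator leaves a function bounded below by c on the disc
  of radius r', so the simple pole at Q carries the main term and Cauchy's inequality on the circle
  of radius r' bounds the rest. The error involves only B, c, r and r', which will not depend on
  s.\<close>

lemma renewal_coeff_asymptotics:
  fixes p :: "nat \<Rightarrow> complex"
  assumes F: "power_series_family \<phi> R C \<epsilon>" and G: "power_series_family \<gamma> R C' \<epsilon>"
    and s: "s \<in> ball 0 \<epsilon>"
    and \<phi>0: "\<phi> 0 s = 0"
    and renewal: "\<And>n. p n = \<gamma> n s + (\<Sum>k\<le>n. \<phi> k s * p (n - k))"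
    and r: "0 < r" "r < r'" "r' < R" "0 < c" and Q: "Q \<noteq> 0" "norm Q \<le> r"
    and root: "power_series_family.series \<phi> Q s = 1"
    and lower: "\<And>q. norm q \<le> r' \<Longrightarrow> c * norm (q - Q) \<le> norm (1 - power_series_family.series \<phi> q s)"
    and upper: "\<And>q. norm q \<le> r' \<Longrightarrow> norm (power_series_family.series \<gamma> q s) \<le> B"
  shows "c \<le> norm (deriv (\<lambda>q. power_series_family.series \<phi> q s) Q) \<and>
    norm (p n - power_series_family.series \<gamma> Q s / (Q * deriv (\<lambda>q. power_series_family.series \<phi> q s) Q) / Q ^ n)
           \<le> (2 * (B / c) / (r' - r)) / r' ^ n"
proof -
  interpret F: power_series_family \<phi> R C \<epsilon> by fact
  interpret G: power_series_family \<gamma> R C' \<epsilon> by fact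
  define f where "f = (\<lambda>q. 1 - F.series q s)"
  define H where "H = (\<lambda>q. if q = Q then deriv f Q else (f q - f Q) / (q - Q))"
  define U where "U = {q \<in> ball 0 R. H q \<noteq> 0}"
  define E where "E = (\<lambda>q. G.series q s / H q)"
  text \<open>k is the generating function of p minus its simple pole at Q; it is holomorphic on the larger disc.\<close>
  define k where "k = (\<lambda>q. if q = Q then deriv E Q else (E q - E Q) / (q - Q))"
  have fQ: "f Q = 0" using root by (simp add: f_def)
  have f_holo: "f holomorphic_on ball 0 R"
    unfolding f_def by (intro holomorphic_intros F.holomorphic_series_left s)
  have QR: "Q \<in> ball 0 R" using Q r by simp
  have H_holo: "H holomorphic_on ball 0 R"
    unfolding H_def by (rule pole_lemma_open[OF f_holo open_ball])
  have H_off: "c \<le> norm (H q)" if "norm q \<le> r'" "q \<noteq> Q" for q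
    using lower[OF that(1)] that(2) fQ by (simp add: H_def f_def norm_divide field_simps)
  \<comment> \<open>The hypothesis \<open>lower\<close> is trivial at Q itself; there the bound is
    obtained as a limit of the bounds at nearby points.\<close>
  have H_Q: "c \<le> norm (H Q)"
  proof (rule tendsto_lowerbound)
    have "isCont H Q"
      using holomorphic_on_imp_continuous_on[OF H_holo] QR by (simp add: continuous_on_eq_continuous_at[OF open_ball])
    then show "((\<lambda>q. norm (H q)) \<longlongrightarrow> norm (H Q)) (at Q)" by (intro tendsto_norm) (simp add: isCont_def)
    have "eventually (\<lambda>q. q \<in> ball 0 r' - {Q}) (at Q)"
      using eventually_at_in_open[of "ball 0 r'" Q] Q r by simp
    then show "eventually (\<lambda>q. c \<le> norm (H q)) (at Q)"
      by eventually_elim (use H_off in auto)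
  qed simp
  have H_lower: "c \<le> norm (H q)" if "norm q \<le> r'" for q
    using H_Q H_off[OF that] by (cases "q = Q") auto
  have "open (ball 0 R \<inter> H -` (- {0}))"
    by (rule continuous_open_preimage[OF holomorphic_on_imp_continuous_on[OF H_holo]]) auto
  also have "ball 0 R \<inter> H -` (- {0}) = U" by (auto simp: U_def)
  finally have U: "open U" .
  have in_U: "q \<in> U" if "norm q \<le> r'" for q
    using H_lower[OF that] that r by (auto simp: U_def)
  have E_holo: "E holomorphic_on U"
    unfolding E_def
    by (intro holomorphic_on_divide holomorphic_on_subset[OF G.holomorphic_series_left[OF s]]
        holomorphic_on_subset[OF H_holo]) (auto simp: U_def)
  have k_holo: "k holomorphic_on U"
    unfolding k_def by (rule pole_lemma_open[OF E_holo U])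
  have E_le: "norm (E q) \<le> B / c" if "norm q \<le> r'" for q
    unfolding E_def norm_divide
    using upper[OF that] H_lower[OF that] r by (intro frac_le) (auto intro: order_trans[OF norm_ge_zero])
  have k_sphere: "norm (k q) \<le> 2 * (B / c) / (r' - r)" if "norm (0 - q) = r'" for q
  proof -
    have q: "norm q = r'" using that by simp
    have "q \<noteq> Q" using q Q r by auto
    have "r' - r \<le> norm (q - Q)" using norm_triangle_ineq2[of q Q] q Q by linarith
    moreover have "norm (E q - E Q) \<le> B / c + B / c"
      using norm_triangle_ineq4[of "E q" "E Q"] E_le[of q] E_le[of Q] q Q r by linarith
    moreover have "0 \<le> B / c" using E_le[of q] norm_ge_zero[of "E q"] q by linarith
    ultimately have "norm (E q - E Q) / norm (q - Q) \<le> (B / c + B / c) / (r' - r)"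
      using r by (intro frac_le) linarith+
    then show ?thesis using \<open>q \<noteq> Q\<close> by (simp add: k_def norm_divide)
  qed
  have k_coeff: "norm ((deriv ^^ n) k 0 / fact n) \<le> (2 * (B / c) / (r' - r)) / r' ^ n"
  proof -
    have "norm ((deriv ^^ n) k 0) \<le> fact n * (2 * (B / c) / (r' - r)) / r' ^ n"
    proof (rule Cauchy_inequality)
      show "k holomorphic_on ball 0 r'" by (rule holomorphic_on_subset[OF k_holo]) (auto intro: in_U)
      show "continuous_on (cball 0 r') k"
        by (rule continuous_on_subset[OF holomorphic_on_imp_continuous_on[OF k_holo]]) (auto intro: in_U)
    qed (use r k_sphere in auto)
    then show ?thesis by (simp add: norm_divide field_simps)
  qed
  \<comment> \<open>No growth bound for p is available, so the identity for its generating function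
    is proved between formal power series, where \<open>1 - Fs\<close> cancels because its constant
    coefficient is 1.\<close>
  define Fs Gs Ps where "Fs = Abs_fps (\<lambda>n. \<phi> n s)" and "Gs = Abs_fps (\<lambda>n. \<gamma> n s)" and "Ps = Abs_fps p"
  have "0 \<in> U" using in_U r by simp
  then have k_fps: "k has_fps_expansion fps_expansion k 0"
    using k_holo U by (intro has_fps_expansion_fps_expansion) auto
  define g where "g = Abs_fps (\<lambda>n. - 1 / Q ^ Suc n)"
  have g_fps: "(\<lambda>q. 1 / (q - Q)) has_fps_expansion g"
  proof (rule has_fps_expansionI)
    have "eventually (\<lambda>q. q \<in> ball 0 (norm Q)) (nhds 0)"
      using Q by (intro eventually_nhds_in_open) auto
    then show "eventually (\<lambda>q. (\<lambda>n. fps_nth g n * q ^ n) sums (1 / (q - Q))) (nhds 0)"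
    proof eventually_elim
      case (elim q)
      then have "norm (q / Q) < 1" using Q by (simp add: norm_divide)
      then have "(\<lambda>n. - 1 / Q * (q / Q) ^ n) sums (- 1 / Q * (1 / (1 - q / Q)))"
        by (intro sums_mult geometric_sums)
      moreover have "- 1 / Q * (1 / (1 - q / Q)) = 1 / (q - Q)"
      proof -
        have "q \<noteq> Q" using elim by auto
        then show ?thesis using Q(1) by (simp add: divide_simps)
      qed
      ultimately show ?case by (simp add: g_def power_divide)
    qed
  qed
  have "(\<lambda>q. (1 - F.series q s) * (k q + E Q * (1 / (q - Q)))) has_fps_expansion
      (1 - Fs) * (fps_expansion k 0 + fps_const (E Q) * g)"
    unfolding Fs_def by (intro fps_expansion_intros F.fps_expansion_series s k_fps g_fps)
  moreover have eq0: "eventually (\<lambda>q. (1 - F.series q s) * (k q + E Q * (1 / (q - Q))) = G.series q s) (nhds 0)"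
  proof -
    have "eventually (\<lambda>q. q \<in> ball 0 (min r' (norm Q))) (nhds 0)"
      using Q r by (intro eventually_nhds_in_open) auto
    then show ?thesis
    proof eventually_elim
      case (elim q)
      then have q: "norm q \<le> r'" "q \<noteq> Q" by auto
      have "H q \<noteq> 0" using H_lower[OF q(1)] r by auto
      have "k q + E Q * (1 / (q - Q)) = E q / (q - Q)"
        using q(2) by (simp add: k_def diff_divide_distrib)
      moreover have "1 - F.series q s = H q * (q - Q)" using q(2) fQ by (simp add: H_def f_def)
      ultimately show ?case using q(2) \<open>H q \<noteq> 0\<close> by (simp add: E_def)
    qed
  qed
  ultimately have "(\<lambda>q. G.series q s) has_fps_expansion (1 - Fs) * (fps_expansion k 0 + fps_const (E Q) * g)"
    by (simp only: has_fps_expansion_cong[OF eq0 refl])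
  moreover have "(\<lambda>q. G.series q s) has_fps_expansion Gs"
    unfolding Gs_def by (rule G.fps_expansion_series[OF s])
  ultimately have "(1 - Fs) * (fps_expansion k 0 + fps_const (E Q) * g) = Gs"
    by (rule fps_expansion_unique_complex)
  moreover have "(1 - Fs) * Ps = Gs"
  proof -
    have "fps_nth Ps n = fps_nth (Gs + Fs * Ps) n" for n
      using renewal[of n] by (simp only: Ps_def Gs_def Fs_def fps_mult_nth atLeast0AtMost fps_add_nth Abs_fps_inverse fps_nth_Abs_fps)
    then have "Ps = Gs + Fs * Ps" by (rule fps_ext)
    then show ?thesis by (simp add: algebra_simps)
  qed
  moreover have "1 - Fs \<noteq> 0"
  proof
    assume "1 - Fs = 0"
    then have "fps_nth (1 - Fs) 0 = 0" by simp
    then show False by (simp add: Fs_def \<phi>0)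
  qed
  ultimately have "Ps = fps_expansion k 0 + fps_const (E Q) * g"
    using mult_left_cancel[of "1 - Fs" Ps "fps_expansion k 0 + fps_const (E Q) * g"] by simp
  then have "fps_nth Ps n = fps_nth (fps_expansion k 0 + fps_const (E Q) * g) n" by (rule arg_cong)
  then have p_eq: "p n = (deriv ^^ n) k 0 / fact n - E Q / Q ^ Suc n"
    by (simp add: Ps_def g_def fps_expansion_def)
  have "((\<lambda>q. F.series q s) has_field_derivative deriv (\<lambda>q. F.series q s) Q) (at Q)"
    by (rule holomorphic_derivI[OF F.holomorphic_series_left[OF s] open_ball QR])
  then have "(f has_field_derivative 0 - deriv (\<lambda>q. F.series q s) Q) (at Q)"
    unfolding f_def by (intro DERIV_diff DERIV_const)
  then have "H Q = - deriv (\<lambda>q. F.series q s) Q"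
    by (simp add: H_def DERIV_imp_deriv)
  then have "p n - G.series Q s / (Q * deriv (\<lambda>q. F.series q s) Q) / Q ^ n = (deriv ^^ n) k 0 / fact n"
    by (simp add: p_eq E_def)
  then show ?thesis using k_coeff H_Q \<open>H Q = - deriv (\<lambda>q. F.series q s) Q\<close> by simp
qed

section \<open>Quasi-powers from the dominant pole\<close>

lemma holomorphic_close_at_0:
  fixes h :: "complex \<Rightarrow> complex"
  assumes "h holomorphic_on ball 0 \<epsilon>" "0 < \<epsilon>" "0 < e"
  obtains d where "0 < d" "d \<le> \<epsilon>" "\<And>s. s \<in> ball 0 d \<Longrightarrow> norm (h s - h 0) < e"
proof -
  have "isCont h 0"
    using holomorphic_on_imp_continuous_on[OF assms(1)] assms(2)
    by (simp add: continuous_on_eq_continuous_at[OF open_ball])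
  then obtain d where d: "d > 0" "\<And>s. dist s 0 < d \<Longrightarrow> dist (h s) (h 0) < e"
    unfolding continuous_at_eps_delta using assms(3) by blast
  show ?thesis
    by (rule that[of "min d \<epsilon>"]) (use d(1) assms(2) in simp, simp, rule d(2)[unfolded dist_norm], simp)
qed

text \<open>Distance 1/2 from 1 keeps the values off the branch cut and bounds the principal
  logarithm by twice that distance.\<close>

lemma Ln_near_1:
  fixes h :: "complex \<Rightarrow> complex"
  assumes "h holomorphic_on A" and near: "\<forall>s\<in>A. norm (h s - 1) < 1 / 2"
  shows "(\<lambda>s. Ln (h s)) holomorphic_on A"
    and "\<And>s. s \<in> A \<Longrightarrow> norm (Ln (h s)) \<le> 1"
    and "\<And>s. s \<in> A \<Longrightarrow> exp (Ln (h s)) = h s"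
proof -
  have nz: "h s \<notin> \<real>\<^sub>\<le>\<^sub>0" if "s \<in> A" for s
  proof
    assume "h s \<in> \<real>\<^sub>\<le>\<^sub>0"
    then have "Re (h s) \<le> 0" by (auto simp: complex_nonpos_Reals_iff)
    then have "1 \<le> \<bar>Re (h s - 1)\<bar>" by simp
    also have "\<dots> \<le> norm (h s - 1)" by (rule abs_Re_le_cmod)
    finally show False using bspec[OF near that] by simp
  qed
  show "(\<lambda>s. Ln (h s)) holomorphic_on A" by (rule holomorphic_on_Ln'[OF nz assms(1)])
  show "norm (Ln (h s)) \<le> 1" if "s \<in> A" for s
    using norm_Ln_le[OF bspec[OF near that]] bspec[OF near that] by simp
  show "exp (Ln (h s)) = h s" if "s \<in> A" for s using nz[OF that] by (intro exp_Ln) auto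
qed

text \<open>Here \<open>\<alpha>\<close> is minus the logarithm of Q(s) / q0. The function
  \<open>\<beta> n\<close> collects the logarithms of the amplitude ratio \<open>cf s / cf 0\<close>
  and of the relative error of the pole approximation, which is uniformly of order
  \<open>(r / r') ^ n\<close> and hence below 1/2 from N on.\<close>

theorem renewal_quasi_powers:
  fixes p :: "nat \<Rightarrow> complex \<Rightarrow> complex"
  assumes F: "power_series_family \<phi> R C \<epsilon>" and G: "power_series_family \<gamma> R C' \<epsilon>" and \<epsilon>: "0 < \<epsilon>"
    and p_holo: "\<And>n. p n holomorphic_on ball 0 \<epsilon>"
    and \<phi>0: "\<And>s. s \<in> ball 0 \<epsilon> \<Longrightarrow> \<phi> 0 s = 0"
    and renewal: "\<And>n s. s \<in> ball 0 \<epsilon> \<Longrightarrow> p n s = \<gamma> n s + (\<Sum>k\<le>n. \<phi> k s * p (n - k) s)"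
    and q0: "0 < q0" "q0 < R"
    and \<phi>_real: "\<And>n. \<phi> n 0 = of_real (a n)" "\<And>n. a n \<ge> 0" "a 1 > 0"
    and sum1: "(\<lambda>n. a n * q0 ^ n) sums 1"
    and \<gamma>_real: "\<And>n. \<gamma> n 0 = of_real (g n)" "\<And>n. g n \<ge> 0" "g 0 > 0"
  obtains \<epsilon>' \<alpha> \<beta> N where "0 < \<epsilon>'" "\<epsilon>' \<le> \<epsilon>" "\<alpha> holomorphic_on ball 0 \<epsilon>'" "\<alpha> 0 = 0"
    "\<And>s. s \<in> ball 0 \<epsilon>' \<Longrightarrow> norm (\<alpha> s) \<le> 1"
    "\<And>s. s \<in> ball 0 \<epsilon>' \<Longrightarrow> norm (of_real q0 * exp (- \<alpha> s)) < R"
    "\<And>s. s \<in> ball 0 \<epsilon>' \<Longrightarrow> power_series_family.series \<phi> (of_real q0 * exp (- \<alpha> s)) s = 1"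
    "\<And>n. n \<ge> N \<Longrightarrow> \<beta> n holomorphic_on ball 0 \<epsilon>'"
    "\<And>n s. n \<ge> N \<Longrightarrow> s \<in> ball 0 \<epsilon>' \<Longrightarrow> norm (\<beta> n s) \<le> 3"
    "\<And>n s. n \<ge> N \<Longrightarrow> s \<in> ball 0 \<epsilon>' \<Longrightarrow> p n s / p n 0 = exp (of_nat n * \<alpha> s + \<beta> n s)"
proof -
  interpret F: power_series_family \<phi> R C \<epsilon> by fact
  interpret G: power_series_family \<gamma> R C' \<epsilon> by fact
  let ?q0 = "complex_of_real q0"
  obtain r r' c \<epsilon>1 Q where r: "0 < r" "r < r'" "r' < R" "0 < c" and \<epsilon>1: "0 < \<epsilon>1" "\<epsilon>1 \<le> \<epsilon>"
    and Q: "Q holomorphic_on ball 0 \<epsilon>1" "Q 0 = of_real q0"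
    and root: "\<And>s. s \<in> ball 0 \<epsilon>1 \<Longrightarrow> Q s \<noteq> 0 \<and> norm (Q s) \<le> r \<and> F.series (Q s) s = 1"
    and lower: "\<And>s q. s \<in> ball 0 \<epsilon>1 \<Longrightarrow> norm q \<le> r' \<Longrightarrow> c * norm (q - Q s) \<le> norm (1 - F.series q s)"
    by (rule holomorphic_simple_root[OF F \<epsilon> q0 \<phi>_real sum1]) blast
  obtain C1 where "power_series_family (\<lambda>n s. of_nat (Suc n) * \<phi> (Suc n) s) r' C1 \<epsilon>"
    using power_series_family_deriv[OF F, of r'] r by auto
  then interpret D: power_series_family "\<lambda>n s. of_nat (Suc n) * \<phi> (Suc n) s" r' C1 \<epsilon> .
  define B where "B = (\<Sum>n. C' * (r' / R) ^ n)"
  define K where "K = 2 * (B / c) / (r' - r)"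
  define d where "d s = D.series (Q s) s" for s
  define cf where "cf s = G.series (Q s) s / (Q s * d s)" for s
  have d_eq: "deriv (\<lambda>q. F.series q s) (Q s) = d s" if "s \<in> ball 0 \<epsilon>1" for s
    unfolding d_def D.series_def
    by (rule DERIV_imp_deriv, rule F.deriv_series) (use that root[OF that] \<epsilon>1 r in auto)
  have sing: "c \<le> norm (d s) \<and> norm (p n s - cf s / Q s ^ n) \<le> K / r' ^ n" if s: "s \<in> ball 0 \<epsilon>1" for n s
    unfolding cf_def d_eq[OF s, symmetric] K_def
  proof (rule renewal_coeff_asymptotics[OF F G])
    show s': "s \<in> ball 0 \<epsilon>" using s \<epsilon>1 by auto
    show "\<phi> 0 s = 0" "\<And>n. p n s = \<gamma> n s + (\<Sum>k\<le>n. \<phi> k s * p (n - k) s)"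
      using \<phi>0[OF s'] renewal[OF s'] by blast+
    show "norm (G.series q s) \<le> B" if "norm q \<le> r'" for q
      unfolding B_def by (rule G.norm_series_le[OF s' that r(3)])
  qed (use root[OF s] lower[OF s] r in blast)+
  have \<epsilon>1_sub: "ball (0::complex) \<epsilon>1 \<subseteq> ball 0 \<epsilon>" using \<epsilon>1 by auto
  have d_holo: "d holomorphic_on ball 0 \<epsilon>1"
    unfolding d_def by (rule D.holomorphic_series_compose[OF _ _ r(2) Q(1)]) (use root r \<epsilon>1_sub in auto)
  have cf_holo: "cf holomorphic_on ball 0 \<epsilon>1"
  proof -
    have "r < R" using r by simp
    then have "(\<lambda>s. G.series (Q s) s) holomorphic_on ball 0 \<epsilon>1"
      by (rule G.holomorphic_series_compose[rotated 2, OF _ Q(1)]) (use root r \<epsilon>1_sub in auto)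
    moreover have "Q s * d s \<noteq> 0" if "s \<in> ball 0 \<epsilon>1" for s
      using sing[OF that, of 0] root[OF that] r by auto
    ultimately show ?thesis unfolding cf_def by (intro holomorphic_on_divide holomorphic_on_mult Q d_holo)
  qed
  have zero_in: "0 \<in> ball (0::complex) \<epsilon>1" using \<epsilon>1 by simp
  \<comment> \<open>The amplitude does not vanish at s = 0: its numerator is a series of nonnegative
    terms with \<open>g 0 > 0\<close>, evaluated at a positive point.\<close>
  have "cf 0 \<noteq> 0"
  proof -
    have "(\<lambda>n. complex_of_real (g n * q0 ^ n)) sums G.series ?q0 0"
      using G.sums_series[of 0 ?q0] \<epsilon> q0 by (simp add: \<gamma>_real)
    moreover from this have sm: "summable (\<lambda>n. g n * q0 ^ n)"
      using summable_of_real_iff sums_summable by blast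
    ultimately have "G.series ?q0 0 = of_real (\<Sum>n. g n * q0 ^ n)"
      by (simp add: sums_iff suminf_of_real)
    moreover have "(\<Sum>n. g n * q0 ^ n) > 0"
      by (rule suminf_pos2[OF sm, of 0]) (use \<gamma>_real q0 in auto)
    ultimately have "G.series ?q0 0 \<noteq> 0" by simp
    moreover have "d 0 \<noteq> 0" using sing[OF zero_in, of 0] r by auto
    ultimately show ?thesis using Q(2) q0 by (simp add: cf_def)
  qed
  obtain d1 where d1: "0 < d1" "d1 \<le> \<epsilon>1" "\<And>s. s \<in> ball 0 d1 \<Longrightarrow> norm (Q s - Q 0) < q0 / 2"
    using holomorphic_close_at_0[OF Q(1) \<epsilon>1(1), of "q0 / 2"] q0 by auto
  obtain d2 where d2: "0 < d2" "d2 \<le> \<epsilon>1" "\<And>s. s \<in> ball 0 d2 \<Longrightarrow> norm (cf s - cf 0) < norm (cf 0) / 2"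
    using holomorphic_close_at_0[OF cf_holo \<epsilon>1(1), of "norm (cf 0) / 2"] \<open>cf 0 \<noteq> 0\<close> by auto
  define \<epsilon>' where "\<epsilon>' = min d1 d2"
  have \<epsilon>': "0 < \<epsilon>'" "\<epsilon>' \<le> \<epsilon>1" using d1 d2 by (auto simp: \<epsilon>'_def)
  have sub: "ball (0::complex) \<epsilon>' \<subseteq> ball 0 \<epsilon>1" using \<epsilon>' by auto
  define u where "u s = Q s / ?q0" for s
  define \<alpha> where "\<alpha> s = - Ln (u s)" for s
  have u_holo: "u holomorphic_on ball 0 \<epsilon>'"
    unfolding u_def using q0 by (intro holomorphic_intros holomorphic_on_subset[OF Q(1) sub]) auto
  have u_near: "\<forall>s\<in>ball 0 \<epsilon>'. norm (u s - 1) < 1 / 2"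
  proof
    fix s :: complex assume s: "s \<in> ball 0 \<epsilon>'"
    have "u s - 1 = (Q s - Q 0) / ?q0" using q0 Q(2) by (simp add: u_def field_simps)
    then have "norm (u s - 1) = norm (Q s - Q 0) / q0" using q0 by (simp add: norm_divide)
    then show "norm (u s - 1) < 1 / 2" using d1(3)[of s] s q0 by (simp add: \<epsilon>'_def divide_less_eq)
  qed
  note Ln_u = Ln_near_1[OF u_holo u_near]
  have Q_eq: "?q0 * exp (- \<alpha> s) = Q s" if "s \<in> ball 0 \<epsilon>'" for s
    using Ln_u(3)[OF that] q0 by (simp add: \<alpha>_def u_def)
  define v where "v s = cf s / cf 0" for s
  have v_holo: "v holomorphic_on ball 0 \<epsilon>'"
    unfolding v_def using \<open>cf 0 \<noteq> 0\<close> by (intro holomorphic_intros holomorphic_on_subset[OF cf_holo sub]) auto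
  have v_near: "\<forall>s\<in>ball 0 \<epsilon>'. norm (v s - 1) < 1 / 2"
  proof
    fix s :: complex assume s: "s \<in> ball 0 \<epsilon>'"
    have "v s - 1 = (cf s - cf 0) / cf 0" using \<open>cf 0 \<noteq> 0\<close> by (simp add: v_def field_simps)
    then have "norm (v s - 1) = norm (cf s - cf 0) / norm (cf 0)" by (simp only: norm_divide)
    then show "norm (v s - 1) < 1 / 2" using d2(3)[of s] s \<open>cf 0 \<noteq> 0\<close> by (simp add: \<epsilon>'_def divide_less_eq)
  qed
  note Ln_v = Ln_near_1[OF v_holo v_near]
  have cf_lower: "norm (cf 0) / 2 < norm (cf s)" if "s \<in> ball 0 \<epsilon>'" for s
    using d2(3)[of s] that norm_triangle_ineq2[of "cf 0" "cf s"] by (simp add: \<epsilon>'_def norm_minus_commute)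
  define w where "w n s = p n s * Q s ^ n / cf s" for n s
  have w_holo: "w n holomorphic_on ball 0 \<epsilon>'" for n
    unfolding w_def
  proof (intro holomorphic_on_divide holomorphic_on_mult holomorphic_on_power)
    show "p n holomorphic_on ball 0 \<epsilon>'" by (rule holomorphic_on_subset[OF p_holo]) (use sub \<epsilon>1_sub in blast)
    show "cf s \<noteq> 0" if "s \<in> ball 0 \<epsilon>'" for s using cf_lower[OF that] by auto
  qed (rule holomorphic_on_subset[OF _ sub], fact)+
  have w_near: "norm (w n s - 1) \<le> 2 * K / norm (cf 0) * (r / r') ^ n" if s: "s \<in> ball 0 \<epsilon>'" for n s
  proof -
    have s1: "s \<in> ball 0 \<epsilon>1" using s sub by blast
    have "cf s \<noteq> 0" using cf_lower[OF s] by auto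
    have "Q s \<noteq> 0" using root[OF s1] by blast
    have K: "0 \<le> K" using sing[OF s1, of 0] order_trans[OF norm_ge_zero] by fastforce
    have "w n s - 1 = (p n s - cf s / Q s ^ n) * Q s ^ n / cf s"
      using \<open>cf s \<noteq> 0\<close> \<open>Q s \<noteq> 0\<close> by (simp add: w_def field_simps)
    then have "norm (w n s - 1) = norm (p n s - cf s / Q s ^ n) * norm (Q s) ^ n / norm (cf s)"
      by (simp add: norm_mult norm_divide norm_power)
    also have "\<dots> \<le> (K / r' ^ n) * r ^ n / (norm (cf 0) / 2)"
      using sing[OF s1, of n] root[OF s1] cf_lower[OF s] \<open>cf 0 \<noteq> 0\<close> K r
      by (intro frac_le mult_mono power_mono) auto
    finally show ?thesis by (simp add: power_divide mult_ac)
  qed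
  have "(\<lambda>n. 2 * K / norm (cf 0) * (r / r') ^ n) \<longlonglongrightarrow> 2 * K / norm (cf 0) * 0"
    using r by (intro tendsto_intros LIMSEQ_realpow_zero) auto
  then have "eventually (\<lambda>n. 2 * K / norm (cf 0) * (r / r') ^ n < 1 / 2) sequentially"
    by (rule order_tendstoD(2)) simp
  then obtain N where N: "\<And>n. n \<ge> N \<Longrightarrow> 2 * K / norm (cf 0) * (r / r') ^ n < 1 / 2"
    unfolding eventually_sequentially by blast
  have w_near': "\<forall>s\<in>ball 0 \<epsilon>'. norm (w n s - 1) < 1 / 2" if "n \<ge> N" for n
    using w_near[of _ n] N[OF that] by (blast intro: le_less_trans)
  note Ln_w = Ln_near_1[OF w_holo w_near']
  have zero_in': "0 \<in> ball (0::complex) \<epsilon>'" using \<epsilon>' by simp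
  \<comment> \<open>Three logarithms of norm at most 1 give the bound 3; the last of them accounts
    for the division by \<open>p n 0\<close>.\<close>
  define \<beta> where "\<beta> n s = Ln (v s) + Ln (w n s) - Ln (w n 0)" for n s
  show ?thesis
  proof (rule that[of \<epsilon>' \<alpha> N \<beta>])
    show "0 < \<epsilon>'" "\<epsilon>' \<le> \<epsilon>" using \<epsilon>' \<epsilon>1 by auto
    show "\<alpha> holomorphic_on ball 0 \<epsilon>'" unfolding \<alpha>_def by (intro holomorphic_intros Ln_u(1))
    show "\<alpha> 0 = 0" using q0 Q(2) by (simp add: \<alpha>_def u_def)
    fix s :: complex assume s: "s \<in> ball 0 \<epsilon>'"
    then have s1: "s \<in> ball 0 \<epsilon>1" using sub by blast
    show "norm (\<alpha> s) \<le> 1" using Ln_u(2)[OF s] by (simp add: \<alpha>_def)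
    show "norm (?q0 * exp (- \<alpha> s)) < R" "F.series (?q0 * exp (- \<alpha> s)) s = 1"
      unfolding Q_eq[OF s] using root[OF s1] r by auto
  next
    fix n assume n: "n \<ge> N"
    show "\<beta> n holomorphic_on ball 0 \<epsilon>'"
      unfolding \<beta>_def by (intro holomorphic_intros Ln_v(1) Ln_w(1) n)
    fix s :: complex assume s: "s \<in> ball 0 \<epsilon>'"
    then have s1: "s \<in> ball 0 \<epsilon>1" using sub by blast
    have "norm (\<beta> n s) \<le> norm (Ln (v s) + Ln (w n s)) + norm (Ln (w n 0))"
      unfolding \<beta>_def by (rule norm_triangle_ineq4)
    also have "norm (Ln (v s) + Ln (w n s)) \<le> norm (Ln (v s)) + norm (Ln (w n s))" by (rule norm_triangle_ineq)
    finally show "norm (\<beta> n s) \<le> 3"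
      using Ln_v(2)[OF s] Ln_w(2)[OF n s] Ln_w(2)[OF n zero_in'] by linarith
    have nz: "cf s \<noteq> 0" "Q s \<noteq> 0" using cf_lower[OF s] root[OF s1] by auto
    have "exp (of_nat n * \<alpha> s + \<beta> n s) = exp (\<alpha> s) ^ n * (v s * w n s / w n 0)"
      using Ln_v(3)[OF s] Ln_w(3)[OF n s] Ln_w(3)[OF n zero_in']
      by (simp add: \<beta>_def exp_add exp_diff exp_of_nat_mult)
    also have "exp (\<alpha> s) = ?q0 / Q s"
      using Ln_u(3)[OF s] by (simp add: \<alpha>_def exp_minus u_def field_simps)
    also have "(?q0 / Q s) ^ n * (v s * w n s / w n 0) = p n s / p n 0"
      using nz \<open>cf 0 \<noteq> 0\<close> q0 by (simp add: v_def w_def Q(2) power_divide)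
    finally show "p n s / p n 0 = exp (of_nat n * \<alpha> s + \<beta> n s)" by simp
  qed
qed

section \<open>Positivity of the variance slope\<close>

lemma second_deriv_nondegenerate:
  fixes f :: "nat \<Rightarrow> nat \<Rightarrow> real"
  assumes F: "power_series_family (\<lambda>n s. \<Sum>l\<le>n. of_real (f n l) * exp (s * of_nat l)) R C \<epsilon>"
    and f_nonneg: "\<And>n l. f n l \<ge> 0" and f11: "f 1 1 > 0" and f32: "f 3 2 > 0"
    and q0: "0 < q0" "q0 < R" and \<epsilon>: "0 < \<epsilon>"
    and \<alpha>: "\<alpha> holomorphic_on ball 0 \<epsilon>" "\<alpha> 0 = 0"
    and root: "\<And>s. s \<in> ball 0 \<epsilon> \<Longrightarrow>
      power_series_family.series (\<lambda>n s. \<Sum>l\<le>n. of_real (f n l) * exp (s * of_nat l)) (of_real q0 * exp (- \<alpha> s)) s = 1"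
    and real: "Im (deriv \<alpha> 0) = 0"
  shows "deriv (deriv \<alpha>) 0 \<noteq> 0"
proof
  text \<open>
    Differentiating \<Sum> f(n,l) q0^n exp(s l - n \<alpha>(s)) = 1 twice at 0 then gives \<Sum> f(n,l) q0^n (l - n \<mu>)^2 = 0,
    so that l = n \<mu> for both (n,l) = (1,1) and (3,2).
  \<close>
  assume degenerate: "deriv (deriv \<alpha>) 0 = 0"
  interpret F: power_series_family "\<lambda>n s. \<Sum>l\<le>n. of_real (f n l) * exp (s * of_nat l)" R C \<epsilon> by fact
  let ?q = "\<lambda>s. of_real q0 * exp (- \<alpha> s)"
  define \<mu> where "\<mu> = Re (deriv \<alpha> 0)"
  have \<mu>: "deriv \<alpha> 0 = of_real \<mu>" using real by (simp add: \<mu>_def complex_eq_iff)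
  obtain r where r: "q0 < r" "r < R" using q0 dense by blast
  have "?q holomorphic_on ball 0 \<epsilon>" by (intro holomorphic_intros \<alpha>)
  then obtain d where d: "0 < d" "d \<le> \<epsilon>" "\<And>s. s \<in> ball 0 d \<Longrightarrow> norm (?q s - ?q 0) < r - q0"
    using holomorphic_close_at_0[of ?q \<epsilon> "r - q0"] \<epsilon> r by auto
  have q_le: "norm (?q s) \<le> r" if "s \<in> ball 0 d" for s
    using d(3)[OF that] norm_triangle_sub[of "?q s" "?q 0"] q0 \<alpha>(2) by simp
  define E where "E n l s = of_real (f n l * q0 ^ n) * exp (s * of_nat l - of_nat n * \<alpha> s)" for n l :: nat and s
  define P where "P N s = (\<Sum>n<N. \<Sum>l\<le>n. E n l s)" for N s
  define \<alpha>' where "\<alpha>' = deriv \<alpha>"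
  define E' where "E' n l s = E n l s * (of_nat l - of_nat n * \<alpha>' s)" for n l :: nat and s
  have \<alpha>_deriv: "(\<alpha> has_field_derivative \<alpha>' s) (at s)" "(\<alpha>' has_field_derivative deriv \<alpha>' s) (at s)"
    if "s \<in> ball 0 \<epsilon>" for s
    unfolding \<alpha>'_def
    by (rule holomorphic_derivI[OF _ open_ball that], (intro holomorphic_deriv \<alpha>(1) open_ball))+
  have E_deriv: "(E n l has_field_derivative E' n l s) (at s)" if "s \<in> ball 0 \<epsilon>" for n l s
    unfolding E_def[abs_def] E'_def
    by (auto intro!: derivative_eq_intros \<alpha>_deriv that)
  have E'_deriv: "(E' n l has_field_derivative (E' n l s * (of_nat l - of_nat n * \<alpha>' s) - E n l s * (of_nat n * deriv \<alpha>' s))) (at s)"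
    if "s \<in> ball 0 \<epsilon>" for n l s
    unfolding E'_def[abs_def]
    by (auto intro!: derivative_eq_intros E_deriv[unfolded E'_def] \<alpha>_deriv that simp: algebra_simps E'_def)
  have P_deriv: "(P N has_field_derivative (\<Sum>n<N. \<Sum>l\<le>n. E' n l s)) (at s)" if "s \<in> ball 0 \<epsilon>" for N s
    unfolding P_def[abs_def] by (intro DERIV_sum E_deriv that)
  have zero: "(0::complex) \<in> ball 0 \<epsilon>" using \<epsilon> by simp
  have P_deriv2: "(deriv ^^ 2) (P N) 0 = of_real (\<Sum>n<N. \<Sum>l\<le>n. f n l * q0 ^ n * (real l - real n * \<mu>)\<^sup>2)" for N
  proof -
    have "((\<lambda>s. \<Sum>n<N. \<Sum>l\<le>n. E' n l s) has_field_derivative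
        (\<Sum>n<N. \<Sum>l\<le>n. E' n l 0 * (of_nat l - of_nat n * \<alpha>' 0) - E n l 0 * (of_nat n * deriv \<alpha>' 0))) (at 0)"
      by (intro DERIV_sum E'_deriv zero)
    then have "(deriv (P N) has_field_derivative
        (\<Sum>n<N. \<Sum>l\<le>n. E' n l 0 * (of_nat l - of_nat n * \<alpha>' 0) - E n l 0 * (of_nat n * deriv \<alpha>' 0))) (at 0)"
      by (rule has_field_derivative_transform_within_open[OF _ open_ball zero])
         (simp add: DERIV_imp_deriv[OF P_deriv])
    then have "(deriv ^^ 2) (P N) 0 =
        (\<Sum>n<N. \<Sum>l\<le>n. E' n l 0 * (of_nat l - of_nat n * \<alpha>' 0) - E n l 0 * (of_nat n * deriv \<alpha>' 0))"
      by (simp add: numeral_2_eq_2 DERIV_imp_deriv)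
    also have "\<dots> = of_real (\<Sum>n<N. \<Sum>l\<le>n. f n l * q0 ^ n * (real l - real n * \<mu>)\<^sup>2)"
      using degenerate \<mu> by (simp add: E'_def E_def \<alpha>'_def \<alpha>(2) power2_eq_square mult_ac)
    finally show ?thesis .
  qed
  have "0 \<le> r" using r q0 by simp
  have "uniform_limit (ball 0 d)
      (\<lambda>N s. \<Sum>n<N. (\<Sum>l\<le>n. of_real (f n l) * exp (s * of_nat l)) * ?q s ^ n) (\<lambda>s. F.series (?q s) s) sequentially"
    by (rule F.uniform_limit_series[OF \<open>0 \<le> r\<close> r(2)]) (use q_le d(2) in auto)
  also have "(\<lambda>N s. \<Sum>n<N. (\<Sum>l\<le>n. of_real (f n l) * exp (s * of_nat l)) * ?q s ^ n) = P"
    unfolding P_def[abs_def] E_def[abs_def] sum_distrib_right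
    by (intro ext sum.cong refl) (simp add: power_mult_distrib exp_of_nat_mult[symmetric] exp_diff exp_minus field_simps)
  finally have ul: "uniform_limit (ball 0 d) P (\<lambda>s. F.series (?q s) s) sequentially" .
  \<comment> \<open>The infinite series may be differentiated termwise because second derivatives
    pass to uniform limits of holomorphic functions; the limit function is constantly 1.\<close>
  have "(\<lambda>N. (deriv ^^ 2) (P N) 0) \<longlonglongrightarrow> (deriv ^^ 2) (\<lambda>s. F.series (?q s) s) 0"
  proof (rule higher_deriv_complex_uniform_limit[OF ul])
    have "P N holomorphic_on ball 0 \<epsilon>" for N
      unfolding P_def[abs_def] E_def[abs_def] by (intro holomorphic_intros \<alpha>)
    then have "P N holomorphic_on ball 0 d" for N
      by (rule holomorphic_on_subset) (use d(2) in auto)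
    then show "\<forall>\<^sub>F N in sequentially. P N holomorphic_on ball 0 d" by simp
  qed (use d(1) in auto)
  moreover have "(deriv ^^ 2) (\<lambda>s. F.series (?q s) s) 0 = (deriv ^^ 2) (\<lambda>s. 1 :: complex) 0"
  proof (rule higher_deriv_cong_ev)
    have "\<forall>\<^sub>F s in nhds 0. s \<in> ball (0::complex) \<epsilon>" using \<epsilon> by (intro eventually_nhds_in_open) auto
    then show "\<forall>\<^sub>F s in nhds 0. F.series (?q s) s = 1" by eventually_elim (rule root)
  qed simp
  ultimately have "(\<lambda>N. complex_of_real (\<Sum>n<N. \<Sum>l\<le>n. f n l * q0 ^ n * (real l - real n * \<mu>)\<^sup>2)) \<longlonglongrightarrow> of_real 0"
    by (simp add: P_deriv2)
  then have lim: "(\<lambda>N. \<Sum>n<N. \<Sum>l\<le>n. f n l * q0 ^ n * (real l - real n * \<mu>)\<^sup>2) \<longlonglongrightarrow> 0"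
    by (simp only: tendsto_of_real_iff)
  define \<kappa> where "\<kappa> = f 1 1 * q0 ^ 1 * (real 1 - real 1 * \<mu>)\<^sup>2 + f 3 2 * q0 ^ 3 * (real 2 - real 3 * \<mu>)\<^sup>2"
  have nn: "f n l * q0 ^ n * (real l - real n * \<mu>)\<^sup>2 \<ge> 0" for n l
    using f_nonneg q0 by simp
  have "\<kappa> \<le> (\<Sum>n<N. \<Sum>l\<le>n. f n l * q0 ^ n * (real l - real n * \<mu>)\<^sup>2)" if "N \<ge> 4" for N
  proof -
    have "\<kappa> \<le> (\<Sum>l\<le>1. f 1 l * q0 ^ 1 * (real l - real 1 * \<mu>)\<^sup>2) + (\<Sum>l\<le>3. f 3 l * q0 ^ 3 * (real l - real 3 * \<mu>)\<^sup>2)"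
      unfolding \<kappa>_def
      by (intro add_mono member_le_sum[of 1 "{..1}" "\<lambda>l. f 1 l * q0 ^ 1 * (real l - real 1 * \<mu>)\<^sup>2"]
          member_le_sum[of 2 "{..3}" "\<lambda>l. f 3 l * q0 ^ 3 * (real l - real 3 * \<mu>)\<^sup>2"] nn) auto
    also have "\<dots> = (\<Sum>n\<in>{1, 3}. \<Sum>l\<le>n. f n l * q0 ^ n * (real l - real n * \<mu>)\<^sup>2)" by simp
    also have "\<dots> \<le> (\<Sum>n<N. \<Sum>l\<le>n. f n l * q0 ^ n * (real l - real n * \<mu>)\<^sup>2)"
      using that by (intro sum_mono2 sum_nonneg nn) auto
    finally show ?thesis .
  qed
  then have "\<kappa> \<le> 0" by (intro LIMSEQ_le_const[OF lim]) blast
  moreover have "\<kappa> > 0"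
  proof (cases "\<mu> = 1")
    case True
    then show ?thesis using f32 q0 by (simp add: \<kappa>_def)
  next
    case False
    then have "f 1 1 * q0 ^ 1 * (real 1 - real 1 * \<mu>)\<^sup>2 > 0" using f11 q0 by simp
    then show ?thesis unfolding \<kappa>_def using nn[of 3 2] by linarith
  qed
  ultimately show False by simp
qed

section \<open>Limit law from quasi-powers\<close>

lemma higher_deriv_bound_half_ball:
  assumes "h holomorphic_on ball 0 \<epsilon>" "0 < \<epsilon>" "\<And>s. s \<in> ball 0 \<epsilon> \<Longrightarrow> norm (h s) \<le> B"
    and "norm z < \<epsilon> / 2"
  shows "norm ((deriv ^^ k) h z) \<le> fact k * B / (\<epsilon> / 2) ^ k"
proof (rule Cauchy_inequality)
  have sub: "cball z (\<epsilon> / 2) \<subseteq> ball 0 \<epsilon>"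
  proof
    fix x assume "x \<in> cball z (\<epsilon> / 2)"
    then have "norm (x - z) \<le> \<epsilon> / 2" by (simp add: dist_norm norm_minus_commute)
    then have "norm x < \<epsilon>" using norm_triangle_sub[of x z] assms(4) by linarith
    then show "x \<in> ball 0 \<epsilon>" by simp
  qed
  show "h holomorphic_on ball z (\<epsilon> / 2)" by (rule holomorphic_on_subset[OF assms(1)]) (use sub in auto)
  show "continuous_on (cball z (\<epsilon> / 2)) h"
    by (rule continuous_on_subset[OF holomorphic_on_imp_continuous_on[OF assms(1)] sub])
  show "norm (h x) \<le> B" if "norm (z - x) = \<epsilon> / 2" for x
    using sub that by (intro assms(3)) (auto simp: dist_norm)
qed (use assms in simp)

lemma taylor_2_at_0:
  assumes h: "h holomorphic_on ball 0 \<epsilon>" and \<epsilon>: "0 < \<epsilon>" and B: "\<And>s. s \<in> ball 0 \<epsilon> \<Longrightarrow> norm (h s) \<le> B"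
    and z: "norm z < \<epsilon> / 2"
  shows "norm (h z - (h 0 + deriv h 0 * z + deriv (deriv h) 0 * z\<^sup>2 / 2)) \<le> 24 * B / \<epsilon> ^ 3 * norm z ^ 3"
proof -
  have "norm ((deriv ^^ 0) h z - (\<Sum>i\<le>2. (deriv ^^ i) h 0 * (z - 0) ^ i / fact i))
      \<le> (fact 3 * B / (\<epsilon> / 2) ^ 3) * norm (z - 0) ^ Suc 2 / fact 2"
  proof (rule complex_Taylor[where S = "ball 0 (\<epsilon> / 2)"])
    fix i x assume x: "x \<in> ball (0::complex) (\<epsilon> / 2)"
    have "(deriv ^^ i) h holomorphic_on ball 0 \<epsilon>" by (rule holomorphic_higher_deriv[OF h open_ball])
    then have "((deriv ^^ i) h has_field_derivative deriv ((deriv ^^ i) h) x) (at x)"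
      by (rule holomorphic_derivI) (use x \<epsilon> in auto)
    then show "((deriv ^^ i) h has_field_derivative (deriv ^^ Suc i) h x) (at x within ball 0 (\<epsilon> / 2))"
      by (simp add: has_field_derivative_at_within)
  next
    fix x assume "x \<in> ball (0::complex) (\<epsilon> / 2)"
    then show "norm ((deriv ^^ Suc 2) h x) \<le> fact 3 * B / (\<epsilon> / 2) ^ 3"
      using higher_deriv_bound_half_ball[OF h \<epsilon> B, of x 3] by (simp add: numeral_3_eq_3 numeral_2_eq_2)
  qed (use z \<epsilon> in auto)
  \<comment> \<open>The third derivative contributes 3! * 8 * B / \<epsilon>^3, and this form of
    Taylor's estimate divides by 2!, hence 24.\<close>
  also have "(fact 3 * B / (\<epsilon> / 2) ^ 3) * norm (z - 0) ^ Suc 2 / fact 2 = 24 * B / \<epsilon> ^ 3 * norm z ^ 3"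
    by (simp add: fact_numeral power_divide field_simps)
  also have "(\<Sum>i\<le>2. (deriv ^^ i) h 0 * (z - 0) ^ i / fact i) = h 0 + deriv h 0 * z + deriv (deriv h) 0 * z\<^sup>2 / 2"
    by (simp add: numeral_2_eq_2)
  finally show ?thesis by simp
qed

text \<open>With finite support the moment generating function is a finite exponential sum whose
  derivatives at 0 are the moments. Since l is merely some holomorphic logarithm, \<open>l 0\<close>
  can be any multiple of 2 pi i, and only \<open>exp (l 0) = 1\<close> is claimed.\<close>

lemma cumulants_of_log_mgf:
  fixes M :: "'a pmf" and X :: "'a \<Rightarrow> real"
  assumes fin: "finite (set_pmf M)" and l: "l holomorphic_on ball 0 \<epsilon>" and \<epsilon>: "0 < \<epsilon>"
    and mgf: "\<And>s. s \<in> ball 0 \<epsilon> \<Longrightarrow> measure_pmf.expectation M (\<lambda>\<omega>. exp (s * of_real (X \<omega>))) = exp (l s)"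
  shows "exp (l 0) = 1"
    and "deriv l 0 = of_real (measure_pmf.expectation M X)"
    and "deriv (deriv l) 0 = of_real (measure_pmf.variance M X)"
proof -
  let ?A = "set_pmf M"
  have fsum: "measure_pmf.expectation M f = (\<Sum>a\<in>?A. pmf M a *\<^sub>R f a)" for f :: "'a \<Rightarrow> 'b :: {banach, second_countable_topology}"
    by (rule integral_measure_pmf[OF fin]) auto
  have int: "integrable (measure_pmf M) f" for f :: "'a \<Rightarrow> real"
    by (rule integrable_measure_pmf_finite[OF fin])
  define m where "m k s = (\<Sum>a\<in>?A. of_real (pmf M a) * of_real (X a) ^ k * exp (s * of_real (X a)))" for k and s :: complex
  have m_deriv: "(m k has_field_derivative m (Suc k) s) (at s)" for k s
    unfolding m_def[abs_def] by (auto intro!: derivative_eq_intros sum.cong simp: mult_ac)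
  have m_mgf: "m 0 s = exp (l s)" if "s \<in> ball 0 \<epsilon>" for s
    using mgf[OF that] fsum[of "\<lambda>\<omega>. exp (s * of_real (X \<omega>))"] by (simp add: m_def scaleR_conv_of_real)
  have m_0: "m k 0 = of_real (measure_pmf.expectation M (\<lambda>\<omega>. X \<omega> ^ k))" for k
    by (simp add: m_def fsum)
  have zero: "(0::complex) \<in> ball 0 \<epsilon>" using \<epsilon> by simp
  show e0: "exp (l 0) = 1" using m_mgf[OF zero] m_0[of 0] by simp
  have l': "(l has_field_derivative deriv l s) (at s)" if "s \<in> ball 0 \<epsilon>" for s
    by (rule holomorphic_derivI[OF l open_ball that])
  have l'': "(deriv l has_field_derivative deriv (deriv l) s) (at s)" if "s \<in> ball 0 \<epsilon>" for s
    by (rule holomorphic_derivI[OF holomorphic_deriv[OF l open_ball] open_ball that])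
  have m1: "m 1 s = deriv l s * exp (l s)" if s: "s \<in> ball 0 \<epsilon>" for s
  proof -
    have "((\<lambda>s. exp (l s)) has_field_derivative m 1 s) (at s)"
      using has_field_derivative_transform_within_open[OF m_deriv[of 0 s] open_ball s m_mgf] by simp
    moreover have "((\<lambda>s. exp (l s)) has_field_derivative exp (l s) * deriv l s) (at s)"
      by (rule DERIV_fun_exp[OF l'[OF s]])
    ultimately show ?thesis using DERIV_unique by fastforce
  qed
  show d1: "deriv l 0 = of_real (measure_pmf.expectation M X)"
    using m1[OF zero] e0 m_0[of 1] by simp
  have "((\<lambda>s. deriv l s * exp (l s)) has_field_derivative m 2 0) (at 0)"
    using has_field_derivative_transform_within_open[OF m_deriv[of 1 0] open_ball zero m1] by (simp add: numeral_2_eq_2)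
  moreover have "((\<lambda>s. deriv l s * exp (l s)) has_field_derivative
      deriv (deriv l) 0 * exp (l 0) + (exp (l 0) * deriv l 0) * deriv l 0) (at 0)"
    by (rule DERIV_mult[OF l''[OF zero] DERIV_fun_exp[OF l'[OF zero]]])
  ultimately have "m 2 0 = deriv (deriv l) 0 * exp (l 0) + (exp (l 0) * deriv l 0) * deriv l 0"
    by (rule DERIV_unique)
  then have "deriv (deriv l) 0 = m 2 0 - (deriv l 0)\<^sup>2" using e0 by (simp add: power2_eq_square)
  also have "\<dots> = of_real (measure_pmf.variance M X)"
    unfolding d1 m_0 by (simp add: measure_pmf.variance_eq[OF int int])
  finally show "deriv (deriv l) 0 = of_real (measure_pmf.variance M X)" .
qed

text \<open>The setting of Hwang's quasi-powers theorem, with amplitude and error term absorbed in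
  the uniformly bounded holomorphic \<open>\<beta> n\<close>. Bounds on \<open>\<beta> n\<close>
  become bounds on its derivatives at 0, which is where the O(1) terms come from.\<close>

locale pmf_quasi_powers =
  fixes M :: "nat \<Rightarrow> 'a pmf" and X :: "nat \<Rightarrow> 'a \<Rightarrow> real"
    and \<alpha> :: "complex \<Rightarrow> complex" and \<beta> :: "nat \<Rightarrow> complex \<Rightarrow> complex" and \<epsilon> A K :: real and N :: nat
  assumes fin: "\<And>n. finite (set_pmf (M n))"
    and \<epsilon>: "0 < \<epsilon>"
    and \<alpha>_holo: "\<alpha> holomorphic_on ball 0 \<epsilon>"
    and \<alpha>_le: "\<And>s. s \<in> ball 0 \<epsilon> \<Longrightarrow> norm (\<alpha> s) \<le> A"
    and \<beta>_holo: "\<And>n. n \<ge> N \<Longrightarrow> \<beta> n holomorphic_on ball 0 \<epsilon>"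
    and \<beta>_le: "\<And>n s. n \<ge> N \<Longrightarrow> s \<in> ball 0 \<epsilon> \<Longrightarrow> norm (\<beta> n s) \<le> K"
    and mgf: "\<And>n s. n \<ge> N \<Longrightarrow> s \<in> ball 0 \<epsilon> \<Longrightarrow>
      measure_pmf.expectation (M n) (\<lambda>\<omega>. exp (s * of_real (X n \<omega>))) = exp (of_nat n * \<alpha> s + \<beta> n s)"
begin

abbreviation mean :: "nat \<Rightarrow> real" where
  "mean n \<equiv> measure_pmf.expectation (M n) (X n)"

abbreviation var :: "nat \<Rightarrow> real" where
  "var n \<equiv> measure_pmf.variance (M n) (X n)"

abbreviation l :: "nat \<Rightarrow> complex \<Rightarrow> complex" where
  "l n \<equiv> \<lambda>s. of_nat n * \<alpha> s + \<beta> n s"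

lemma l_holo: "n \<ge> N \<Longrightarrow> l n holomorphic_on ball 0 \<epsilon>"
  by (intro holomorphic_intros \<alpha>_holo \<beta>_holo)

lemma l_cumulants:
  assumes "n \<ge> N"
  shows "exp (l n 0) = 1" "deriv (l n) 0 = of_real (mean n)" "deriv (deriv (l n)) 0 = of_real (var n)"
  by (rule cumulants_of_log_mgf[OF fin l_holo[OF assms] \<epsilon> mgf[OF assms]]; assumption)+

lemma l_higher_deriv:
  assumes "n \<ge> N"
  shows "(deriv ^^ k) (l n) 0 = of_nat n * (deriv ^^ k) \<alpha> 0 + (deriv ^^ k) (\<beta> n) 0"
proof -
  have z: "(0::complex) \<in> ball 0 \<epsilon>" using \<epsilon> by simp
  have "(deriv ^^ k) (\<lambda>s. of_nat n * \<alpha> s + \<beta> n s) 0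
      = (deriv ^^ k) (\<lambda>s. of_nat n * \<alpha> s) 0 + (deriv ^^ k) (\<beta> n) 0"
    by (rule higher_deriv_add[OF _ _ open_ball z]) (intro holomorphic_intros \<alpha>_holo \<beta>_holo assms)+
  also have "(deriv ^^ k) (\<lambda>s. of_nat n * \<alpha> s) 0 = of_nat n * (deriv ^^ k) \<alpha> 0"
    by (rule higher_deriv_cmult[OF \<alpha>_holo z open_ball])
  finally show ?thesis .
qed

lemma \<beta>_higher_deriv_le:
  "n \<ge> N \<Longrightarrow> norm ((deriv ^^ k) (\<beta> n) 0) \<le> fact k * K / (\<epsilon> / 2) ^ k"
  using \<epsilon> by (intro higher_deriv_bound_half_ball \<beta>_holo \<beta>_le) auto

lemma mean_close:
  assumes "n \<ge> N"
  shows "norm (of_real (mean n) - of_nat n * deriv \<alpha> 0) \<le> 2 * K / \<epsilon>"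
  using l_higher_deriv[OF assms, of 1] \<beta>_higher_deriv_le[OF assms, of 1] l_cumulants(2)[OF assms] by (simp add: mult.commute)

lemma var_close:
  assumes "n \<ge> N"
  shows "norm (of_real (var n) - of_nat n * deriv (deriv \<alpha>) 0) \<le> 8 * K / \<epsilon>\<^sup>2"
proof -
  have "of_real (var n) - of_nat n * deriv (deriv \<alpha>) 0 = (deriv ^^ 2) (\<beta> n) 0"
    using l_higher_deriv[OF assms, of 2] l_cumulants(3)[OF assms] by (simp add: numeral_2_eq_2)
  then show ?thesis using \<beta>_higher_deriv_le[OF assms, of 2] by (simp add: power_divide)
qed

text \<open>It is not known beforehand that \<open>\<alpha>\<close> has real derivatives at 0. A
  nonzero imaginary part of the slope would make the distance to the real numbers f n grow
  linearly.\<close>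

lemma real_slope:
  fixes f :: "nat \<Rightarrow> real"
  assumes "\<And>n. n \<ge> N \<Longrightarrow> norm (of_real (f n) - of_nat n * (z::complex)) \<le> C"
  shows "Im z = 0"
proof (rule ccontr)
  assume "Im z \<noteq> 0"
  then obtain n :: nat where n: "real n > C / \<bar>Im z\<bar>" using reals_Archimedean2 by blast
  let ?n = "max n N"
  have "real ?n * \<bar>Im z\<bar> = \<bar>Im (of_real (f ?n) - of_nat ?n * z)\<bar>" by (simp add: abs_mult)
  also have "\<dots> \<le> C" using abs_Im_le_cmod order_trans assms[of ?n] by (metis max.cobounded2)
  finally have "real ?n \<le> C / \<bar>Im z\<bar>" using \<open>Im z \<noteq> 0\<close> by (simp add: field_simps)
  then show False using n by simp
qed

lemma real_part_bigo:
  fixes f :: "nat \<Rightarrow> real"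
  assumes "\<And>n. n \<ge> N \<Longrightarrow> norm (of_real (f n) - of_nat n * (z::complex)) \<le> C"
  shows "(\<lambda>n. f n - Re z * real n) \<in> O(\<lambda>n. 1)"
proof (rule bigoI[of _ C])
  show "\<forall>\<^sub>F n in sequentially. norm (f n - Re z * real n) \<le> C * norm (1 :: real)"
    using eventually_ge_at_top[of N]
  proof eventually_elim
    case (elim n)
    have "\<bar>f n - Re z * real n\<bar> = \<bar>Re (of_real (f n) - of_nat n * z)\<bar>" by (simp add: mult.commute)
    also have "\<dots> \<le> C" using abs_Re_le_cmod order_trans assms[OF elim] by metis
    finally show ?case by simp
  qed
qed

lemma deriv_\<alpha>_real: "Im (deriv \<alpha> 0) = 0" "Im (deriv (deriv \<alpha>) 0) = 0"
  using real_slope[OF mean_close] real_slope[OF var_close] by blast+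

lemma mean_bigo: "(\<lambda>n. mean n - Re (deriv \<alpha> 0) * real n) \<in> O(\<lambda>n. 1)"
  by (rule real_part_bigo[OF mean_close])

lemma var_bigo: "(\<lambda>n. var n - Re (deriv (deriv \<alpha>) 0) * real n) \<in> O(\<lambda>n. 1)"
  by (rule real_part_bigo[OF var_close])

lemma var_slope: "(\<lambda>n. var n / real n) \<longlonglongrightarrow> Re (deriv (deriv \<alpha>) 0)"
proof -
  have "(\<lambda>n. var n - Re (deriv (deriv \<alpha>) 0) * real n) \<in> o(\<lambda>n. real n)"
    by (rule landau_o.big_small_trans[OF var_bigo]) real_asymp
  then have "(\<lambda>n. (var n - Re (deriv (deriv \<alpha>) 0) * real n) / real n) \<longlonglongrightarrow> 0"
    by (rule smalloD_tendsto)
  then have "(\<lambda>n. (var n - Re (deriv (deriv \<alpha>) 0) * real n) / real n + Re (deriv (deriv \<alpha>) 0)) \<longlonglongrightarrow> 0 + Re (deriv (deriv \<alpha>) 0)"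
    by (intro tendsto_intros)
  moreover have "\<forall>\<^sub>F n in sequentially. (var n - Re (deriv (deriv \<alpha>) 0) * real n) / real n + Re (deriv (deriv \<alpha>) 0) = var n / real n"
    using eventually_gt_at_top[of 0] by eventually_elim (simp add: field_simps)
  ultimately show ?thesis using Lim_transform_eventually by fastforce
qed

lemma var_slope_nonneg: "Re (deriv (deriv \<alpha>) 0) \<ge> 0"
  by (rule tendsto_lowerbound[OF var_slope]) (auto intro!: always_eventually divide_nonneg_nonneg integral_nonneg)

text \<open>Levy's continuity theorem at z = i t / sqrt(var n). Centring by the exact mean cancels
  the linear Taylor term of \<open>l n\<close>, and scaling by the exact variance makes the
  quadratic one equal to -t^2 / 2. The remainder is of order n * n^(-3/2).\<close>

theorem asymptotically_normal:
  assumes pos: "Re (deriv (deriv \<alpha>) 0) > 0"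
  shows "asymptotically_normal M X"
  unfolding asymptotically_normal_def
proof (rule levy_continuity)
  define Y where "Y n \<omega> = (X n \<omega> - mean n) / sqrt (var n)" for n \<omega>
  show "real_distribution (distr (measure_pmf (M n)) borel (\<lambda>\<omega>. (X n \<omega> - mean n) / sqrt (var n)))" for n
    by (rule prob_space.real_distribution_distr) (auto simp: measure_pmf.prob_space_axioms)
  show "real_distribution std_normal_distribution" by (rule real_dist_normal_dist)
  fix t
  \<comment> \<open>Half the variance slope, so that eventually
    \<open>c * real n \<le> var n\<close> and \<open>z n\<close> is of order n^(-1/2).\<close>
  define c where "c = Re (deriv (deriv \<alpha>) 0) / 2"
  define C where "C = 24 * (A + K) / \<epsilon> ^ 3"
  define z where "z n = \<i> * of_real (t / sqrt (var n))" for n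
  define \<rho> where "\<rho> n = l n (z n) - (l n 0 + deriv (l n) 0 * z n + deriv (deriv (l n)) 0 * (z n)\<^sup>2 / 2)" for n
  have A: "0 \<le> A" using order_trans[OF norm_ge_zero \<alpha>_le[of 0]] \<epsilon> by simp
  have K: "0 \<le> K" using order_trans[OF norm_ge_zero \<beta>_le[of N 0]] \<epsilon> by simp
  have "c < Re (deriv (deriv \<alpha>) 0)" "0 < c" using pos by (simp_all add: c_def)
  have "\<forall>\<^sub>F n in sequentially. c < var n / real n"
    by (rule order_tendstoD(1)[OF var_slope \<open>c < _\<close>])
  then have ev_var: "\<forall>\<^sub>F n in sequentially. n \<ge> max N 1 \<and> c * real n \<le> var n"
    using eventually_ge_at_top[of "max N 1"]
    by eventually_elim (auto simp: field_simps)
  have z_norm: "norm (z n) \<le> \<bar>t\<bar> / sqrt (c * real n)" if "n \<ge> max N 1 \<and> c * real n \<le> var n" for n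
  proof -
    have pos: "0 < c * real n" using that \<open>0 < c\<close> by simp
    then have "0 < var n" using that by linarith
    then have "norm (z n) = \<bar>t\<bar> / sqrt (var n)"
      by (simp add: z_def norm_mult norm_divide del: of_real_divide)
    also have "\<dots> \<le> \<bar>t\<bar> / sqrt (c * real n)"
      using that pos by (intro frac_le real_sqrt_le_mono) auto
    finally show ?thesis .
  qed
  have "(\<lambda>n. \<bar>t\<bar> / sqrt (c * real n)) \<longlonglongrightarrow> 0" using \<open>0 < c\<close> by real_asymp
  then have "\<forall>\<^sub>F n in sequentially. \<bar>t\<bar> / sqrt (c * real n) < \<epsilon> / 2"
    using \<epsilon> by (intro order_tendstoD(2)) auto
  with ev_var have ev: "\<forall>\<^sub>F n in sequentially. n \<ge> max N 1 \<and> c * real n \<le> var n \<and> norm (z n) < \<epsilon> / 2"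
  proof eventually_elim
    case (elim n)
    then show ?case using le_less_trans[OF z_norm[OF elim(1)] elim(2)] by blast
  qed
  have \<rho>_le: "norm (\<rho> n) \<le> C * real n * (\<bar>t\<bar> / sqrt (c * real n)) ^ 3"
    if n: "n \<ge> max N 1 \<and> c * real n \<le> var n \<and> norm (z n) < \<epsilon> / 2" for n
  proof -
    \<comment> \<open>Since n >= 1, the bounded part can be absorbed into a multiple of n.\<close>
    have "norm (l n s) \<le> real n * (A + K)" if s: "s \<in> ball 0 \<epsilon>" for s
    proof -
      have "norm (l n s) \<le> real n * norm (\<alpha> s) + norm (\<beta> n s)"
        by (rule order_trans[OF norm_triangle_ineq]) (simp add: norm_mult)
      also have "\<dots> \<le> real n * A + real n * K"
        using \<alpha>_le[OF s] \<beta>_le[of n s] s n K mult_right_mono[of 1 "real n" K]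
        by (intro add_mono mult_left_mono) auto
      finally show ?thesis by (simp add: algebra_simps)
    qed
    then have "norm (\<rho> n) \<le> 24 * (real n * (A + K)) / \<epsilon> ^ 3 * norm (z n) ^ 3"
      unfolding \<rho>_def using n by (intro taylor_2_at_0 l_holo \<epsilon>) auto
    also have "\<dots> = C * real n * norm (z n) ^ 3" by (simp add: C_def)
    also have "\<dots> \<le> C * real n * (\<bar>t\<bar> / sqrt (c * real n)) ^ 3"
      using z_norm[of n] n A K \<epsilon> by (intro mult_left_mono power_mono) (auto simp: C_def)
    finally show ?thesis .
  qed
  have "(\<lambda>n. real n * (1 / sqrt (real n)) ^ 3) \<longlonglongrightarrow> 0" by real_asymp
  then have "(\<lambda>n. C * (\<bar>t\<bar> / sqrt c) ^ 3 * (real n * (1 / sqrt (real n)) ^ 3)) \<longlonglongrightarrow> 0"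
    by (rule tendsto_mult_right_zero)
  then have "(\<lambda>n. C * real n * (\<bar>t\<bar> / sqrt (c * real n)) ^ 3) \<longlonglongrightarrow> 0"
    by (simp add: real_sqrt_mult power_divide power_mult_distrib mult_ac)
  moreover have "\<forall>\<^sub>F n in sequentially. norm (\<rho> n) \<le> C * real n * (\<bar>t\<bar> / sqrt (c * real n)) ^ 3"
    using ev by eventually_elim (rule \<rho>_le)
  ultimately have "\<rho> \<longlonglongrightarrow> 0" by (rule Lim_null_comparison[rotated])
  then have "(\<lambda>n. exp (of_real (- (t\<^sup>2) / 2) + \<rho> n)) \<longlonglongrightarrow> exp (of_real (- (t\<^sup>2) / 2) + 0)"
    by (intro tendsto_intros)
  moreover have "\<forall>\<^sub>F n in sequentially. exp (of_real (- (t\<^sup>2) / 2) + \<rho> n)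
      = char (distr (measure_pmf (M n)) borel (Y n)) t"
    using ev
  proof eventually_elim
    case (elim n)
    have n: "n \<ge> N" and "0 < real n" using elim by auto
    then have v: "0 < var n" using elim \<open>0 < c\<close> mult_pos_pos[of c "real n"] by linarith
    have "char (distr (measure_pmf (M n)) borel (Y n)) t = measure_pmf.expectation (M n) (\<lambda>\<omega>. exp (\<i> * of_real (t * Y n \<omega>)))"
      unfolding char_def by (subst integral_distr) auto
    also have "\<dots> = measure_pmf.expectation (M n) (\<lambda>\<omega>. exp (- of_real (mean n) * z n) * exp (z n * of_real (X n \<omega>)))"
      by (rule Bochner_Integration.integral_cong)
         (simp_all add: Y_def z_def exp_add[symmetric] diff_divide_distrib algebra_simps)
    also have "\<dots> = exp (- of_real (mean n) * z n) * exp (l n (z n))"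
      using mgf[OF n, of "z n"] elim \<epsilon> by simp
    also have "l n (z n) = l n 0 + of_real (mean n) * z n + of_real (var n) * (z n)\<^sup>2 / 2 + \<rho> n"
      unfolding \<rho>_def l_cumulants(2,3)[OF n] by simp
    also have "of_real (var n) * (z n)\<^sup>2 / 2 = of_real (- (t\<^sup>2) / 2)"
    proof -
      have "(t / sqrt (var n))\<^sup>2 = t\<^sup>2 / var n" using v by (simp add: power_divide)
      then have "(z n)\<^sup>2 = of_real (- (t\<^sup>2 / var n))"
        by (simp only: z_def power_mult_distrib of_real_power[symmetric]) simp
      then have "of_real (var n) * (z n)\<^sup>2 / 2 = of_real (var n * - (t\<^sup>2 / var n) / 2)" by simp
      also have "var n * - (t\<^sup>2 / var n) / 2 = - (t\<^sup>2) / 2" using v by simp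
      finally show ?thesis .
    qed
    also have "exp (- of_real (mean n) * z n) * exp (l n 0 + of_real (mean n) * z n + of_real (- (t\<^sup>2) / 2) + \<rho> n)
        = exp (l n 0) * exp (of_real (- (t\<^sup>2) / 2) + \<rho> n)"
      by (simp add: exp_add[symmetric] algebra_simps)
    finally show ?case using l_cumulants(1)[OF n] by simp
  qed
  ultimately have "(\<lambda>n. char (distr (measure_pmf (M n)) borel (Y n)) t) \<longlonglongrightarrow> exp (of_real (- (t\<^sup>2) / 2) + 0)"
    by (rule Lim_transform_eventually)
  then show "(\<lambda>n. char (distr (measure_pmf (M n)) borel (\<lambda>\<omega>. (X n \<omega> - mean n) / sqrt (var n))) t)
      \<longlonglongrightarrow> char std_normal_distribution t"
    by (simp only: Y_def[abs_def] char_std_normal_distribution exp_of_real add_0_right)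
qed

end

section \<open>Compositions as weighted paths\<close>

text \<open>
  \<open>path_weight b c e l i n\<close> is the total weight of the paths with l further steps from state i,
  the states after the start being at least c and summing to n; a final step from state k contributes
  1/(bk - e)!. With e = 0 the path ends in the leaves of the last level, with e = 1 it returns to
  state 1.
\<close>

primrec path_weight :: "nat \<Rightarrow> nat \<Rightarrow> nat \<Rightarrow> nat \<Rightarrow> nat \<Rightarrow> nat \<Rightarrow> real" where
  "path_weight b c e 0 i n = (if n = 0 then 1 / fact (b * i - e) else 0)"
| "path_weight b c e (Suc l) i n = (\<Sum>k\<in>{c..min (b * i) n}. path_weight b c e l k (n - k) / fact (b * i - k))"

text \<open>Leaf depths in a forest of t trees of height l. It is used with t = b * i, the children
  of i internal nodes, and m = b * i + (b - 1) * n, the number of leaves when the forest has n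
  internal nodes.\<close>

definition power_lists :: "nat \<Rightarrow> nat \<Rightarrow> real \<Rightarrow> nat \<Rightarrow> nat list set" where
  "power_lists b m t l =
     {ks. length ks = m \<and> (\<Sum>k\<leftarrow>ks. 1 / real b ^ k) = t \<and> l \<in> set ks \<and> (\<forall>k\<in>set ks. k \<le> l)}"

lemma finite_power_lists: "b \<ge> 2 \<Longrightarrow> finite (power_lists b m t l)"
  by (rule finite_subset[OF _ finite_lists_sum_inverse_powers[of b m t]]) (auto simp: power_lists_def)

lemma sum_list_split_zeros:
  "(\<Sum>k\<leftarrow>ks. 1 / real b ^ k) = real (length (filter (\<lambda>x. x = 0) ks)) + (\<Sum>k\<leftarrow>filter (\<lambda>x. x \<noteq> 0) ks. 1 / real b ^ k)"
  by (induction ks) auto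

lemma sum_list_map_Suc:
  "(\<Sum>k\<leftarrow>map Suc ks. 1 / real b ^ k) = (\<Sum>k\<leftarrow>ks. 1 / real b ^ k) / real b"
  by (induction ks) (auto simp: add_divide_distrib)

text \<open>Such a list is a shuffle of its positive entries with its zeros; as the two have no
  entry in common, the number of shuffles is a binomial coefficient.\<close>

lemma card_insert_zeros:
  assumes S: "finite S" "\<And>ys. ys \<in> S \<Longrightarrow> length ys = r \<and> 0 \<notin> set ys"
  shows "card {ks. filter (\<lambda>x. x \<noteq> 0) ks \<in> S \<and> filter (\<lambda>x. x = (0::nat)) ks = replicate a 0} = ((r + a) choose a) * card S"
proof -
  have eq: "{ks. filter (\<lambda>x. x \<noteq> 0) ks = ys \<and> filter (\<lambda>x. x = (0::nat)) ks = replicate a 0} = shuffles ys (replicate a 0)"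
    if "ys \<in> S" for ys
  proof -
    have "x \<noteq> 0" if "x \<in> set ys" for x using S(2)[OF \<open>ys \<in> S\<close>] that by metis
    then have "partition (\<lambda>x. x \<noteq> 0) -` {(ys, replicate a 0)} = shuffles ys (replicate a 0)"
      by (intro inv_image_partition) auto
    then show ?thesis by (auto simp: o_def)
  qed
  have "{ks. filter (\<lambda>x. x \<noteq> 0) ks \<in> S \<and> filter (\<lambda>x. x = (0::nat)) ks = replicate a 0}
      = (\<Union>ys\<in>S. {ks. filter (\<lambda>x. x \<noteq> 0) ks = ys \<and> filter (\<lambda>x. x = (0::nat)) ks = replicate a 0})" by auto
  also have "card \<dots> = (\<Sum>ys\<in>S. card {ks. filter (\<lambda>x. x \<noteq> 0) ks = ys \<and> filter (\<lambda>x. x = (0::nat)) ks = replicate a 0})"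
  proof (rule card_UN_disjoint[OF S(1)])
    show "\<forall>ys\<in>S. finite {ks. filter (\<lambda>x. x \<noteq> 0) ks = ys \<and> filter (\<lambda>x. x = (0::nat)) ks = replicate a 0}"
    proof
      fix ys assume "ys \<in> S"
      show "finite {ks. filter (\<lambda>x. x \<noteq> 0) ks = ys \<and> filter (\<lambda>x. x = (0::nat)) ks = replicate a 0}"
        unfolding eq[OF \<open>ys \<in> S\<close>] by (rule finite_shuffles)
    qed
  qed blast
  also have "\<dots> = (\<Sum>ys\<in>S. (r + a) choose a)"
  proof (rule sum.cong)
    fix ys assume ys: "ys \<in> S"
    have "card (shuffles ys (replicate a 0)) = (length ys + length (replicate a (0::nat))) choose length ys"
      by (rule card_disjoint_shuffles) (use S(2)[OF ys] in auto)
    then show "card {ks. filter (\<lambda>x. x \<noteq> 0) ks = ys \<and> filter (\<lambda>x. x = (0::nat)) ks = replicate a 0} = (r + a) choose a"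
      unfolding eq[OF ys] using S(2)[OF ys] binomial_symmetric[of r "r + a"] by simp
  qed simp
  finally show ?thesis by simp
qed

lemma filter_zero_eq_replicate: "replicate (length (filter (\<lambda>x. x = (0::nat)) ks)) 0 = filter (\<lambda>x. x = 0) ks"
  by (induction ks) auto

lemma positive_eq_map_Suc: "0 \<notin> set ys \<Longrightarrow> map Suc (map (\<lambda>x. x - 1) ys) = ys"
  by (induction ys) auto

lemma step_length:
  fixes b k n :: nat
  assumes "b \<ge> 2" "k \<le> n"
  shows "b * k + (b - 1) * (n - k) = k + (b - 1) * n"
proof -
  obtain n' where "n = k + n'" using assms(2) le_Suc_ex by blast
  moreover obtain b' where "b = Suc b'" using assms(1) by (cases b) auto
  ultimately show ?thesis by (simp add: algebra_simps)
qed

text \<open>Removal of the top level. The zeros are the b * i - k leaves there and the other entries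
  sum to k; lowering these by one multiplies their sum by b, which gives state k, and k of the n
  internal nodes are used up.\<close>

lemma power_lists_step:
  assumes b: "b \<ge> 2" and k: "1 \<le> k" "k \<le> b * i" "k \<le> n"
  shows "{ks \<in> power_lists b (b * i + (b - 1) * n) (real (b * i)) (Suc l). length (filter (\<lambda>x. x = 0) ks) = b * i - k}
    = {ks. filter (\<lambda>x. x \<noteq> 0) ks \<in> map Suc ` power_lists b (b * k + (b - 1) * (n - k)) (real (b * k)) l
        \<and> filter (\<lambda>x. x = 0) ks = replicate (b * i - k) 0}" (is "?L = ?R")
proof -
  note len = step_length[OF b k(3)]
  have split: "length ks = length (filter (\<lambda>x. x = 0) ks) + length (filter (\<lambda>x. x \<noteq> 0) ks)" for ks :: "nat list"
    using sum_length_filter_compl[of "\<lambda>x. x = 0" ks] by simp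
  have set_split: "Suc l \<in> set ks \<and> (\<forall>x\<in>set ks. x \<le> Suc l) \<longleftrightarrow>
      Suc l \<in> set (filter (\<lambda>x. x \<noteq> 0) ks) \<and> (\<forall>x\<in>set (filter (\<lambda>x. x \<noteq> 0) ks). x \<le> Suc l)" for ks
    by auto
  have bk: "real (b * i) = real (b * i - k) + real k" using k(2) by linarith
  have main: "ks \<in> power_lists b (b * i + (b - 1) * n) (real (b * i)) (Suc l) \<longleftrightarrow>
      ys \<in> power_lists b (b * k + (b - 1) * (n - k)) (real (b * k)) l"
    if zeros: "length (filter (\<lambda>x. x = 0) ks) = b * i - k" and ys: "filter (\<lambda>x. x \<noteq> 0) ks = map Suc ys" for ks ys
  proof -
    have "length ks = b * i + (b - 1) * n \<longleftrightarrow> length ys = b * k + (b - 1) * (n - k)"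
      using split[of ks] k(2) unfolding zeros ys len by auto
    moreover have "(\<Sum>k\<leftarrow>ks. 1 / real b ^ k) = real (b * i) \<longleftrightarrow> (\<Sum>k\<leftarrow>ys. 1 / real b ^ k) = real (b * k)"
      unfolding sum_list_split_zeros[of b ks] zeros ys sum_list_map_Suc bk using b by (simp add: field_simps)
    moreover have "Suc l \<in> set ks \<and> (\<forall>x\<in>set ks. x \<le> Suc l) \<longleftrightarrow> l \<in> set ys \<and> (\<forall>x\<in>set ys. x \<le> l)"
      unfolding set_split[of ks] ys by auto
    ultimately show ?thesis unfolding power_lists_def by blast
  qed
  show ?thesis
  proof (intro set_eqI iffI)
    fix ks assume ks: "ks \<in> ?L"
    then have zeros: "length (filter (\<lambda>x. x = 0) ks) = b * i - k" by simp
    obtain ys where ys: "filter (\<lambda>x. x \<noteq> 0) ks = map Suc ys"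
    proof
      show "filter (\<lambda>x. x \<noteq> 0) ks = map Suc (map (\<lambda>x. x - 1) (filter (\<lambda>x. x \<noteq> 0) ks))"
        by (rule positive_eq_map_Suc[symmetric]) simp
    qed
    have "ys \<in> power_lists b (b * k + (b - 1) * (n - k)) (real (b * k)) l"
      using main[OF zeros ys] ks by simp
    then show "ks \<in> ?R" using ys zeros filter_zero_eq_replicate[of ks, symmetric] by simp
  next
    fix ks assume ks: "ks \<in> ?R"
    then have zeros: "length (filter (\<lambda>x. x = 0) ks) = b * i - k" by simp
    obtain ys where ys: "filter (\<lambda>x. x \<noteq> 0) ks = map Suc ys"
      and "ys \<in> power_lists b (b * k + (b - 1) * (n - k)) (real (b * k)) l" using ks by auto
    then show "ks \<in> ?L" using main[OF zeros ys] zeros by simp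
  qed
qed

text \<open>No tree is constructed; lengths and sums suffice. The maximum \<open>Suc l\<close>
  forces a positive entry, so there are fewer than b * i zeros. With k = b * i minus the number of
  zeros, the positive entries number k + (b - 1) * n, each contributes at most 1 / b, and so b * k
  <= k + (b - 1) * n, that is, k <= n.\<close>

lemma power_lists_zeros:
  assumes b: "b \<ge> 2" and ks: "ks \<in> power_lists b (b * i + (b - 1) * n) (real (b * i)) (Suc l)"
  shows "\<exists>k\<in>{1..min (b * i) n}. length (filter (\<lambda>x. x = 0) ks) = b * i - k"
proof -
  let ?a = "length (filter (\<lambda>x. x = 0) ks)" and ?ys = "filter (\<lambda>x. x \<noteq> 0) ks"
  have len: "length ks = b * i + (b - 1) * n" and sum: "(\<Sum>k\<leftarrow>ks. 1 / real b ^ k) = real (b * i)" and l: "Suc l \<in> set ks"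
    using ks by (auto simp: power_lists_def)
  have tot: "real (b * i) = real ?a + (\<Sum>k\<leftarrow>?ys. 1 / real b ^ k)"
    using sum sum_list_split_zeros[of b ks] by simp
  have "1 / real b ^ Suc l \<le> (\<Sum>k\<leftarrow>?ys. 1 / real b ^ k)"
  proof (rule member_le_sum_list)
    have "Suc l \<in> set ?ys" using l by simp
    then show "1 / real b ^ Suc l \<in> set (map (\<lambda>k. 1 / real b ^ k) ?ys)"
      unfolding set_map by (rule imageI)
  qed auto
  moreover have "0 < 1 / real b ^ Suc l" using b by simp
  ultimately have "real ?a < real (b * i)" using tot by linarith
  then have a: "?a < b * i" by (simp only: of_nat_less_iff)
  have "(\<Sum>k\<leftarrow>?ys. 1 / real b ^ k) \<le> (\<Sum>k\<leftarrow>?ys. 1 / real b)"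
  proof (rule sum_list_mono)
    fix k assume "k \<in> set ?ys"
    then have "real b ^ 1 \<le> real b ^ k" using b by (intro power_increasing) auto
    then show "1 / real b ^ k \<le> 1 / real b" using b by (intro divide_left_mono) auto
  qed
  also have "\<dots> = real (length ?ys) / real b" by (simp add: sum_list_triv)
  also have "length ?ys = b * i + (b - 1) * n - ?a"
    using sum_length_filter_compl[of "\<lambda>x. x = 0" ks] len by simp
  finally have "real (b * i) - real ?a \<le> real (b * i + (b - 1) * n - ?a) / real b" using tot by linarith
  moreover have "0 < real b" using b by simp
  ultimately have "(real (b * i) - real ?a) * real b \<le> real (b * i + (b - 1) * n - ?a)"
    by (simp only: pos_le_divide_eq)
  also have "real (b * i + (b - 1) * n - ?a) = (real (b * i) - real ?a) + (real b - 1) * real n"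
    using a b by (simp add: of_nat_diff)
  finally have "(real b - 1) * (real (b * i) - real ?a) \<le> (real b - 1) * real n"
    by (simp add: algebra_simps)
  then have "real (b * i) - real ?a \<le> real n" using b by simp
  then have "real (b * i - ?a) \<le> real n" using a by (simp only: of_nat_diff less_imp_le)
  then have "b * i - ?a \<le> n" by (simp only: of_nat_le_iff)
  then show ?thesis using a by (intro bexI[of _ "b * i - ?a"]) auto
qed

text \<open>The multinomial coefficient is built up level by level: in the binomial coefficient for
  the positions of the zeros, one factorial in the denominator cancels the factorial of the shorter
  length from the induction hypothesis.\<close>

lemma card_power_lists:
  assumes b: "b \<ge> 2" and "i \<ge> 1"
  shows "real (card (power_lists b (b * i + (b - 1) * n) (real (b * i)) l))
    = fact (b * i + (b - 1) * n) * path_weight b 1 0 l i n"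
  using \<open>i \<ge> 1\<close>
proof (induction l arbitrary: i n)
  case 0
  have eq: "ks = replicate (length ks) 0" if "\<forall>k\<in>set ks. k \<le> 0" for ks :: "nat list"
    using that by (simp add: replicate_length_same)
  show ?case
  proof (cases "n = 0")
    case True
    have "power_lists b (b * i) (real (b * i)) 0 = {replicate (b * i) 0}"
    proof (intro set_eqI iffI)
      fix ks assume "ks \<in> power_lists b (b * i) (real (b * i)) 0"
      then show "ks \<in> {replicate (b * i) 0}" using eq[of ks] by (auto simp: power_lists_def)
    next
      fix ks assume "ks \<in> {replicate (b * i) (0::nat)}"
      then show "ks \<in> power_lists b (b * i) (real (b * i)) 0"
        using b 0 by (auto simp: power_lists_def sum_list_replicate)
    qed
    then show ?thesis using True by simp
  next
    case False
    have "ks \<notin> power_lists b (b * i + (b - 1) * n) (real (b * i)) 0" for ks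
    proof
      assume ks: "ks \<in> power_lists b (b * i + (b - 1) * n) (real (b * i)) 0"
      then have "ks = replicate (b * i + (b - 1) * n) 0" using eq[of ks] by (auto simp: power_lists_def)
      then have "(\<Sum>k\<leftarrow>ks. 1 / real b ^ k) = real (b * i + (b - 1) * n)" by (simp add: sum_list_replicate)
      then have "b * i + (b - 1) * n = b * i" using ks by (simp only: power_lists_def mem_Collect_eq of_nat_eq_iff)
      then show False using b False by simp
    qed
    then have "power_lists b (b * i + (b - 1) * n) (real (b * i)) 0 = {}" by blast
    then show ?thesis using False by simp
  qed
next
  case (Suc l)
  let ?m = "b * i + (b - 1) * n"
  let ?A = "power_lists b ?m (real (b * i)) (Suc l)"
  let ?S = "\<lambda>k. power_lists b (b * k + (b - 1) * (n - k)) (real (b * k)) l"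
  let ?Ak = "\<lambda>k. {ks \<in> ?A. length (filter (\<lambda>x. x = 0) ks) = b * i - k}"
  have fin: "finite ?A" by (rule finite_power_lists[OF b])
  have "?A = (\<Union>k\<in>{1..min (b * i) n}. ?Ak k)"
    using power_lists_zeros[OF b] by blast
  then have "card ?A = card (\<Union>k\<in>{1..min (b * i) n}. ?Ak k)" by simp
  also have "\<dots> = (\<Sum>k\<in>{1..min (b * i) n}. card (?Ak k))"
    by (rule card_UN_disjoint) (use fin in auto)
  finally have "real (card ?A) = (\<Sum>k\<in>{1..min (b * i) n}. real (card (?Ak k)))" by simp
  also have "\<dots> = (\<Sum>k\<in>{1..min (b * i) n}. fact ?m * (path_weight b 1 0 l k (n - k) / fact (b * i - k)))"
  proof (rule sum.cong)
    fix k assume "k \<in> {1..min (b * i) n}"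
    then have k: "1 \<le> k" "k \<le> b * i" "k \<le> n" by auto
    have len: "b * k + (b - 1) * (n - k) + (b * i - k) = ?m"
      using step_length[OF b k(3)] k(2) by linarith
    let ?r = "b * k + (b - 1) * (n - k)"
    have "card (?Ak k) = ((?r + (b * i - k)) choose (b * i - k)) * card (map Suc ` ?S k)"
      unfolding power_lists_step[OF b k]
      by (rule card_insert_zeros) (use finite_power_lists[OF b] in \<open>auto simp: power_lists_def\<close>)
    also have "card (map Suc ` ?S k) = card (?S k)"
      by (intro card_image) (auto simp: inj_on_def)
    finally have eq: "card (?Ak k) = (?m choose (b * i - k)) * card (?S k)" unfolding len .
    have "real (card (?Ak k)) = real (?m choose (b * i - k)) * real (card (?S k))"
      unfolding eq by (rule of_nat_mult)
    also have "real (card (?S k)) = fact ?r * path_weight b 1 0 l k (n - k)"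
      by (rule Suc.IH[OF k(1)])
    also have "real (?m choose (b * i - k)) = fact ?m / (fact (b * i - k) * fact ?r)"
    proof -
      have "b * i - k \<le> ?m" "?m - (b * i - k) = ?r" using len by linarith+
      then show ?thesis using binomial_fact[of "b * i - k" ?m, where ?'a = real] by simp
    qed
    finally show "real (card (?Ak k)) = fact ?m * (path_weight b 1 0 l k (n - k) / fact (b * i - k))"
      by simp
  qed simp
  finally show ?case by (simp add: sum_distrib_left)
qed

lemma path_weight_nonneg: "path_weight b c e l i n \<ge> 0"
  by (induction l arbitrary: i n) (auto intro!: sum_nonneg)

text \<open>Every further state takes at least 1 from n. This is what makes the finite range l <= n
  in the generating functions below complete.\<close>

lemma path_weight_eq_0: "n < l \<Longrightarrow> 1 \<le> c \<Longrightarrow> path_weight b c e l i n = 0"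
  by (induction l arbitrary: i n) (auto intro!: sum.neutral)

section \<open>From compositions to paths starting at state 1\<close>

lemma compositions_zero_notin:
  assumes b: "b \<ge> 2" and ks: "ks \<in> compositions b (Suc n)"
  shows "0 \<notin> set ks"
proof
  assume 0: "0 \<in> set ks"
  let ?z = "filter (\<lambda>x. x = 0) ks" and ?ys = "filter (\<lambda>x. x \<noteq> 0) ks"
  have len: "length ks = (b - 1) * Suc n + 1" and sum: "(\<Sum>k\<leftarrow>ks. 1 / real b ^ k) = 1"
    using ks by (auto simp: compositions_def)
  have tot: "real (length ?z) + (\<Sum>k\<leftarrow>?ys. 1 / real b ^ k) = 1"
    using sum sum_list_split_zeros[of b ks] by simp
  have z: "real (length ?z) \<ge> 1"
  proof -
    have "?z \<noteq> []" using 0 by (auto simp: filter_empty_conv)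
    then have "length ?z \<ge> 1" by (cases ?z) auto
    then show ?thesis by simp
  qed
  \<comment> \<open>A zero part already exhausts the sum 1, so no positive part fits; yet there are
    at least b >= 2 parts.\<close>
  have "?ys = []"
  proof (rule ccontr)
    assume "?ys \<noteq> []"
    then obtain y where y: "y \<in> set ?ys" by fastforce
    have "1 / real b ^ y \<le> (\<Sum>k\<leftarrow>?ys. 1 / real b ^ k)"
    proof (rule member_le_sum_list)
      show "1 / real b ^ y \<in> set (map (\<lambda>k. 1 / real b ^ k) ?ys)" unfolding set_map using y by (rule imageI)
    qed auto
    moreover have "0 < 1 / real b ^ y" using b by simp
    ultimately show False using tot z by linarith
  qed
  then have "length ks = length ?z" and "real (length ?z) = 1"
    using sum_length_filter_compl[of "\<lambda>x. x = 0" ks] tot by auto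
  then show False using len b by simp
qed

text \<open>With index n + 1 the root of the tree is internal. Removing it lowers all parts by one,
  turns the sum 1 into b * 1, that is, state 1, and leaves n internal nodes. The same shift makes
  the largest exponent one more than the number of further steps.\<close>

lemma composition_fibre:
  assumes b: "b \<ge> 2"
  shows "{ks \<in> compositions b (Suc n). largest_exponent ks = Suc l}
    = map Suc ` power_lists b (b * 1 + (b - 1) * n) (real (b * 1)) l" (is "?L = ?R")
proof -
  have len: "(b - 1) * Suc n + 1 = b * 1 + (b - 1) * n" using b by simp
  have main: "map Suc ys \<in> ?L \<longleftrightarrow> ys \<in> power_lists b (b * 1 + (b - 1) * n) (real (b * 1)) l" for ys
  proof -
    have "length (map Suc ys) = (b - 1) * Suc n + 1 \<longleftrightarrow> length ys = b * 1 + (b - 1) * n"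
      unfolding len by simp
    moreover have "(\<Sum>k\<leftarrow>map Suc ys. 1 / real b ^ k) = 1 \<longleftrightarrow> (\<Sum>k\<leftarrow>ys. 1 / real b ^ k) = real (b * 1)"
      unfolding sum_list_map_Suc using b by auto
    moreover have "largest_exponent (map Suc ys) = Suc l \<longleftrightarrow> l \<in> set ys \<and> (\<forall>y\<in>set ys. y \<le> l)"
      if "length ys = b * 1 + (b - 1) * n"
    proof -
      have "set ys \<noteq> {}" using that b by auto
      then have "Max (set (map Suc ys)) = Suc l \<longleftrightarrow> Suc l \<in> set (map Suc ys) \<and> (\<forall>y\<in>set (map Suc ys). y \<le> Suc l)"
        by (intro Max_eq_iff) auto
      then show ?thesis by (auto simp: largest_exponent_def)
    qed
    ultimately show ?thesis unfolding power_lists_def compositions_def by blast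
  qed
  show ?thesis
  proof (intro set_eqI iffI)
    fix ks assume ks: "ks \<in> ?L"
    then have eq: "map Suc (map (\<lambda>x. x - 1) ks) = ks"
      using compositions_zero_notin[OF b] by (intro positive_eq_map_Suc) blast
    have "map Suc (map (\<lambda>x. x - 1) ks) \<in> ?L" unfolding eq by (rule ks)
    then have "map (\<lambda>x. x - 1) ks \<in> power_lists b (b * 1 + (b - 1) * n) (real (b * 1)) l"
      unfolding main .
    from imageI[OF this, of "map Suc"] show "ks \<in> ?R" unfolding eq .
  next
    fix ks assume "ks \<in> ?R"
    then obtain ys where "ks = map Suc ys" "ys \<in> power_lists b (b * 1 + (b - 1) * n) (real (b * 1)) l" by blast
    then show "ks \<in> ?L" using main by blast
  qed
qed

lemma largest_exponent_pos:
  assumes b: "b \<ge> 2" and ks: "ks \<in> compositions b (Suc n)"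
  shows "largest_exponent ks > 0"
proof -
  have "ks \<noteq> []" using ks by (auto simp: compositions_def)
  then have "largest_exponent ks \<in> set ks" unfolding largest_exponent_def by (intro Max_in) auto
  then show ?thesis using compositions_zero_notin[OF b ks] by (metis gr0I)
qed

lemma card_composition_fibre:
  assumes b: "b \<ge> 2"
  shows "real (card {ks \<in> compositions b (Suc n). largest_exponent ks = Suc l})
    = fact (b * 1 + (b - 1) * n) * path_weight b 1 0 l 1 n"
proof -
  have "card (map Suc ` power_lists b (b * 1 + (b - 1) * n) (real (b * 1)) l)
      = card (power_lists b (b * 1 + (b - 1) * n) (real (b * 1)) l)"
    by (intro card_image) (auto simp: inj_on_def)
  then show ?thesis unfolding composition_fibre[OF b] using card_power_lists[OF b, of 1 n l] by simp
qed

lemma sum_compositions_by_largest_exponent: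
  fixes h :: "nat \<Rightarrow> complex"
  assumes b: "b \<ge> 2"
  shows "(\<Sum>ks\<in>compositions b (Suc n). h (largest_exponent ks))
    = fact (b * 1 + (b - 1) * n) * (\<Sum>l\<le>n. of_real (path_weight b 1 0 l 1 n) * h (Suc l))"
proof -
  let ?S = "compositions b (Suc n)"
  let ?fib = "\<lambda>l. {ks \<in> ?S. largest_exponent ks = Suc l}"
  have fin: "finite ?S" by (rule finite_compositions[OF b])
  have "largest_exponent ks \<in> Suc ` {..n}" if ks: "ks \<in> ?S" for ks
  proof -
    obtain l where l: "largest_exponent ks = Suc l" using largest_exponent_pos[OF b ks] by (cases "largest_exponent ks") auto
    have "?fib l \<noteq> {}" using ks l by blast
    then have "card (?fib l) \<noteq> 0" using fin by simp
    then have "path_weight b 1 0 l 1 n \<noteq> 0" using card_composition_fibre[OF b, of n l] by (metis mult_zero_right of_nat_eq_0_iff)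
    then have "l \<le> n" using path_weight_eq_0[of n l 1 b 0 1] by (metis not_le order_refl)
    then show ?thesis using l by simp
  qed
  then have "(\<Sum>ks\<in>?S. h (largest_exponent ks)) = (\<Sum>y\<in>Suc ` {..n}. \<Sum>ks\<in>{ks \<in> ?S. largest_exponent ks = y}. h (largest_exponent ks))"
    by (intro sum.group[symmetric] fin) auto
  also have "\<dots> = (\<Sum>l\<le>n. \<Sum>ks\<in>?fib l. h (largest_exponent ks))"
    by (subst sum.reindex) auto
  also have "\<dots> = (\<Sum>l\<le>n. of_nat (card (?fib l)) * h (Suc l))"
    by (intro sum.cong) auto
  also have "\<dots> = (\<Sum>l\<le>n. fact (b * 1 + (b - 1) * n) * (of_real (path_weight b 1 0 l 1 n) * h (Suc l)))"
  proof (intro sum.cong refl)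
    fix l
    have "complex_of_real (real (card (?fib l))) = of_real (fact (b * 1 + (b - 1) * n) * path_weight b 1 0 l 1 n)"
      using card_composition_fibre[OF b, of n l] by (rule arg_cong)
    then have "of_nat (card (?fib l)) = fact (b * 1 + (b - 1) * n) * complex_of_real (path_weight b 1 0 l 1 n)"
      by (simp only: of_real_mult of_real_fact of_real_of_nat_eq)
    then show "of_nat (card (?fib l)) * h (Suc l) = fact (b * 1 + (b - 1) * n) * (of_real (path_weight b 1 0 l 1 n) * h (Suc l))"
      by simp
  qed
  finally show ?thesis by (simp only: sum_distrib_left)
qed

lemma mgf_random_composition:
  assumes b: "b \<ge> 2"
  shows "measure_pmf.expectation (random_composition b (Suc n)) (\<lambda>ks. exp (s * of_real (real (largest_exponent ks))))
    = (\<Sum>l\<le>n. of_real (path_weight b 1 0 l 1 n) * exp (s * of_nat (Suc l)))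
      / (\<Sum>l\<le>n. complex_of_real (path_weight b 1 0 l 1 n))"
proof -
  let ?S = "compositions b (Suc n)" and ?F = "fact (b * 1 + (b - 1) * n) :: complex"
  have S: "finite ?S" "?S \<noteq> {}" using finite_compositions[OF b] compositions_nonempty[OF b] by auto
  have "measure_pmf.expectation (random_composition b (Suc n)) (\<lambda>ks. exp (s * of_real (real (largest_exponent ks))))
      = (\<Sum>ks\<in>?S. pmf (pmf_of_set ?S) ks *\<^sub>R exp (s * of_real (real (largest_exponent ks))))"
    unfolding random_composition_def by (rule integral_measure_pmf) (use S in auto)
  also have "\<dots> = (\<Sum>ks\<in>?S. exp (s * of_nat (largest_exponent ks)) / of_nat (card ?S))"
    using S by (intro sum.cong) (auto simp: scaleR_conv_of_real)
  also have "\<dots> = (\<Sum>ks\<in>?S. exp (s * of_nat (largest_exponent ks))) / (\<Sum>ks\<in>?S. 1)"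
    by (simp add: sum_divide_distrib)
  also have "\<dots> = (?F * (\<Sum>l\<le>n. of_real (path_weight b 1 0 l 1 n) * exp (s * of_nat (Suc l))))
      / (?F * (\<Sum>l\<le>n. complex_of_real (path_weight b 1 0 l 1 n)))"
    using sum_compositions_by_largest_exponent[OF b, of "\<lambda>l. exp (s * of_nat l)" n]
      sum_compositions_by_largest_exponent[OF b, of "\<lambda>l. 1" n] by simp
  finally show ?thesis by simp
qed

text \<open>The exponent \<open>Suc l\<close> counts the final step too, so that exponents add when
  paths are concatenated and, for e = 0, agree with the largest exponent. The type stays general
  because the function is evaluated at x = 1 over the reals and at x = \<open>exp s\<close> over the
  complex numbers.\<close>

definition path_gf :: "nat \<Rightarrow> nat \<Rightarrow> nat \<Rightarrow> 'a::real_normed_field \<Rightarrow> nat \<Rightarrow> nat \<Rightarrow> 'a" where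
  "path_gf b c e x i n = (\<Sum>l\<le>n. of_real (path_weight b c e l i n) * x ^ Suc l)"

lemma path_gf_rec:
  assumes c: "1 \<le> c"
  shows "path_gf b c e x i n =
    x * ((if n = 0 then 1 / fact (b * i - e) else 0) + (\<Sum>k\<in>{c..min (b * i) n}. path_gf b c e x k (n - k) / fact (b * i - k)))"
proof -
  \<comment> \<open>Weights with more steps than the sum n are 0, so the range of l can be stretched
    to one common to all k before the sums are exchanged.\<close>
  have ext: "path_gf b c e x k j = (\<Sum>l<m. of_real (path_weight b c e l k j) * x ^ Suc l)" if "j < m" for k j m
    unfolding path_gf_def
    by (rule sum.mono_neutral_left) (use that path_weight_eq_0[OF _ c] in auto)
  have "path_gf b c e x i n = (\<Sum>l<Suc n. of_real (path_weight b c e l i n) * x ^ Suc l)"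
    by (rule ext) simp
  also have "\<dots> = of_real (path_weight b c e 0 i n) * x + (\<Sum>l<n. of_real (path_weight b c e (Suc l) i n) * x ^ Suc (Suc l))"
    by (subst sum.lessThan_Suc_shift) simp
  also have "(\<Sum>l<n. of_real (path_weight b c e (Suc l) i n) * x ^ Suc (Suc l))
      = (\<Sum>l<n. \<Sum>k\<in>{c..min (b * i) n}. x * (of_real (path_weight b c e l k (n - k)) * x ^ Suc l / fact (b * i - k)))"
    unfolding path_weight.simps of_real_sum sum_distrib_right
    by (intro sum.cong refl) (simp add: mult_ac)
  also have "\<dots> = (\<Sum>k\<in>{c..min (b * i) n}. \<Sum>l<n. x * (of_real (path_weight b c e l k (n - k)) * x ^ Suc l / fact (b * i - k)))"
    by (rule sum.swap)
  also have "\<dots> = (\<Sum>k\<in>{c..min (b * i) n}. x * (path_gf b c e x k (n - k) / fact (b * i - k)))"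
  proof (rule sum.cong[OF refl])
    fix k assume "k \<in> {c..min (b * i) n}"
    then have "n - k < n" using c by auto
    then show "(\<Sum>l<n. x * (of_real (path_weight b c e l k (n - k)) * x ^ Suc l / fact (b * i - k)))
        = x * (path_gf b c e x k (n - k) / fact (b * i - k))"
      by (simp only: ext[of "n - k" n] sum_distrib_left sum_divide_distrib)
  qed
  finally show ?thesis by (simp add: sum_distrib_left distrib_left mult.commute)
qed

text \<open>Decomposition of a path at its first return to state 1.\<close>

lemma path_gf_renewal:
  assumes b: "b \<ge> 1" and "i \<ge> 1"
  shows "path_gf b 1 0 x i n = path_gf b 2 0 x i n + (\<Sum>j<n. path_gf b 2 1 x i j * path_gf b 1 0 x 1 (n - 1 - j))"
  using \<open>i \<ge> 1\<close>
proof (induction n arbitrary: i rule: less_induct)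
  case (less n i)
  have bi: "1 \<le> b * i" using b less.prems by simp
  let ?w = "path_gf b 1 0 x" and ?u = "path_gf b 2 0 x" and ?v = "path_gf b 2 1 x"
  show ?case
  proof (cases "n = 0")
    case True
    then show ?thesis
      using path_gf_rec[of 1 b 0 x i n] path_gf_rec[of 2 b 0 x i n] by simp
  next
    case False
    then have n: "1 \<le> n" by simp
    let ?K = "{2..min (b * i) n}"
    \<comment> \<open>The term k = 1 is an immediate return to state 1; the other first steps fall
      under the induction hypothesis.\<close>
    have "{1..min (b * i) n} = insert 1 ?K" using n bi by auto
    then have "?w i n = x * (?w 1 (n - 1) / fact (b * i - 1) + (\<Sum>k\<in>?K. ?w k (n - k) / fact (b * i - k)))"
      using path_gf_rec[of 1 b 0 x i n] False by simp
    also have "(\<Sum>k\<in>?K. ?w k (n - k) / fact (b * i - k))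
        = (\<Sum>k\<in>?K. ?u k (n - k) / fact (b * i - k)) + (\<Sum>k\<in>?K. \<Sum>j<n - k. ?v k j * ?w 1 (n - 1 - (j + k)) / fact (b * i - k))"
      unfolding sum.distrib[symmetric]
    proof (rule sum.cong[OF refl])
      fix k assume k: "k \<in> ?K"
      have "?w k (n - k) = ?u k (n - k) + (\<Sum>j<n - k. ?v k j * ?w 1 (n - k - 1 - j))"
        using k by (intro less.IH) auto
      also have "(\<Sum>j<n - k. ?v k j * ?w 1 (n - k - 1 - j)) = (\<Sum>j<n - k. ?v k j * ?w 1 (n - 1 - (j + k)))"
        by (intro sum.cong refl arg_cong2[where f = "(*)"] arg_cong2[where f = "?w"]) auto
      finally show "?w k (n - k) / fact (b * i - k)
          = ?u k (n - k) / fact (b * i - k) + (\<Sum>j<n - k. ?v k j * ?w 1 (n - 1 - (j + k)) / fact (b * i - k))"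
        by (simp add: add_divide_distrib sum_divide_distrib)
    qed
    also have "(\<Sum>k\<in>?K. \<Sum>j<n - k. ?v k j * ?w 1 (n - 1 - (j + k)) / fact (b * i - k))
        = (\<Sum>j<n. \<Sum>k\<in>{2..min (b * i) j}. ?v k (j - k) * ?w 1 (n - 1 - j) / fact (b * i - k))"
    proof -
      have "(\<Sum>k\<in>?K. \<Sum>j<n - k. ?v k j * ?w 1 (n - 1 - (j + k)) / fact (b * i - k))
          = (\<Sum>(k, j)\<in>Sigma ?K (\<lambda>k. {..<n - k}). ?v k j * ?w 1 (n - 1 - (j + k)) / fact (b * i - k))"
        by (rule sum.Sigma) auto
      \<comment> \<open>The new j is the sum of all states before the return, now including the
        first state k; hence n - 1 - j is left after the returning state 1.\<close>
      also have "\<dots> = (\<Sum>(j, k)\<in>Sigma {..<n} (\<lambda>j. {2..min (b * i) j}). ?v k (j - k) * ?w 1 (n - 1 - j) / fact (b * i - k))"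
        by (rule sum.reindex_bij_witness[of _ "\<lambda>(j, k). (k, j - k)" "\<lambda>(k, j). (j + k, k)"]) auto
      also have "\<dots> = (\<Sum>j<n. \<Sum>k\<in>{2..min (b * i) j}. ?v k (j - k) * ?w 1 (n - 1 - j) / fact (b * i - k))"
        by (rule sum.Sigma[symmetric]) auto
      finally show ?thesis .
    qed
    finally have w: "?w i n = x * (\<Sum>k\<in>?K. ?u k (n - k) / fact (b * i - k))
        + x * (?w 1 (n - 1) / fact (b * i - 1) + (\<Sum>j<n. \<Sum>k\<in>{2..min (b * i) j}. ?v k (j - k) * ?w 1 (n - 1 - j) / fact (b * i - k)))"
      by (simp add: algebra_simps)
    have "(\<Sum>j<n. ?v i j * ?w 1 (n - 1 - j))
        = (\<Sum>j<n. x * (if j = 0 then ?w 1 (n - 1) / fact (b * i - 1) else 0)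
            + x * (\<Sum>k\<in>{2..min (b * i) j}. ?v k (j - k) * ?w 1 (n - 1 - j) / fact (b * i - k)))"
    proof (rule sum.cong[OF refl])
      fix j
      have "?v i j = x * ((if j = 0 then 1 / fact (b * i - 1) else 0) + (\<Sum>k\<in>{2..min (b * i) j}. ?v k (j - k) / fact (b * i - k)))"
        by (rule path_gf_rec) simp
      then show "?v i j * ?w 1 (n - 1 - j) = x * (if j = 0 then ?w 1 (n - 1) / fact (b * i - 1) else 0)
            + x * (\<Sum>k\<in>{2..min (b * i) j}. ?v k (j - k) * ?w 1 (n - 1 - j) / fact (b * i - k))"
        by (simp add: distrib_left distrib_right sum_distrib_right)
    qed
    also have "\<dots> = x * (?w 1 (n - 1) / fact (b * i - 1)) + x * (\<Sum>j<n. \<Sum>k\<in>{2..min (b * i) j}. ?v k (j - k) * ?w 1 (n - 1 - j) / fact (b * i - k))"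
      using n by (simp add: sum.distrib sum_distrib_left[symmetric] sum.delta)
    finally have v: "(\<Sum>j<n. ?v i j * ?w 1 (n - 1 - j)) = \<dots>" .
    have u: "?u i n = x * (\<Sum>k\<in>?K. ?u k (n - k) / fact (b * i - k))"
      using path_gf_rec[of 2 b 0 x i n] False by simp
    show ?thesis unfolding w u v by (simp add: distrib_left)
  qed
qed

text \<open>The polynomial has degree at most n + 1 in x, so passing from x = 1 to a complex x costs
  a factor of at most y per unit of n, which only reduces the radius of convergence.\<close>

lemma norm_path_gf_le:
  fixes x :: complex
  assumes "norm x \<le> y" "1 \<le> y"
  shows "norm (path_gf b c e x i n) \<le> y ^ Suc n * path_gf b c e 1 i n"
proof -
  have "norm (path_gf b c e x i n) \<le> (\<Sum>l\<le>n. norm (of_real (path_weight b c e l i n) * x ^ Suc l))"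
    unfolding path_gf_def by (rule norm_sum)
  also have "\<dots> \<le> (\<Sum>l\<le>n. path_weight b c e l i n * y ^ Suc n)"
  proof (rule sum_mono)
    fix l assume l: "l \<in> {..n}"
    have "norm x ^ Suc l \<le> y ^ Suc l" using assms by (intro power_mono) auto
    also have "\<dots> \<le> y ^ Suc n" using l assms(2) by (intro power_increasing) auto
    finally have "norm x ^ Suc l \<le> y ^ Suc n" .
    then have "path_weight b c e l i n * norm x ^ Suc l \<le> path_weight b c e l i n * y ^ Suc n"
      by (rule mult_left_mono[OF _ path_weight_nonneg])
    then show "norm (of_real (path_weight b c e l i n) * x ^ Suc l) \<le> path_weight b c e l i n * y ^ Suc n"
      by (simp only: norm_mult norm_power norm_of_real abs_of_nonneg[OF path_weight_nonneg])
  qed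
  also have "\<dots> = y ^ Suc n * path_gf b c e 1 i n"
    by (simp add: path_gf_def sum_distrib_left mult.commute)
  finally show ?thesis .
qed

lemma path_gf_nonneg: "path_gf b c e (1 :: real) i n \<ge> 0"
  by (simp add: path_gf_def sum_nonneg path_weight_nonneg)

text \<open>Ending in leaves has the larger factorial in the denominator. The series of last path
  segments therefore inherits the coefficient bound of the excursion series.\<close>

lemma path_weight_end_le: "1 \<le> c \<Longrightarrow> i \<ge> 1 \<Longrightarrow> path_weight b c 0 l i n \<le> path_weight b c e l i n"
proof (induction l arbitrary: i n)
  case 0
  have "(fact (b * i - e) :: real) \<le> fact (b * i)" by (rule fact_mono) simp
  then show ?case by (auto intro!: divide_left_mono)
next
  case (Suc l)
  then show ?case by (auto intro!: sum_mono divide_right_mono)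
qed

section \<open>The radius of convergence of the excursion series\<close>

locale excursions =
  fixes b :: nat
  assumes b: "b \<ge> 2"
begin

text \<open>The returning state 1 is not counted in n, which is why the equation for q0 contains
  \<open>a 1 n * q0 ^ Suc n\<close>.\<close>

definition a :: "nat \<Rightarrow> nat \<Rightarrow> real" where
  "a i n = path_gf b 2 1 1 i n"

text \<open>
  N q is one step of the excursion chain killed at state 1, T the weight of the killing step; the
  excursion series of all states solve S = T + N q S.
\<close>

definition T :: "nat \<Rightarrow> real" where
  "T i = 1 / fact (b * i - 1)"

definition N :: "real \<Rightarrow> (nat \<Rightarrow> real) \<Rightarrow> nat \<Rightarrow> real" where
  "N q Y i = (\<Sum>k\<in>{2..b * i}. q ^ k / fact (b * i - k) * Y k)"

definition S :: "real \<Rightarrow> nat \<Rightarrow> nat \<Rightarrow> real" where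
  "S q m i = (\<Sum>n\<le>m. a i n * q ^ n)"

lemma a_nonneg: "a i n \<ge> 0"
  by (simp add: a_def path_gf_nonneg)

lemma T_pos: "T i > 0"
  by (simp add: T_def)

lemma S_nonneg: "0 \<le> q \<Longrightarrow> S q m i \<ge> 0"
  by (simp add: S_def sum_nonneg a_nonneg)

lemma S_mono: "0 \<le> q \<Longrightarrow> m \<le> m' \<Longrightarrow> S q m i \<le> S q m' i"
  unfolding S_def by (intro sum_mono2) (auto simp: a_nonneg)

lemma N_mono: "0 \<le> q \<Longrightarrow> (\<And>k. 2 \<le> k \<Longrightarrow> Y k \<le> Z k) \<Longrightarrow> N q Y i \<le> N q Z i"
  unfolding N_def by (intro sum_mono mult_left_mono) auto

lemma S_rec: "S q m i = T i + (\<Sum>k\<in>{2..min (b * i) m}. q ^ k / fact (b * i - k) * S q (m - k) k)"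
proof -
  have a_rec: "a i n = (if n = 0 then T i else 0) + (\<Sum>k\<in>{2..min (b * i) n}. a k (n - k) / fact (b * i - k))" for n
    unfolding a_def T_def by (subst path_gf_rec) simp_all
  have "S q m i = (\<Sum>n\<le>m. (if n = 0 then T i else 0) + (\<Sum>k\<in>{2..min (b * i) n}. a k (n - k) / fact (b * i - k) * q ^ n))"
    unfolding S_def
  proof (rule sum.cong[OF refl])
    fix n
    show "a i n * q ^ n = (if n = 0 then T i else 0) + (\<Sum>k\<in>{2..min (b * i) n}. a k (n - k) / fact (b * i - k) * q ^ n)"
      unfolding a_rec[of n] by (simp add: distrib_right sum_distrib_right)
  qed
  also have "\<dots> = T i + (\<Sum>n\<le>m. \<Sum>k\<in>{2..min (b * i) n}. a k (n - k) / fact (b * i - k) * q ^ n)"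
    by (simp add: sum.distrib sum.delta)
  also have "(\<Sum>n\<le>m. \<Sum>k\<in>{2..min (b * i) n}. a k (n - k) / fact (b * i - k) * q ^ n)
      = (\<Sum>(n, k)\<in>Sigma {..m} (\<lambda>n. {2..min (b * i) n}). a k (n - k) / fact (b * i - k) * q ^ n)"
    by (rule sum.Sigma) auto
  also have "\<dots> = (\<Sum>(k, n)\<in>Sigma {2..min (b * i) m} (\<lambda>k. {..m - k}). q ^ k / fact (b * i - k) * (a k n * q ^ n))"
    by (rule sum.reindex_bij_witness[of _ "\<lambda>(k, n). (n + k, k)" "\<lambda>(n, k). (k, n - k)"])
       (auto simp: power_add[symmetric])
  also have "\<dots> = (\<Sum>k\<in>{2..min (b * i) m}. \<Sum>n\<le>m - k. q ^ k / fact (b * i - k) * (a k n * q ^ n))"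
    by (rule sum.Sigma[symmetric]) auto
  finally show ?thesis by (simp add: S_def sum_distrib_left)
qed

text \<open>The recursion mixes truncation orders, so before convergence is known the equation S = T
  + N q S is replaced by two inequalities between truncations. This is the upper one.\<close>

lemma S_Suc_le:
  assumes q: "0 \<le> q"
  shows "S q (Suc m) i \<le> T i + N q (S q m) i"
proof -
  have "(\<Sum>k\<in>{2..min (b * i) (Suc m)}. q ^ k / fact (b * i - k) * S q (Suc m - k) k)
      \<le> (\<Sum>k\<in>{2..min (b * i) (Suc m)}. q ^ k / fact (b * i - k) * S q m k)"
    using q by (intro sum_mono mult_left_mono S_mono) auto
  also have "\<dots> \<le> N q (S q m) i"
    unfolding N_def using q
    by (intro sum_mono2) (auto intro!: divide_nonneg_nonneg mult_nonneg_nonneg S_nonneg)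
  finally show ?thesis using S_rec[of q "Suc m" i] by simp
qed

text \<open>The lower inequality: a step to k lowers the truncation order by k <= b * i, which the
  shift by \<open>b * i\<close> compensates.\<close>

lemma S_ge:
  assumes q: "0 \<le> q"
  shows "T i + N q (S q m) i \<le> S q (m + b * i) i"
proof -
  have "N q (S q m) i \<le> (\<Sum>k\<in>{2..b * i}. q ^ k / fact (b * i - k) * S q (m + b * i - k) k)"
    unfolding N_def using q by (intro sum_mono mult_left_mono S_mono) auto
  also have "{2..b * i} = {2..min (b * i) (m + b * i)}" by simp
  finally show ?thesis using S_rec[of q "m + b * i" i] by simp
qed

text \<open>The convergence criterion: N is monotone, so by induction on the truncation order the
  partial sums never overtake a nonnegative supersolution.\<close>

lemma S_le_supersolution:
  assumes q: "0 \<le> q" and Y: "\<And>i. 1 \<le> i \<Longrightarrow> T i + N q Y i \<le> Y i" "\<And>i. 0 \<le> Y i" and "1 \<le> i"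
  shows "S q m i \<le> Y i"
  using \<open>1 \<le> i\<close>
proof (induction m arbitrary: i)
  case 0
  have "0 \<le> N q Y i" unfolding N_def using q Y(2) by (intro sum_nonneg) auto
  then show ?case using S_rec[of q 0 i] Y(1)[OF 0] by simp
next
  case (Suc m)
  have "S q (Suc m) i \<le> T i + N q (S q m) i" by (rule S_Suc_le[OF q])
  also have "N q (S q m) i \<le> N q Y i" by (rule N_mono[OF q]) (use Suc.IH in simp)
  also have "T i + N q Y i \<le> Y i" by (rule Y(1)[OF Suc.prems])
  finally show ?case by simp
qed

lemma summable_if_bounded:
  assumes "0 \<le> q" "\<And>m. S q m i \<le> B"
  shows "summable (\<lambda>n. a i n * q ^ n)"
proof (rule bounded_imp_summable)
  show "(\<Sum>n\<le>m. a i n * q ^ n) \<le> B" for m using assms(2)[of m] by (simp add: S_def)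
qed (use assms(1) a_nonneg in simp)

lemma S_le_suminf: "0 \<le> q \<Longrightarrow> summable (\<lambda>n. a i n * q ^ n) \<Longrightarrow> S q m i \<le> (\<Sum>n. a i n * q ^ n)"
  unfolding S_def by (rule sum_le_suminf) (auto simp: a_nonneg)

text \<open>From state i the chain steps to i + 1 <= b * i with positive weight, so the series of
  state i dominates a positive multiple of that of state i + 1.\<close>

lemma summable_all:
  assumes q: "0 \<le> q" and s: "summable (\<lambda>n. a 1 n * q ^ n)" and "1 \<le> i"
  shows "summable (\<lambda>n. a i n * q ^ n)"
proof (cases "q = 0")
  case True
  have "summable (\<lambda>n. if n = 0 then a i n else 0)" by (rule summable_single)
  moreover have "(\<lambda>n. a i n * q ^ n) = (\<lambda>n. if n = 0 then a i n else 0)" using True by auto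
  ultimately show ?thesis by simp
next
  case False
  then have q: "0 < q" using q by simp
  show ?thesis using \<open>1 \<le> i\<close>
  proof (induction i rule: dec_induct)
    case base
    then show ?case by (rule s)
  next
    case (step i)
    let ?c = "q ^ Suc i / fact (b * i - Suc i)"
    have c: "?c > 0" using q by simp
    have "2 * i \<le> b * i" using b by simp
    with step.hyps(1) have "2 \<le> Suc i" "Suc i \<le> b * i" by linarith+
    then have k: "Suc i \<in> {2..b * i}" by simp
    have "S q m (Suc i) \<le> (\<Sum>n. a i n * q ^ n) / ?c" for m
    proof -
      have "?c * S q m (Suc i) \<le> N q (S q m) i"
        unfolding N_def
        by (rule member_le_sum[OF k]) (use q S_nonneg in auto)
      also have "\<dots> \<le> S q (m + b * i) i" using S_ge[of q i m] q T_pos[of i] by simp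
      also have "\<dots> \<le> (\<Sum>n. a i n * q ^ n)" using q by (intro S_le_suminf step.IH) simp
      finally show ?thesis using c by (simp only: pos_le_divide_eq mult.commute)
    qed
    then show ?case using q by (intro summable_if_bounded) auto
  qed
qed

lemma N_suminf_le:
  assumes q: "0 \<le> q" and s: "\<And>i. 1 \<le> i \<Longrightarrow> summable (\<lambda>n. a i n * q ^ n)" and i: "1 \<le> i"
  shows "T i + N q (\<lambda>k. \<Sum>n. a k n * q ^ n) i \<le> (\<Sum>n. a i n * q ^ n)"
proof (rule LIMSEQ_le_const2)
  have "(\<lambda>m. S q m k) \<longlonglongrightarrow> (\<Sum>n. a k n * q ^ n)" if "1 \<le> k" for k
    unfolding S_def by (rule summable_LIMSEQ'[OF s[OF that]])
  then show "(\<lambda>m. T i + N q (S q m) i) \<longlonglongrightarrow> T i + N q (\<lambda>k. \<Sum>n. a k n * q ^ n) i"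
    unfolding N_def by (intro tendsto_intros) auto
  show "\<exists>M. \<forall>m\<ge>M. T i + N q (S q m) i \<le> (\<Sum>n. a i n * q ^ n)"
    using S_ge[OF q, of i] S_le_suminf[OF q s[OF i]] order_trans by blast
qed

end

section \<open>Geometric weights and extension of convergence\<close>

lemma power_over_fact_le_exp:
  fixes y :: real
  assumes "0 \<le> y"
  shows "(\<Sum>j\<le>n. y ^ j / fact j) \<le> exp y"
proof -
  have "(\<lambda>j. y ^ j / fact j) sums exp y"
    using exp_converges[of y] by (simp add: divide_inverse mult.commute)
  then show ?thesis
    using sum_le_suminf[of "\<lambda>j. y ^ j / fact j" "{..n}"] assms by (auto simp: sums_iff)
qed

context excursions
begin

text \<open>Reading the sum from k = b * i downwards gives an exponential series in 1 / (Q \<theta>)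
  times (Q \<theta>)^(b i). As b >= 2, the latter contains a higher power of \<theta> than
  \<theta>^i; for small \<theta> the excess decays geometrically in i. The bound is the same for all
  q up to Q.\<close>

lemma N_geometric_le:
  assumes q: "0 \<le> q" "q \<le> Q" "0 < Q" and \<theta>: "0 < \<theta>" "Q ^ b * \<theta> ^ (b - 1) \<le> 1 / 2"
  shows "N q (\<lambda>k. \<theta> ^ k) i \<le> exp (1 / (Q * \<theta>)) * (1 / 2) ^ i * \<theta> ^ i"
proof -
  let ?y = "1 / (Q * \<theta>)"
  have "N q (\<lambda>k. \<theta> ^ k) i \<le> (\<Sum>k\<in>{2..b * i}. Q ^ k / fact (b * i - k) * \<theta> ^ k)"
    unfolding N_def using q \<theta> by (intro sum_mono mult_right_mono divide_right_mono power_mono) auto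
  also have "\<dots> \<le> (\<Sum>k\<le>b * i. Q ^ k / fact (b * i - k) * \<theta> ^ k)"
    using q \<theta> by (intro sum_mono2) auto
  also have "\<dots> = (\<Sum>j\<le>b * i. (Q * \<theta>) ^ (b * i) * (?y ^ j / fact j))"
  proof (rule sum.reindex_bij_witness[of _ "\<lambda>j. b * i - j" "\<lambda>k. b * i - k"])
    fix k assume k: "k \<in> {..b * i}"
    have "(Q * \<theta>) ^ (b * i) * ?y ^ (b * i - k) = (Q * \<theta>) ^ k"
    proof -
      have "(Q * \<theta>) ^ (b * i) = (Q * \<theta>) ^ k * (Q * \<theta>) ^ (b * i - k)"
        using k by (simp add: power_add[symmetric])
      then show ?thesis using q \<theta> by (simp add: power_one_over)
    qed
    then show "(Q * \<theta>) ^ (b * i) * (?y ^ (b * i - k) / fact (b * i - k)) = Q ^ k / fact (b * i - k) * \<theta> ^ k"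
      by (simp add: power_mult_distrib)
  qed auto
  also have "\<dots> = (Q * \<theta>) ^ (b * i) * (\<Sum>j\<le>b * i. ?y ^ j / fact j)" by (rule sum_distrib_left[symmetric])
  also have "\<dots> \<le> (Q * \<theta>) ^ (b * i) * exp ?y"
    using q \<theta> by (intro mult_left_mono power_over_fact_le_exp) auto
  also have "(Q * \<theta>) ^ (b * i) = (Q ^ b * \<theta> ^ (b - 1)) ^ i * \<theta> ^ i"
  proof -
    have "\<theta> ^ b = \<theta> ^ (b - 1) * \<theta>" using b power_minus_mult[of b \<theta>] by simp
    then show ?thesis by (simp add: power_mult power_mult_distrib mult_ac)
  qed
  also have "(Q ^ b * \<theta> ^ (b - 1)) ^ i * \<theta> ^ i * exp ?y \<le> (1 / 2) ^ i * \<theta> ^ i * exp ?y"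
    using q \<theta> by (intro mult_right_mono power_mono) auto
  finally show ?thesis by (simp add: mult_ac)
qed

lemma T_le_geometric:
  assumes "0 < \<theta>" "1 \<le> i"
  shows "T i \<le> exp (1 / \<theta>) * \<theta> ^ i"
proof -
  have "2 * i \<le> b * i" using b by simp
  with assms(2) have "i \<le> b * i - 1" by linarith
  then have "(fact i :: real) \<le> fact (b * i - 1)" by (rule fact_mono)
  then have "T i \<le> 1 / fact i" unfolding T_def by (intro divide_left_mono) auto
  also have "\<dots> = ((1 / \<theta>) ^ i / fact i) * \<theta> ^ i" using assms by (simp add: power_one_over)
  also have "(1 / \<theta>) ^ i / fact i \<le> (\<Sum>j\<le>i. (1 / \<theta>) ^ j / fact j)"
    using assms by (intro member_le_sum) auto
  also have "\<dots> \<le> exp (1 / \<theta>)" using assms by (intro power_over_fact_le_exp) simp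
  finally show ?thesis using assms by (simp add: mult_right_mono)
qed

lemma half_power_small:
  assumes "0 < (e :: real)"
  obtains I where "\<And>i. i \<ge> I \<Longrightarrow> E * (1 / 2) ^ i \<le> e"
proof -
  have "(\<lambda>i. E * (1 / 2) ^ i) \<longlonglongrightarrow> E * 0"
    by (intro tendsto_intros LIMSEQ_realpow_zero) auto
  then have "eventually (\<lambda>i. E * (1 / 2) ^ i < e) sequentially"
    using assms by (intro order_tendstoD(2)) auto
  then show ?thesis using that unfolding eventually_sequentially by (meson less_imp_le)
qed

text \<open>
  The vector 2S + \<kappa>\<theta>^i strictly dominates
  one step of the recursion at q, because T is a strict gain for small states and the
  superexponentially small weights make \<theta>^i a strict gain for large ones.
\<close>

lemma summable_extend:
  assumes q: "0 \<le> q" and s1: "summable (\<lambda>n. a 1 n * q ^ n)"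
  obtains q' where "q < q'" "summable (\<lambda>n. a 1 n * q' ^ n)"
proof -
  \<comment> \<open>Q leaves room to the right of q: all constants below serve the whole interval up
    to Q, so the new point x can be chosen last. The value of \<theta> makes
    \<open>Q ^ b * \<theta>\<close> at most 1/2.\<close>
  define Q where "Q = q + 1"
  define \<theta> where "\<theta> = 1 / (2 + 2 * Q ^ b)"
  define E where "E = exp (1 / (Q * \<theta>))"
  define D where "D = exp (1 / \<theta>)"
  define s where "s i = (\<Sum>n. a i n * q ^ n)" for i
  have Q: "0 < Q" "q \<le> Q" using q by (auto simp: Q_def)
  have Qb: "0 < Q ^ b" using Q by simp
  then have \<theta>: "0 < \<theta>" "\<theta> \<le> 1" by (auto simp: \<theta>_def divide_simps)
  have Q\<theta>: "Q ^ b * \<theta> ^ (b - 1) \<le> 1 / 2"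
  proof -
    have "\<theta> ^ (b - 1) \<le> \<theta> ^ 1" using b \<theta> by (intro power_decreasing) auto
    then have "Q ^ b * \<theta> ^ (b - 1) \<le> Q ^ b * \<theta>" using Qb by (intro mult_left_mono) auto
    also have "\<dots> \<le> 1 / 2" using Qb by (simp add: \<theta>_def divide_simps)
    finally show ?thesis .
  qed
  have E: "1 \<le> E" using Q \<theta> by (simp add: E_def)
  define G where "G x i = N x (\<lambda>k. \<theta> ^ k) i" for x i
  have NV: "G x i \<le> E * (1 / 2) ^ i * \<theta> ^ i" if "0 \<le> x" "x \<le> Q" for x i
    unfolding E_def G_def by (rule N_geometric_le[OF that Q(1) \<theta>(1) Q\<theta>])
  have TD: "T i \<le> D * \<theta> ^ i" if "1 \<le> i" for i
    unfolding D_def by (rule T_le_geometric[OF \<theta>(1) that])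
  have sm: "summable (\<lambda>n. a i n * q ^ n)" if "1 \<le> i" for i
    by (rule summable_all[OF q s1 that])
  have Ns: "T i + N q s i \<le> s i" if "1 \<le> i" for i
    unfolding s_def by (rule N_suminf_le[OF q sm that])
  obtain I0 where I0: "\<And>i. i \<ge> I0 \<Longrightarrow> E * (1 / 2) ^ i \<le> 1 / 2"
    by (rule half_power_small[of "1 / 2" E]) auto
  \<comment> \<open>The finite sum covers the states up to \<open>I0\<close>. Beyond them
    \<open>2 * D\<close> makes T at most half of the bound, and the choice of \<open>I0\<close>
    makes one step of N contribute at most the other half.\<close>
  define C where "C = 2 * D + (\<Sum>i\<le>I0. \<bar>s i\<bar> / \<theta> ^ i)"
  have D0: "0 \<le> D" by (simp add: D_def)
  have C0: "2 * D \<le> C" unfolding C_def using \<theta> by (simp add: sum_nonneg)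
  have S_le: "S q m i \<le> C * \<theta> ^ i" if "1 \<le> i" for m i
    using that
  proof (induction m arbitrary: i)
    case 0
    have "S q 0 i = T i" using S_rec[of q 0 i] by simp
    also have "\<dots> \<le> D * \<theta> ^ i" by (rule TD[OF 0])
    also have "\<dots> \<le> C * \<theta> ^ i" using C0 D0 \<theta> by (intro mult_right_mono) auto
    finally show ?case .
  next
    case (Suc m)
    show ?case
    proof (cases "i \<le> I0")
      case True
      have "S q (Suc m) i \<le> s i" unfolding s_def by (rule S_le_suminf[OF q sm[OF Suc.prems]])
      also have "s i \<le> \<bar>s i\<bar> / \<theta> ^ i * \<theta> ^ i" using \<theta> by simp
      also have "\<bar>s i\<bar> / \<theta> ^ i \<le> (\<Sum>i\<le>I0. \<bar>s i\<bar> / \<theta> ^ i)"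
        using True \<theta> by (intro member_le_sum) auto
      also have "\<dots> \<le> C" using D0 by (simp add: C_def)
      finally show ?thesis using \<theta> by (simp add: mult_right_mono)
    next
      case False
      have "S q (Suc m) i \<le> T i + N q (S q m) i" by (rule S_Suc_le[OF q])
      also have "N q (S q m) i \<le> N q (\<lambda>k. C * \<theta> ^ k) i" by (rule N_mono[OF q]) (use Suc.IH in simp)
      also have "\<dots> = C * G q i" by (simp add: G_def N_def sum_distrib_left mult_ac)
      also have "\<dots> \<le> C * (E * (1 / 2) ^ i * \<theta> ^ i)" using NV[OF q Q(2)] C0 D0 by (intro mult_left_mono) auto
      also have "\<dots> \<le> C * (1 / 2 * \<theta> ^ i)"
        using I0[of i] False C0 D0 \<theta> by (intro mult_left_mono mult_right_mono) auto
      also have "T i + C * (1 / 2 * \<theta> ^ i) \<le> C / 2 * \<theta> ^ i + C * (1 / 2 * \<theta> ^ i)"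
        proof -
          have "D * \<theta> ^ i \<le> C / 2 * \<theta> ^ i" using C0 \<theta> by (intro mult_right_mono) auto
          then show ?thesis using TD[OF Suc.prems] by linarith
        qed
      finally show ?thesis by simp
    qed
  qed
  have s_le: "s i \<le> C * \<theta> ^ i" if "1 \<le> i" for i
  proof (rule LIMSEQ_le_const2)
    show "(\<lambda>m. S q m i) \<longlonglongrightarrow> s i" unfolding S_def s_def by (rule summable_LIMSEQ'[OF sm[OF that]])
  qed (use S_le[OF that] in blast)
  \<comment> \<open>Small enough that up to \<open>I0\<close>, where T is at least
    \<open>1 / fact (b * I0)\<close>, the correction \<kappa> \<theta>^i uses at most half of
    \<open>T i\<close> after one step.\<close>
  define \<kappa> where "\<kappa> = 1 / (2 * E * fact (b * I0))"
  have \<kappa>: "0 < \<kappa>" using E by (simp add: \<kappa>_def)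
  have \<kappa>T: "\<kappa> * (E * (1 / 2) ^ i * \<theta> ^ i) \<le> T i / 2" if "i \<le> I0" for i
  proof -
    have "(1 / 2) ^ i * \<theta> ^ i \<le> 1 * (1 :: real)" using \<theta> by (intro mult_mono power_le_one) auto
    then have "\<kappa> * E * ((1 / 2) ^ i * \<theta> ^ i) \<le> \<kappa> * E * 1" using \<kappa> E by (intro mult_left_mono) auto
    also have "\<dots> = 1 / fact (b * I0) / 2" using E by (simp add: \<kappa>_def)
    also have "1 / fact (b * I0) \<le> T i"
    proof -
      have "b * i - 1 \<le> b * I0" using that mult_le_mono2[of i I0 b] by linarith
      then have "(fact (b * i - 1) :: real) \<le> fact (b * I0)" by (rule fact_mono)
      then show ?thesis unfolding T_def by (intro divide_left_mono) auto
    qed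
    finally show ?thesis by (simp add: mult_ac)
  qed
  define C' where "C' = 2 * C + \<kappa>"
  have C': "0 < C'" using C0 D0 \<kappa> by (simp add: C'_def)
  \<comment> \<open>The maximum secures nonnegativity at i = 0, where convergence of s is not
    established; for i >= 1 it equals \<open>s i\<close>.\<close>
  define Y where "Y i = 2 * max (s i) 0 + \<kappa> * \<theta> ^ i" for i
  have Y0: "0 \<le> Y i" for i using \<kappa> \<theta> by (simp add: Y_def)
  have s0: "0 \<le> s i" if "1 \<le> i" for i
    unfolding s_def using a_nonneg q by (intro suminf_nonneg sm that) auto
  have Y_le: "Y i \<le> C' * \<theta> ^ i" if "1 \<le> i" for i
    using s_le[OF that] s0[OF that] by (simp add: Y_def C'_def algebra_simps)
  \<comment> \<open>Beyond \<open>I1\<close> replacing q by any x up to Q costs at most \<kappa>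
    \<theta>^i / 2, so x has to be adapted to finitely many states only.\<close>
  obtain I1 where I1: "\<And>i. i \<ge> I1 \<Longrightarrow> E * (1 / 2) ^ i \<le> \<kappa> / (2 * C')"
    by (rule half_power_small[of "\<kappa> / (2 * C')" E]) (use \<kappa> C' in auto)
  define I where "I = max I0 I1"
  have "((\<lambda>x. C' * (G x i - G q i)) \<longlongrightarrow>
      C' * (G q i - G q i)) (at_right q)" for i
    unfolding G_def N_def by (intro tendsto_intros) auto
  then have "\<forall>\<^sub>F x in at_right q. C' * (G x i - G q i) < T i / 2" for i
    using T_pos[of i] by (intro order_tendstoD(2)) auto
  then have "\<forall>\<^sub>F x in at_right q. \<forall>i\<in>{..I}. C' * (G x i - G q i) < T i / 2"
    by (intro eventually_ball_finite) auto
  moreover have "\<forall>\<^sub>F x in at_right q. x \<in> {q<..<Q}" by (rule eventually_at_right_real) (simp add: Q_def)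
  ultimately have "\<forall>\<^sub>F x in at_right q. x \<in> {q<..<Q} \<and> (\<forall>i\<in>{..I}. C' * (G x i - G q i) < T i / 2)"
    by (rule eventually_elim2) blast
  then obtain x where x: "q < x" "x < Q" and small: "\<And>i. i \<le> I \<Longrightarrow> C' * (G x i - G q i) < T i / 2"
    using eventually_happens'[OF trivial_limit_at_right_real] by fastforce
  have super: "T i + N x Y i \<le> Y i" if i: "1 \<le> i" for i
  proof -
    have "N x Y i - N q Y i = (\<Sum>k\<in>{2..b * i}. (x ^ k - q ^ k) / fact (b * i - k) * Y k)"
      by (simp add: N_def sum_subtractf[symmetric] diff_divide_distrib left_diff_distrib)
    also have "\<dots> \<le> (\<Sum>k\<in>{2..b * i}. (x ^ k - q ^ k) / fact (b * i - k) * (C' * \<theta> ^ k))"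
      using x q Y_le by (intro sum_mono mult_left_mono) (auto intro!: power_mono)
    also have "\<dots> = C' * (G x i - G q i)"
      by (simp add: G_def N_def sum_subtractf[symmetric] sum_distrib_left diff_divide_distrib algebra_simps)
    finally have diff: "N x Y i \<le> N q Y i + C' * (G x i - G q i)" by linarith
    have "N q Y i = 2 * N q (\<lambda>k. max (s k) 0) i + \<kappa> * G q i"
      by (simp add: G_def N_def Y_def sum.distrib[symmetric] sum_distrib_left algebra_simps)
    also have "N q (\<lambda>k. max (s k) 0) i = N q s i"
      unfolding N_def by (intro sum.cong) (auto simp: s0 max_absorb1)
    finally have NY: "N q Y i \<le> 2 * (s i - T i) + \<kappa> * G q i"
      using Ns[OF i] by (simp add: algebra_simps)
    \<comment> \<open>The slack in the supersolution is T i + \<kappa> \<theta>^i, because doubling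
      s gains one extra T. Up to \<open>I0\<close> both terms on the left are at most T i / 2,
      beyond \<open>I\<close> both are at most \<kappa> \<theta>^i / 2, and in between there is one
      of each kind.\<close>
    have "\<kappa> * G q i + C' * (G x i - G q i) \<le> T i + \<kappa> * \<theta> ^ i"
    proof -
      have small_state: "\<kappa> * G q i \<le> T i / 2" if "i \<le> I0"
        using \<kappa>T[OF that] mult_left_mono[OF NV[OF q Q(2), of i], of \<kappa>] \<kappa> by linarith
      have large_state: "\<kappa> * G q i \<le> \<kappa> * \<theta> ^ i / 2" if "i \<ge> I0"
      proof -
        have "G q i \<le> 1 / 2 * \<theta> ^ i"
          using NV[OF q Q(2), of i] mult_right_mono[OF I0[OF that], of "\<theta> ^ i"] \<theta>
          by (meson less_imp_le order_trans zero_le_power)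
        then have "\<kappa> * G q i \<le> \<kappa> * (1 / 2 * \<theta> ^ i)" using \<kappa> by (intro mult_left_mono) auto
        then show ?thesis by simp
      qed
      have \<kappa>\<theta>: "0 \<le> \<kappa> * \<theta> ^ i" using \<kappa> \<theta> by simp
      show ?thesis
      proof (cases "i \<le> I")
        case True
        then show ?thesis using small[OF True] small_state large_state \<kappa>\<theta> T_pos[of i]
          by (cases "i \<le> I0") auto
      next
        case False
        then have i': "i \<ge> I0" "i \<ge> I1" by (auto simp: I_def)
        have "0 \<le> G q i" unfolding G_def N_def using q \<theta> by (intro sum_nonneg) auto
        then have "C' * (G x i - G q i) \<le> C' * (E * (1 / 2) ^ i * \<theta> ^ i)"
          using NV[of x i] x q C' by (intro mult_left_mono) auto
        also have "\<dots> \<le> C' * (\<kappa> / (2 * C') * \<theta> ^ i)"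
          using I1[OF i'(2)] C' \<theta> by (intro mult_left_mono mult_right_mono) auto
        also have "\<dots> = \<kappa> * \<theta> ^ i / 2" using C' by simp
        finally show ?thesis using large_state[OF i'(1)] T_pos[of i] by linarith
      qed
    qed
    moreover have "Y i = 2 * s i + \<kappa> * \<theta> ^ i" using s0[OF i] by (simp add: Y_def)
    ultimately show ?thesis using diff NY by (simp add: algebra_simps)
  qed
  have "S x m 1 \<le> Y 1" for m
    by (rule S_le_supersolution) (use x q super Y0 in auto)
  then have "summable (\<lambda>n. a 1 n * x ^ n)" using x q by (intro summable_if_bounded) auto
  then show ?thesis using that x by blast
qed

end

section \<open>The root of the excursion equation\<close>

context excursions
begin

lemma a_1_0: "a 1 0 = 1 / fact (b - 1)"
  unfolding a_def by (subst path_gf_rec) simp_all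

text \<open>Suppose the series never exceeds 1 where it converges. The term n = 0 then bounds these
  points by (b - 1)!, so they have a finite supremum R. The partial sums are at most 1 at R by
  continuity, so the series converges at R, and \<open>summable_extend\<close> contradicts the
  choice of R.\<close>

lemma exists_large:
  obtains q where "0 < q" "summable (\<lambda>n. a 1 n * q ^ n)" "1 < (\<Sum>n. a 1 n * q ^ Suc n)"
proof -
  define A where "A = {q. 0 \<le> q \<and> summable (\<lambda>n. a 1 n * q ^ n)}"
  have sum_Suc: "summable (\<lambda>n. a 1 n * q ^ Suc n)" if "q \<in> A" for q
  proof -
    have "summable (\<lambda>n. q * (a 1 n * q ^ n))" using that by (intro summable_mult) (simp add: A_def)
    then show ?thesis by (simp add: mult_ac)
  qed
  have "\<exists>q\<in>A. 1 < (\<Sum>n. a 1 n * q ^ Suc n)"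
  proof (rule ccontr)
    assume "\<not> ?thesis"
    then have le1: "(\<Sum>n. a 1 n * q ^ Suc n) \<le> 1" if "q \<in> A" for q using that by force
    have part: "(\<Sum>n\<le>m. a 1 n * q ^ Suc n) \<le> 1" if "q \<in> A" for q m
    proof -
      have "(\<Sum>n\<le>m. a 1 n * q ^ Suc n) \<le> (\<Sum>n. a 1 n * q ^ Suc n)"
        using that by (intro sum_le_suminf sum_Suc) (auto simp: A_def a_nonneg)
      then show ?thesis using le1[OF that] by linarith
    qed
    have bdd: "q \<le> fact (b - 1)" if "q \<in> A" for q
    proof -
      have "a 1 0 * q \<le> 1" using part[OF that, of 0] by simp
      then show ?thesis unfolding a_1_0 by (simp add: divide_le_eq)
    qed
    define R where "R = Sup A"
    have "0 \<in> A"
    proof -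
      have "summable (\<lambda>n. if n = 0 then a 1 n else 0)" by (rule summable_single)
      moreover have "(\<lambda>n. a 1 n * 0 ^ n) = (\<lambda>n. if n = 0 then a 1 n else 0)" by auto
      ultimately show ?thesis by (simp add: A_def)
    qed
    have bA: "bdd_above A" using bdd by (auto simp: bdd_above_def)
    have R_up: "q \<le> R" if "q \<in> A" for q unfolding R_def by (rule cSup_upper[OF that bA])
    obtain q1 where q1: "0 < q1" "q1 \<in> A"
    proof -
      obtain q' where "0 < q'" "summable (\<lambda>n. a 1 n * q' ^ n)"
        by (rule summable_extend[of 0]) (use \<open>0 \<in> A\<close> in \<open>auto simp: A_def\<close>)
      then show ?thesis using that by (simp add: A_def)
    qed
    then have R0: "0 < R" using R_up[of q1] by linarith
    have below: "q \<in> A" if "0 \<le> q" "q < R" for q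
    proof -
      have "\<exists>x\<in>A. q < x"
        by (rule less_cSupD) (use \<open>0 \<in> A\<close> that(2) in \<open>auto simp: R_def\<close>)
      then obtain q' where q': "q' \<in> A" "q < q'" by blast
      have "summable (\<lambda>n. a 1 n * q ^ n)"
      proof (rule summable_comparison_test')
        show "summable (\<lambda>n. a 1 n * q' ^ n)" using q' by (simp add: A_def)
        show "norm (a 1 n * q ^ n) \<le> a 1 n * q' ^ n" if "0 \<le> n" for n
          using q' \<open>0 \<le> q\<close> a_nonneg by (auto simp: abs_mult intro!: mult_left_mono power_mono)
      qed
      then show ?thesis using that by (simp add: A_def)
    qed
    have "(\<Sum>n\<le>m. a 1 n * R ^ Suc n) \<le> 1" for m
    proof (rule tendsto_upperbound)
      show "((\<lambda>q. \<Sum>n\<le>m. a 1 n * q ^ Suc n) \<longlongrightarrow> (\<Sum>n\<le>m. a 1 n * R ^ Suc n)) (at_left R)"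
        by (intro tendsto_intros)
      have "\<forall>\<^sub>F q in at_left R. q \<in> {0<..<R}" by (rule eventually_at_left_real[OF R0])
      then show "\<forall>\<^sub>F q in at_left R. (\<Sum>n\<le>m. a 1 n * q ^ Suc n) \<le> 1"
        by eventually_elim (rule part, rule below, auto)
    qed simp
    moreover have "S R m 1 * R = (\<Sum>n\<le>m. a 1 n * R ^ Suc n)" for m
      unfolding S_def sum_distrib_right by (intro sum.cong) auto
    ultimately have "S R m 1 * R \<le> 1" for m by simp
    then have "S R m 1 \<le> 1 / R" for m using R0 by (simp add: pos_le_divide_eq)
    then have "summable (\<lambda>n. a 1 n * R ^ n)" using R0 by (intro summable_if_bounded) auto
    then obtain q' where "R < q'" "summable (\<lambda>n. a 1 n * q' ^ n)" using summable_extend[of R] R0 by auto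
    then have "q' \<in> A" using R0 by (simp add: A_def)
    then show False using R_up \<open>R < q'\<close> by fastforce
  qed
  then obtain q where q: "q \<in> A" "1 < (\<Sum>n. a 1 n * q ^ Suc n)" by blast
  have "q \<noteq> 0" using q(2) by auto
  then show ?thesis using q(1) by (intro that[OF _ _ q(2)]) (auto simp: A_def)
qed

text \<open>By the intermediate value theorem. Since the value at R strictly exceeds 1, the root
  lies strictly inside; convergence at R supplies the geometric coefficient bound.\<close>

theorem exists_root:
  obtains q0 R C where "0 < q0" "q0 < R" "\<And>n. a 1 n \<le> C / R ^ n" "(\<lambda>n. a 1 n * q0 ^ Suc n) sums 1"
proof -
  obtain R where R: "0 < R" "summable (\<lambda>n. a 1 n * R ^ n)" "1 < (\<Sum>n. a 1 n * R ^ Suc n)"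
    by (rule exists_large)
  define F where "F q = (\<Sum>n. a 1 n * q ^ Suc n)" for q
  have sR: "summable (\<lambda>n. a 1 n * R ^ Suc n)"
    using summable_mult[OF R(2), of R] by (simp add: mult_ac)
  have bound: "norm (a 1 n * q ^ Suc n) \<le> a 1 n * R ^ Suc n" if "q \<in> {0..R}" for n q
    unfolding norm_mult norm_power using that a_nonneg by (intro mult_mono power_mono) auto
  have sq: "summable (\<lambda>n. a 1 n * q ^ Suc n)" if "q \<in> {0..R}" for q
    by (rule summable_comparison_test'[OF sR bound[OF that]])
  have ul: "uniform_limit {0..R} (\<lambda>m q. \<Sum>n<m. a 1 n * q ^ Suc n) F sequentially"
    unfolding F_def by (rule Weierstrass_m_test[OF bound sR])
  have "continuous_on {0..R} F"
    by (rule uniform_limit_theorem[OF _ ul]) (auto intro!: always_eventually continuous_intros)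
  moreover have "F 0 = 0" by (simp add: F_def)
  moreover have "1 < F R" using R(3) by (simp add: F_def)
  ultimately obtain q0 where q0: "0 \<le> q0" "q0 \<le> R" "F q0 = 1"
    using IVT'[of F 0 1 R] R(1) by auto
  have ne: "q0 \<noteq> 0" "q0 \<noteq> R" using q0(3) \<open>F 0 = 0\<close> \<open>1 < F R\<close> by auto
  show ?thesis
  proof (rule that[of q0 R "\<Sum>n. a 1 n * R ^ n"])
    show "0 < q0" "q0 < R" using q0 ne by auto
    show "(\<lambda>n. a 1 n * q0 ^ Suc n) sums 1"
      using sq[of q0] q0 by (simp add: F_def sums_iff)
    show "a 1 n \<le> (\<Sum>n. a 1 n * R ^ n) / R ^ n" for n
    proof -
      have "a 1 n * R ^ n \<le> (\<Sum>n. a 1 n * R ^ n)"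
        using sum_le_suminf[OF R(2), of "{n}"] R(1) by (simp add: a_nonneg)
      then show ?thesis using R(1) by (simp add: pos_le_divide_eq)
    qed
  qed
qed

end

section \<open>Asymptotic normality of the largest exponent\<close>

lemma power_series_family_mono:
  assumes "power_series_family \<phi> R C \<epsilon>" "\<epsilon>' \<le> \<epsilon>"
  shows "power_series_family \<phi> R C \<epsilon>'"
proof -
  interpret power_series_family \<phi> R C \<epsilon> by fact
  have "ball (0::complex) \<epsilon>' \<subseteq> ball 0 \<epsilon>" using assms(2) by auto
  then show ?thesis using R_pos bound by unfold_locales (auto intro: holomorphic_on_subset[OF holo])
qed

text \<open>Both indices are shifted so that n includes the returning state 1 and l the returning
  step. The coefficients with n = 0 vanish, as the renewal equation requires; (n, l) = (1, 1) and
  (3, 2) are the excursions 1 -> 1 and 1 -> 2 -> 1.\<close>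

definition excursion_coeff :: "nat \<Rightarrow> nat \<Rightarrow> nat \<Rightarrow> real" where
  "excursion_coeff b n l = (case (n, l) of (Suc j, Suc m) \<Rightarrow> path_weight b 2 1 m 1 j | _ \<Rightarrow> 0)"

lemma excursion_coeff_nonneg: "excursion_coeff b n l \<ge> 0"
  by (auto simp: excursion_coeff_def path_weight_nonneg split: nat.split)

lemma excursion_coeff_1_1: "excursion_coeff b 1 1 > 0"
  by (simp add: excursion_coeff_def)

lemma excursion_coeff_3_2: "b \<ge> 2 \<Longrightarrow> excursion_coeff b 3 2 > 0"
  by (simp add: excursion_coeff_def numeral_eq_Suc min_def)

lemma excursion_coeff_gf:
  "(\<Sum>l\<le>Suc j. of_real (excursion_coeff b (Suc j) l) * exp (s * of_nat l)) = path_gf b 2 1 (exp s) 1 j"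
  by (subst sum.atMost_Suc_shift)
     (simp add: excursion_coeff_def path_gf_def exp_of_nat2_mult[symmetric] del: of_nat_Suc power_Suc)

lemma path_gf_holomorphic: "(\<lambda>s. path_gf b c e (exp s) i n) holomorphic_on A"
  unfolding path_gf_def by (intro holomorphic_intros)

lemma path_gf_1_of_real: "path_gf b c e (1 :: complex) i n = of_real (path_gf b c e 1 i n)"
  by (simp add: path_gf_def)

text \<open>Reality of \<open>deriv \<alpha> 0\<close> remains a premise of the last conclusion
  because it is derived from the means, once the quasi-powers are read as moment generating
  functions.\<close>

lemma exists_quasi_powers:
  assumes b: "b \<ge> 2"
  obtains \<epsilon> \<alpha> \<beta> N where "0 < \<epsilon>" "\<alpha> holomorphic_on ball 0 \<epsilon>" "\<And>s. s \<in> ball 0 \<epsilon> \<Longrightarrow> norm (\<alpha> s) \<le> 1"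
    "\<And>n. n \<ge> N \<Longrightarrow> \<beta> n holomorphic_on ball 0 \<epsilon>"
    "\<And>n s. n \<ge> N \<Longrightarrow> s \<in> ball 0 \<epsilon> \<Longrightarrow> norm (\<beta> n s) \<le> 3"
    "\<And>n s. n \<ge> N \<Longrightarrow> s \<in> ball 0 \<epsilon> \<Longrightarrow>
      path_gf b 1 0 (exp s) 1 n / path_gf b 1 0 1 1 n = exp (of_nat n * \<alpha> s + \<beta> n s)"
    "Im (deriv \<alpha> 0) = 0 \<Longrightarrow> deriv (deriv \<alpha>) 0 \<noteq> 0"
proof -
  interpret excursions b by unfold_locales (rule b)
  obtain q0 R0 C where q0: "0 < q0" "q0 < R0" and C: "\<And>n. a 1 n \<le> C / R0 ^ n"
    and sum1: "(\<lambda>n. a 1 n * q0 ^ Suc n) sums 1"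
    by (rule exists_root) blast
  have R0: "0 < R0" using q0 by simp
  have C0: "0 \<le> C" using C[of 0] a_nonneg[of 1 0] by simp
  \<comment> \<open>On this ball the norm of \<open>exp s\<close> is at most sqrt(R0 / q0), so the
    reduced radius R is the geometric mean of q0 and \<open>R0\<close> and still exceeds q0.\<close>
  define \<epsilon> where "\<epsilon> = ln (R0 / q0) / 2"
  define R where "R = R0 / exp \<epsilon>"
  have ln_pos: "0 < ln (R0 / q0)" using q0 by simp
  then have \<epsilon>: "0 < \<epsilon>" by (simp add: \<epsilon>_def)
  have R: "0 < R" "q0 < R"
  proof -
    have "exp \<epsilon> < exp (ln (R0 / q0))" using ln_pos by (simp add: \<epsilon>_def)
    also have "\<dots> = R0 / q0" using q0 by simp
    finally show "q0 < R" using q0 by (simp add: R_def field_simps)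
  qed (use R0 in \<open>simp add: R_def\<close>)
  have exp_s: "norm (exp s) \<le> exp \<epsilon>" if "s \<in> ball 0 \<epsilon>" for s :: complex
    using that abs_Re_le_cmod[of s] by simp
  define f where "f = excursion_coeff b"
  define \<phi> where "\<phi> n s = (\<Sum>l\<le>n. of_real (f n l) * exp (s * of_nat l))" for n and s :: complex
  define \<gamma> where "\<gamma> n s = path_gf b 2 0 (exp s) 1 n" for n and s :: complex
  define p where "p n s = path_gf b 1 0 (exp s) 1 n" for n and s :: complex
  have \<phi>_0: "\<phi> 0 s = 0" for s by (simp add: \<phi>_def f_def excursion_coeff_def)
  have \<phi>_Suc: "\<phi> (Suc j) s = path_gf b 2 1 (exp s) 1 j" for j s
    unfolding \<phi>_def f_def by (rule excursion_coeff_gf)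
  have gf_bound: "norm (path_gf b 2 e (exp s) 1 n) \<le> exp \<epsilon> * C / R ^ n"
    if s: "s \<in> ball 0 \<epsilon>" and e: "path_gf b 2 e 1 1 n \<le> a 1 n" for e n and s :: complex
  proof -
    have "norm (path_gf b 2 e (exp s) 1 n) \<le> exp \<epsilon> ^ Suc n * path_gf b 2 e 1 1 n"
      using \<epsilon> by (intro norm_path_gf_le exp_s s) simp
    also have "\<dots> \<le> exp \<epsilon> ^ Suc n * (C / R0 ^ n)"
      using order_trans[OF e C] by (intro mult_left_mono) auto
    also have "\<dots> = exp \<epsilon> * C / R ^ n" by (simp add: R_def power_divide)
    finally show ?thesis .
  qed
  \<comment> \<open>The shift n = j + 1 costs a factor R, and \<open>exp \<epsilon> * R\<close> is
    \<open>R0\<close>.\<close>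
  have F: "power_series_family \<phi> R (R0 * C) \<epsilon>"
  proof
    show "\<phi> n holomorphic_on ball 0 \<epsilon>" for n
      unfolding \<phi>_def[abs_def] by (intro holomorphic_intros)
    show "norm (\<phi> n s) \<le> R0 * C / R ^ n" if "s \<in> ball 0 \<epsilon>" for n s
    proof (cases n)
      case 0
      then show ?thesis using \<phi>_0 R0 C0 by simp
    next
      case (Suc j)
      have "norm (\<phi> n s) \<le> exp \<epsilon> * C / R ^ j"
        unfolding Suc \<phi>_Suc by (rule gf_bound[OF that]) (simp add: a_def)
      also have "\<dots> = R0 * C / R ^ n" using R0 by (simp add: Suc R_def)
      finally show ?thesis .
    qed
  qed (rule R)
  have end_le: "path_gf b 2 0 1 1 n \<le> a 1 n" for n
    unfolding a_def path_gf_def by (auto intro!: sum_mono path_weight_end_le)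
  have G: "power_series_family \<gamma> R (exp \<epsilon> * C) \<epsilon>"
  proof
    show "\<gamma> n holomorphic_on ball 0 \<epsilon>" for n
      unfolding \<gamma>_def[abs_def] by (rule path_gf_holomorphic)
    show "norm (\<gamma> n s) \<le> exp \<epsilon> * C / R ^ n" if "s \<in> ball 0 \<epsilon>" for n s
      unfolding \<gamma>_def by (rule gf_bound[OF that end_le])
  qed (rule R)
  have renewal: "p n s = \<gamma> n s + (\<Sum>k\<le>n. \<phi> k s * p (n - k) s)" for n s
  proof -
    have "p n s = \<gamma> n s + (\<Sum>j<n. \<phi> (Suc j) s * p (n - Suc j) s)"
      unfolding p_def \<gamma>_def \<phi>_Suc using path_gf_renewal[of b 1 "exp s" n] b by simp
    then show ?thesis by (subst sum.atMost_shift) (simp add: \<phi>_0)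
  qed
  define av where "av n = (\<Sum>l\<le>n. f n l)" for n
  have av_Suc: "av (Suc n) = a 1 n" for n
  proof -
    have "complex_of_real (av (Suc n)) = \<phi> (Suc n) 0" by (simp add: av_def \<phi>_def)
    also have "\<dots> = of_real (a 1 n)" unfolding \<phi>_Suc a_def by (simp add: path_gf_1_of_real)
    finally show ?thesis by (simp only: of_real_eq_iff)
  qed
  have av_sums: "(\<lambda>n. av n * q0 ^ n) sums 1"
  proof -
    have "(\<lambda>n. av (Suc n) * q0 ^ Suc n) sums 1" unfolding av_Suc by (rule sum1)
    then have "(\<lambda>n. av n * q0 ^ n) sums (1 + av 0 * q0 ^ 0)" by (rule sums_Suc)
    then show ?thesis by (simp add: av_def f_def excursion_coeff_def)
  qed
  obtain \<epsilon>' \<alpha> \<beta> N where \<epsilon>': "0 < \<epsilon>'" "\<epsilon>' \<le> \<epsilon>" and \<alpha>: "\<alpha> holomorphic_on ball 0 \<epsilon>'" "\<alpha> 0 = 0"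
    "\<And>s. s \<in> ball 0 \<epsilon>' \<Longrightarrow> norm (\<alpha> s) \<le> 1"
    and root: "\<And>s. s \<in> ball 0 \<epsilon>' \<Longrightarrow> power_series_family.series \<phi> (of_real q0 * exp (- \<alpha> s)) s = 1"
    and \<beta>: "\<And>n. n \<ge> N \<Longrightarrow> \<beta> n holomorphic_on ball 0 \<epsilon>'"
    "\<And>n s. n \<ge> N \<Longrightarrow> s \<in> ball 0 \<epsilon>' \<Longrightarrow> norm (\<beta> n s) \<le> 3"
    "\<And>n s. n \<ge> N \<Longrightarrow> s \<in> ball 0 \<epsilon>' \<Longrightarrow> p n s / p n 0 = exp (of_nat n * \<alpha> s + \<beta> n s)"
  proof (rule renewal_quasi_powers[OF F G \<epsilon> _ \<phi>_0 renewal q0(1) R(2) _ _ _ av_sums])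
    show "p n holomorphic_on ball 0 \<epsilon>" for n
      unfolding p_def[abs_def] by (rule path_gf_holomorphic)
    show "\<phi> n 0 = of_real (av n)" for n by (simp add: \<phi>_def av_def)
    show "0 \<le> av n" for n by (simp add: av_def f_def sum_nonneg excursion_coeff_nonneg)
    show "0 < av 1" using av_Suc[of 0] a_1_0 by simp
    show "\<gamma> n 0 = of_real (path_gf b 2 0 1 1 n)" for n by (simp add: \<gamma>_def path_gf_1_of_real)
    show "0 \<le> path_gf b 2 0 (1::real) 1 n" for n by (rule path_gf_nonneg)
    show "0 < path_gf b 2 0 (1::real) 1 0" by (simp add: path_gf_def)
  qed blast
  show ?thesis
  proof (rule that[of \<epsilon>' \<alpha> N \<beta>])
    show "path_gf b 1 0 (exp s) 1 n / path_gf b 1 0 1 1 n = exp (of_nat n * \<alpha> s + \<beta> n s)"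
      if "n \<ge> N" "s \<in> ball 0 \<epsilon>'" for n s
      using \<beta>(3)[OF that] by (simp add: p_def)
    show "deriv (deriv \<alpha>) 0 \<noteq> 0" if "Im (deriv \<alpha> 0) = 0"
    proof (rule second_deriv_nondegenerate[OF _ _ _ _ q0(1) R(2) \<epsilon>'(1) \<alpha>(1,2) _ that])
      show "power_series_family (\<lambda>n s. \<Sum>l\<le>n. of_real (f n l) * exp (s * of_nat l)) R (R0 * C) \<epsilon>'"
        using power_series_family_mono[OF F \<epsilon>'(2)] unfolding \<phi>_def[abs_def] .
      show "power_series_family.series (\<lambda>n s. \<Sum>l\<le>n. of_real (f n l) * exp (s * of_nat l)) (of_real q0 * exp (- \<alpha> s)) s = 1"
        if "s \<in> ball 0 \<epsilon>'" for s
        using root[OF that] unfolding \<phi>_def[abs_def] .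
    qed (simp_all add: f_def excursion_coeff_nonneg excursion_coeff_1_1[simplified] excursion_coeff_3_2[OF b])
  qed (use \<epsilon>'(1) \<alpha> \<beta> in auto)
qed

theorem theorem6:
  fixes b :: nat
  assumes "b \<ge> 2"
  shows "\<exists>\<mu> \<sigma> :: real.
    asymptotically_normal (random_composition b) (\<lambda>n ks. real (largest_exponent ks)) \<and>
    (\<lambda>n. measure_pmf.expectation (random_composition b n) (\<lambda>ks. real (largest_exponent ks))
           - \<mu> * real n) \<in> O(\<lambda>n. 1) \<and>
    (\<lambda>n. measure_pmf.variance (random_composition b n) (\<lambda>ks. real (largest_exponent ks))
           - \<sigma>\<^sup>2 * real n) \<in> O(\<lambda>n. 1)"
proof -
  obtain \<epsilon> \<alpha> \<beta> N where \<epsilon>: "0 < \<epsilon>" and \<alpha>: "\<alpha> holomorphic_on ball 0 \<epsilon>" "\<And>s. s \<in> ball 0 \<epsilon> \<Longrightarrow> norm (\<alpha> s) \<le> 1"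
    and \<beta>: "\<And>n. n \<ge> N \<Longrightarrow> \<beta> n holomorphic_on ball 0 \<epsilon>"
    "\<And>n s. n \<ge> N \<Longrightarrow> s \<in> ball 0 \<epsilon> \<Longrightarrow> norm (\<beta> n s) \<le> 3"
    and gf: "\<And>n s. n \<ge> N \<Longrightarrow> s \<in> ball 0 \<epsilon> \<Longrightarrow>
      path_gf b 1 0 (exp s) 1 n / path_gf b 1 0 1 1 n = exp (of_nat n * \<alpha> s + \<beta> n s)"
    and nondegenerate: "Im (deriv \<alpha> 0) = 0 \<Longrightarrow> deriv (deriv \<alpha>) 0 \<noteq> 0"
    by (rule exists_quasi_powers[OF assms]) blast
  \<comment> \<open>Compositions of index n correspond to paths with sum n - 1. The missing
    \<open>\<alpha> s\<close> moves into the bounded part, which raises its bound from 3 to 4 and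
    the threshold to \<open>Suc N\<close>.\<close>
  interpret pmf_quasi_powers "random_composition b" "\<lambda>n ks. real (largest_exponent ks)"
    \<alpha> "\<lambda>n s. \<beta> (n - 1) s - \<alpha> s" \<epsilon> 1 4 "Suc N"
  proof
    show "finite (set_pmf (random_composition b n))" for n
      using finite_compositions[OF assms] compositions_nonempty[OF assms]
      by (simp add: random_composition_def)
    fix n assume n: "n \<ge> Suc N"
    then obtain n' where n': "n = Suc n'" "n' \<ge> N" by (cases n) auto
    show "(\<lambda>s. \<beta> (n - 1) s - \<alpha> s) holomorphic_on ball 0 \<epsilon>"
      using n' by (intro holomorphic_intros \<alpha> \<beta>) simp
    fix s :: complex assume s: "s \<in> ball 0 \<epsilon>"
    show "norm (\<beta> (n - 1) s - \<alpha> s) \<le> 4"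
      using norm_triangle_ineq4[of "\<beta> n' s" "\<alpha> s"] \<alpha>(2)[OF s] \<beta>(2)[OF n'(2) s] n' by simp
    have "measure_pmf.expectation (random_composition b n) (\<lambda>ks. exp (s * of_real (real (largest_exponent ks))))
        = path_gf b 1 0 (exp s) 1 n' / path_gf b 1 0 1 1 n'"
      unfolding n'(1) mgf_random_composition[OF assms]
      by (simp add: path_gf_def exp_of_nat2_mult[symmetric] del: of_nat_Suc power_Suc)
    also have "\<dots> = exp (of_nat n' * \<alpha> s + \<beta> n' s)" by (rule gf[OF n'(2) s])
    finally show "measure_pmf.expectation (random_composition b n) (\<lambda>ks. exp (s * of_real (real (largest_exponent ks))))
        = exp (of_nat n * \<alpha> s + (\<beta> (n - 1) s - \<alpha> s))"
      by (simp add: n' algebra_simps)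
  qed (use \<epsilon> \<alpha> in auto)
  let ?v = "Re (deriv (deriv \<alpha>) 0)"
  have "deriv (deriv \<alpha>) 0 \<noteq> 0" using deriv_\<alpha>_real(1) by (rule nondegenerate)
  then have "?v \<noteq> 0" using deriv_\<alpha>_real(2) by (simp add: complex_eq_iff)
  then have pos: "?v > 0" using var_slope_nonneg by simp
  show ?thesis
  proof (intro exI conjI)
    show "Defs.asymptotically_normal (random_composition b) (\<lambda>n ks. real (largest_exponent ks))"
      by (rule asymptotically_normal[OF pos])
    show "(\<lambda>n. mean n - Re (deriv \<alpha> 0) * real n) \<in> O(\<lambda>n. 1)" by (rule mean_bigo)
    show "(\<lambda>n. var n - (sqrt ?v)\<^sup>2 * real n) \<in> O(\<lambda>n. 1)"
      using var_bigo pos by simp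
  qed
qed

end
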